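(* Let $r\in\mathbb{N}$, $k\in\mathbb{Z}_+$ with $k\leqslant r-1$, $t\in(-1,1)$, and let $\mathscr{R}=\mathscr{O}$ or $\mathscr{R}=\mathscr{L}$. Then, for every $\delta>0$, there exists a unique $\lambda=\lambda(\delta)>0$ such that $\delta\lambda\,\|u_{\lambda,t}\|_2=\|u_{\lambda,t}^{(r)}\|_2$, and for this $\lambda$ \[ \Omega_t(\delta)=\mathcal{E}_\delta\left(\mathscr{R};D^k_t;W^r_2\right)=\left\|u_{\lambda,t}^{(r)}\right\|_2\delta+\left\|u_{\lambda,t}\right\|_2 . \]
   Context: Let $\mathbb{I}=[-1,1]$, $L_2=L_2(\mathbb{I})$ (real-valued functions) with norm $\|f\|_2=\left(\int_{-1}^1|f(x)|^2\,dx\right)^{1/2}$. For $m\in\mathbb{N}$, $L_2^m$ is the space of functions $f:\mathbb{I}\to\mathbb{R}$ having absolutely continuous derivative $f^{(m-1)}$ and such that $f^{(m)}\in L_2$; $L_2^m((a,b))$ is the analogous space on an interval $(a,b)$. Let $W^r_2=\{f\in L_2^r:\|f^{(r)}\|_2\leqslant 1\}$. For $\lambda\geqslant 0$ and $t\in(-1,1)$ (with $r,k$ fixed), $u_{\lambda,t}$ denotes the unique function whose restrictions to $(-1,t)$ and $(t,1)$ belong to $L_2^{2r}((-1,t))$ and $L_2^{2r}((t,1))$ respectively and which satisfies \[ \begin{cases}(-1)^ru^{(2r)}(x)+\lambda u(x)=0,& x\in(-1,t)\cup(t,1),\\ u^{(s)}(-1)=u^{(s)}(1)=0,& s=0,1,\ldots,r-1,\\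 u^{(s)}(t+0)-u^{(s)}(t-0)=(-1)^{k-1}\delta_{r-k-1,s},& s=0,1,\ldots,2r-1,\end{cases} \] where $\delta_{i,j}$ is the Kronecker symbol. The derivatives $u_{\lambda,t}^{(s)}$ are taken on $(-1,t)\cup(t,1)$; for $0\leqslant s\leqslant 2r-1$, $s\ne r-k-1$, they are extended to $\mathbb{I}$ by continuity. $D^k_t$ is the functional $f\mapsto f^{(k)}(t)$ (from $L_2$ to $\mathbb{R}$, with domain $L_2^r$). Its modulus of continuity on $W^r_2$ is \[ \Omega_t(\delta)=\Omega(\delta;D^k_t;W^r_2)=\sup\{|f^{(k)}(t)|: f\in W^r_2,\ \|f\|_2\leqslant\delta\}. \] Optimal recovery: $\mathscr{L}$ is the set of all linear maps $S:L_2\to\mathbb{R}$ and $\mathscr{O}$ is the set of all mappings $S:L_2\to\mathbb{R}$. For $\mathscr{R}\in\{\mathscr{L},\mathscr{O}\}$, \[ \mathcal{E}_\delta(\mathscr{R};D^k_t;W^r_2)=\inf_{S\in\mathscr{R}}\ \sup\{|f^{(k)}(t)-Sg|: f\in W^r_2,\ g\in L_2,\ \|f-g\|_2\leqslant\delta\}. \] *)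

theory Defs
  imports "HOL-Analysis.Analysis"
begin

text \<open>Functions on a set \<open>S\<close> of reals are total functions \<open>real \<Rightarrow> real\<close>; only their values on
  \<open>S\<close> matter. Derivatives are taken relative to \<open>S\<close>, so they are one-sided at an end point
  belonging to \<open>S\<close>.\<close>

primrec deriv_on :: "real set \<Rightarrow> nat \<Rightarrow> (real \<Rightarrow> real) \<Rightarrow> real \<Rightarrow> real" where
  "deriv_on S 0 f = f"
| "deriv_on S (Suc n) f = (\<lambda>x. vector_derivative (deriv_on S n f) (at x within S))"

definition absolutely_continuous_on :: "real set \<Rightarrow> (real \<Rightarrow> real) \<Rightarrow> bool" where
  "absolutely_continuous_on S f \<longleftrightarrow>
    (\<forall>\<epsilon>>0. \<exists>\<eta>>0. \<forall>(n::nat) a b.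
       (\<forall>i<n. a i \<le> b i \<and> {a i..b i} \<subseteq> S) \<and>
       disjoint_family_on (\<lambda>i. {a i<..<b i}) {..<n} \<and>
       (\<Sum>i<n. b i - a i) < \<eta>
       \<longrightarrow> (\<Sum>i<n. \<bar>f (b i) - f (a i)\<bar>) < \<epsilon>)"

definition L2 :: "real set \<Rightarrow> (real \<Rightarrow> real) set" where
  "L2 S = {f. f \<in> borel_measurable (lebesgue_on S) \<and>
              integrable (lebesgue_on S) (\<lambda>x. \<bar>f x\<bar>\<^sup>2)}"

definition L2_norm :: "(real \<Rightarrow> real) \<Rightarrow> real" where
  "L2_norm f = sqrt (integral\<^sup>L (lebesgue_on {-1..1}) (\<lambda>x. \<bar>f x\<bar>\<^sup>2))"

text \<open>The space \<open>L\<^sub>2\<^sup>m\<close> on an interval \<open>S\<close>, for \<open>m \<ge> 1\<close>. The derivative of order \<open>m\<close> need only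
  exist almost everywhere. Its existence almost everywhere follows from absolute continuity of the
  derivative of order \<open>m - 1\<close>; it is listed because \<^const>\<open>vector_derivative\<close> is total, so that
  membership of \<open>f\<^sup>(\<^sup>m\<^sup>)\<close> in \<open>L\<^sub>2\<close> would not by itself express it.\<close>

definition L2_deriv :: "real set \<Rightarrow> nat \<Rightarrow> (real \<Rightarrow> real) set" where
  "L2_deriv S m = {f.
     (\<forall>j<m - 1. \<forall>x\<in>S. deriv_on S j f differentiable (at x within S)) \<and>
     absolutely_continuous_on S (deriv_on S (m - 1) f) \<and>
     (AE x in lebesgue_on S. deriv_on S (m - 1) f differentiable (at x within S)) \<and>
     deriv_on S m f \<in> L2 S}"

definition W2 :: "nat \<Rightarrow> (real \<Rightarrow> real) set" where
  "W2 r = {f \<in> L2_deriv {-1..1} r. L2_norm (deriv_on {-1..1} r f) \<le> 1}"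

definition punctured :: "real \<Rightarrow> real set" where
  "punctured t = {-1<..<t} \<union> {t<..<1}"

text \<open>Values at \<open>-1\<close>, \<open>1\<close> and \<open>t \<plusminus> 0\<close> are one-sided limits. The sign \<open>(-1)\<^sup>k\<^sup>-\<^sup>1\<close> is written
  \<open>(-1)\<^sup>k\<^sup>+\<^sup>1\<close>, which also covers \<open>k = 0\<close>.\<close>

definition bvp_solution :: "nat \<Rightarrow> nat \<Rightarrow> real \<Rightarrow> real \<Rightarrow> (real \<Rightarrow> real) \<Rightarrow> bool" where
  "bvp_solution r k \<mu> t u \<longleftrightarrow>
     u \<in> L2_deriv {-1<..<t} (2 * r) \<and> u \<in> L2_deriv {t<..<1} (2 * r) \<and>
     (\<forall>x\<in>punctured t.
        deriv_on (punctured t) (2 * r - 1) u differentiable (at x) \<and>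
        (-1) ^ r * deriv_on (punctured t) (2 * r) u x + \<mu> * u x = 0) \<and>
     (\<forall>s<r. (deriv_on (punctured t) s u \<longlongrightarrow> 0) (at_right (-1)) \<and>
            (deriv_on (punctured t) s u \<longlongrightarrow> 0) (at_left 1)) \<and>
     (\<forall>s<2 * r. \<exists>p q.
        (deriv_on (punctured t) s u \<longlongrightarrow> p) (at_right t) \<and>
        (deriv_on (punctured t) s u \<longlongrightarrow> q) (at_left t) \<and>
        p - q = (-1) ^ (k + 1) * (if s = r - k - 1 then 1 else 0))"

text \<open>The solution is determined on \<^term>\<open>punctured t\<close>; elsewhere it is set to \<open>0\<close> so that it is
  unique as a total function. The three points \<open>-1\<close>, \<open>t\<close>, \<open>1\<close> do not affect \<^const>\<open>L2_norm\<close>.\<close>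

definition u_sol :: "nat \<Rightarrow> nat \<Rightarrow> real \<Rightarrow> real \<Rightarrow> real \<Rightarrow> real" where
  "u_sol r k \<mu> t = (THE u. bvp_solution r k \<mu> t u \<and> (\<forall>x. x \<notin> punctured t \<longrightarrow> u x = 0))"

definition u_deriv :: "nat \<Rightarrow> nat \<Rightarrow> real \<Rightarrow> real \<Rightarrow> nat \<Rightarrow> real \<Rightarrow> real" where
  "u_deriv r k \<mu> t s = deriv_on (punctured t) s (u_sol r k \<mu> t)"

text \<open>Suprema and infima are taken in the extended reals, since the error of a recovery map may be
  infinite.\<close>

definition modulus :: "nat \<Rightarrow> nat \<Rightarrow> real \<Rightarrow> real \<Rightarrow> ereal" where
  "modulus r k t \<delta> =
     Sup {ereal \<bar>deriv_on {-1..1} k f t\<bar> | f. f \<in> W2 r \<and> L2_norm f \<le> \<delta>}"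

text \<open>Elements of \<open>L\<^sub>2\<close> are functions up to equality almost everywhere, so a map on \<open>L\<^sub>2\<close> is a map on
  functions respecting that equality.\<close>

definition all_maps :: "((real \<Rightarrow> real) \<Rightarrow> real) set" where
  "all_maps = {S. \<forall>f\<in>L2 {-1..1}. \<forall>g\<in>L2 {-1..1}.
     (AE x in lebesgue_on {-1..1}. f x = g x) \<longrightarrow> S f = S g}"

definition linear_maps :: "((real \<Rightarrow> real) \<Rightarrow> real) set" where
  "linear_maps = {S \<in> all_maps. \<forall>f\<in>L2 {-1..1}. \<forall>g\<in>L2 {-1..1}. \<forall>a b.
     S (\<lambda>x. a * f x + b * g x) = a * S f + b * S g}"

definition recovery_error ::
    "real \<Rightarrow> ((real \<Rightarrow> real) \<Rightarrow> real) set \<Rightarrow> nat \<Rightarrow> nat \<Rightarrow> real \<Rightarrow> ereal" where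
  "recovery_error \<delta> R r k t =
     (INF S\<in>R. Sup {ereal \<bar>deriv_on {-1..1} k f t - S g\<bar> | f g.
        f \<in> W2 r \<and> g \<in> L2 {-1..1} \<and> L2_norm (\<lambda>x. f x - g x) \<le> \<delta>})"

end

theory Submission
  imports Defs "Jordan_Normal_Form.Determinant"
begin

text \<open>Write \<open>u = u\<^bsub>\<mu>,t\<^esub>\<close> and let \<open>w\<close> be the continuous extension of \<open>u\<^sup>(\<^sup>r\<^sup>)\<close>. Integrating by parts on
  both sides of \<open>t\<close> gives, for every \<open>f\<close> in \<open>L\<^sub>2\<^sup>r\<close>,
  \<open>f\<^sup>(\<^sup>k\<^sup>)(t) = \<integral> f w + (-1)\<^sup>r\<^sup>+\<^sup>1 \<integral> f\<^sup>(\<^sup>r\<^sup>) u\<close>.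
  By Cauchy-Schwarz, both the modulus of continuity and the error of the linear method
  \<open>g \<mapsto> \<integral> g w\<close> are at most \<open>\<delta> \<parallel>w\<parallel> + \<parallel>u\<parallel>\<close>. Since \<open>w\<^sup>(\<^sup>r\<^sup>) = (-1)\<^sup>r\<^sup>+\<^sup>1 \<mu> u\<close>, the function
  \<open>w / (\<mu> \<parallel>u\<parallel>)\<close> attains this bound as soon as \<open>\<delta> \<mu> \<parallel>u\<parallel> = \<parallel>w\<parallel>\<close>.

  A \<open>\<mu>\<close> with this property exists by the intermediate value theorem: the identity applied to the
  functions \<open>w\<close> for two parameters shows that the norms depend continuously on \<open>\<mu>\<close>, and test
  polynomials control the limits \<open>\<mu> \<rightarrow> 0\<close> and \<open>\<mu> \<rightarrow> \<infinity>\<close>. It is unique because two such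
  parameters force equality in Cauchy-Schwarz, so that the two pairs \<open>(u, w)\<close> are proportional, and
  test functions then show that they coincide.

  The function \<open>u\<close> itself is a combination of power series solving \<open>u\<^sup>(\<^sup>2\<^sup>r\<^sup>) = (-1)\<^sup>r\<^sup>+\<^sup>1 \<mu> u\<close>. The
  identity with \<open>f = u\<^sup>(\<^sup>r\<^sup>)\<close> shows that the homogeneous problem has only the zero solution, which
  gives both uniqueness and the solvability of the linear system for the coefficients.\<close>

section \<open>Absolutely continuous functions\<close>

text \<open>The obstacle is regularity. A function of L_2^r has its r-th derivative almost
  everywhere only, so integration by parts rests on the fundamental theorem for absolutely
  continuous functions, and u itself is smooth on each closed half but jumps at t. The function w is
  still admissible as f, because the jump sits at order r-k-1 < r and the orders r, ..., 2r-1 are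
  continuous across t. The same order explains the functional: in the boundary sum at t the jump of
  u^(r-k-1) is paired with f^(k) and with nothing else. Inserting the w of a parameter \<nu> into
  the identity for \<mu> gives inner products that are symmetric in the two parameters, up to one
  factor \<nu>. Playing the two orders against each other yields the energy comparison, the
  continuity and the uniqueness without any formula for u. Test polynomials come in two kinds:
  y^k/k! is annihilated by the r-th derivative and tests w alone, while its product with a high
  power of 1 - y^2/4 has small norm and forces u to contribute. The lower bound for arbitrary
  methods uses that f and -f share the data g = 0.\<close>

lemma absolutely_continuous_on_finite_family:
  assumes "absolutely_continuous_on S F" "\<epsilon> > 0"
  obtains \<eta> where "\<eta> > 0"
    "\<And>(P::'i set) l u. finite P \<Longrightarrow> \<forall>i\<in>P. l i \<le> u i \<and> {l i..u i} \<subseteq> S \<Longrightarrow>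
       disjoint_family_on (\<lambda>i. {l i<..<u i}) P \<Longrightarrow> (\<Sum>i\<in>P. u i - l i) < \<eta> \<Longrightarrow>
       (\<Sum>i\<in>P. \<bar>F (u i) - F (l i)\<bar>) < \<epsilon>"
proof -
  obtain \<eta> where "\<eta> > 0" and \<eta>: "\<And>(n::nat) a b.
       (\<forall>i<n. a i \<le> b i \<and> {a i..b i} \<subseteq> S) \<Longrightarrow>
       disjoint_family_on (\<lambda>i. {a i<..<b i}) {..<n} \<Longrightarrow> (\<Sum>i<n. b i - a i) < \<eta>
       \<Longrightarrow> (\<Sum>i<n. \<bar>F (b i) - F (a i)\<bar>) < \<epsilon>"
    using assms unfolding absolutely_continuous_on_def by meson
  show thesis
  proof
    show "\<eta> > 0" by fact
    fix P :: "'i set" and l u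
    assume P: "finite P" "\<forall>i\<in>P. l i \<le> u i \<and> {l i..u i} \<subseteq> S"
      "disjoint_family_on (\<lambda>i. {l i<..<u i}) P" "(\<Sum>i\<in>P. u i - l i) < \<eta>"
    \<comment> \<open>The definition numbers its intervals by \<open>{..<n}\<close>; an enumeration
      of \<open>P\<close> reduces to it the families indexed by the pairs of a tagged
      division.\<close>
    obtain h where h: "bij_betw h {0..<card P} P"
      using ex_bij_betw_nat_finite[OF P(1)] by blast
    then have h: "bij_betw h {..<card P} P" by (simp add: atLeast0LessThan)
    have hP: "h i \<in> P" if "i < card P" for i using h that by (auto simp: bij_betw_def)
    have "(\<Sum>i<card P. \<bar>F (u (h i)) - F (l (h i))\<bar>) < \<epsilon>"
    proof (rule \<eta>)
      show "\<forall>i<card P. l (h i) \<le> u (h i) \<and> {l (h i)..u (h i)} \<subseteq> S" using P(2) hP by blast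
      show "disjoint_family_on (\<lambda>i. {l (h i)<..<u (h i)}) {..<card P}"
        unfolding disjoint_family_on_def
      proof (intro ballI impI)
        fix i j assume "i \<in> {..<card P}" "j \<in> {..<card P}" "i \<noteq> j"
        then have "h i \<noteq> h j" "h i \<in> P" "h j \<in> P"
          using h hP unfolding bij_betw_def inj_on_def by auto
        then show "{l (h i)<..<u (h i)} \<inter> {l (h j)<..<u (h j)} = {}"
          using P(3) unfolding disjoint_family_on_def by blast
      qed
      show "(\<Sum>i<card P. u (h i) - l (h i)) < \<eta>"
        using P(4) sum.reindex_bij_betw[OF h, of "\<lambda>i. u i - l i"] by simp
    qed
    then show "(\<Sum>i\<in>P. \<bar>F (u i) - F (l i)\<bar>) < \<epsilon>"
      using sum.reindex_bij_betw[OF h, of "\<lambda>i. \<bar>F (u i) - F (l i)\<bar>"] by simp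
  qed
qed

text \<open>The sum is the measure of a disjoint union inside \<open>T\<close>.\<close>

lemma sum_length_disjoint_intervals_le:
  fixes T :: "real set"
  assumes "finite P" "disjoint_family_on (\<lambda>i. {l i<..<u i}) P" "\<And>i. i \<in> P \<Longrightarrow> l i \<le> u i"
    "\<And>i. i \<in> P \<Longrightarrow> {l i<..<u i} \<subseteq> T" "T \<in> sets lebesgue" "emeasure lebesgue T < ennreal e" "e > 0"
  shows "(\<Sum>i\<in>P. u i - l i) < e"
proof -
  have "ennreal (\<Sum>i\<in>P. u i - l i) = (\<Sum>i\<in>P. ennreal (u i - l i))"
    using assms(3) by (simp add: sum_ennreal)
  also have "\<dots> = (\<Sum>i\<in>P. emeasure lebesgue {l i<..<u i})"
    using assms(3) by (intro sum.cong) auto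
  also have "\<dots> = emeasure lebesgue (\<Union>i\<in>P. {l i<..<u i})"
    by (rule sum_emeasure) (use assms in auto)
  also have "\<dots> \<le> emeasure lebesgue T"
    by (rule emeasure_mono) (use assms in auto)
  also have "\<dots> < ennreal e" by fact
  finally show ?thesis
    using ennreal_less_iff sum_nonneg[of P "\<lambda>i. u i - l i"] assms(3) by auto
qed

text \<open>The gauge takes care of the exceptional set. At a tag in \<open>N\<close> the ball is
  kept inside an open \<open>T\<close> containing \<open>N\<close> of measure below \<eta>, so the
  cells tagged there are short in total and absolute continuity bounds the increments of
  \<open>F\<close> over them. At any other tag differentiability controls the cell.\<close>

lemma fundamental_theorem_of_calculus_absolutely_continuous:
  fixes F g :: "real \<Rightarrow> real"
  assumes "a \<le> b" and ac: "absolutely_continuous_on {a..b} F" and N: "negligible N"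
    and der: "\<And>x. x \<in> {a..b} - N \<Longrightarrow> (F has_vector_derivative g x) (at x within {a..b})"
  shows "(g has_integral (F b - F a)) {a..b}"
proof -
  \<comment> \<open>Cells tagged in \<open>N\<close> then contribute nothing to the Riemann sum;
    only their increments of \<open>F\<close> remain.\<close>
  define g0 where "g0 x = (if x \<in> N then 0 else g x)" for x
  have "(g0 has_integral (F b - F a)) (cbox a b)"
    unfolding has_integral
  proof (intro allI impI)
    fix e :: real assume e: "e > 0"
    \<comment> \<open>The summand 1 keeps the quotient meaningful when \<open>a = b\<close> and
      leaves \<open>e1 * (b - a)\<close> strictly below \<open>e / 2\<close>.\<close>
    define e1 where "e1 = e / (2 * (b - a + 1))"
    have e1: "e1 > 0" "e1 * (b - a) < e / 2"
      using e \<open>a \<le> b\<close> by (auto simp: e1_def divide_simps)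
    obtain \<eta> where \<eta>: "\<eta> > 0" 
      "\<And>(P::(real \<times> real set) set) l u. finite P \<Longrightarrow> \<forall>i\<in>P. l i \<le> u i \<and> {l i..u i} \<subseteq> {a..b} \<Longrightarrow>
       disjoint_family_on (\<lambda>i. {l i<..<u i}) P \<Longrightarrow> (\<Sum>i\<in>P. u i - l i) < \<eta> \<Longrightarrow>
       (\<Sum>i\<in>P. \<bar>F (u i) - F (l i)\<bar>) < e / 2"
      by (rule absolutely_continuous_on_finite_family[OF ac half_gt_zero[OF e]]) blast
    have Nn: "N \<in> null_sets lebesgue" using N negligible_iff_null_sets by blast
    obtain T where T: "open T" "N \<subseteq> T" "emeasure lebesgue (T - N) < ennreal \<eta>"
      using sets_lebesgue_outer_open[of N \<eta>] Nn \<eta>(1) by blast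
    have Tm: "T \<in> sets lebesgue" using T(1) by simp
    have T\<eta>: "emeasure lebesgue T < ennreal \<eta>"
      using T(3) emeasure_Diff_null_set[OF Nn Tm] by simp
    have "\<exists>d>0. (x \<in> N \<longrightarrow> ball x d \<subseteq> T) \<and> (x \<in> {a..b} - N \<longrightarrow>
         (\<forall>y\<in>{a..b}. norm (y-x) < d \<longrightarrow> norm (F y - F x - (y-x) *\<^sub>R g x) \<le> e1 * norm (y-x)))" for x
    proof (cases "x \<in> N")
      case True then show ?thesis using T openE by (metis DiffE subsetD)
    next
      case False
      then show ?thesis
        using der[of x, unfolded has_vector_derivative_def has_derivative_within_alt] e1(1)
        by (metis DiffD1 DiffI zero_less_one)
    qed
    then obtain d where d: "\<And>x. d x > 0" "\<And>x. x \<in> N \<Longrightarrow> ball x (d x) \<subseteq> T"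
      "\<And>x y. x \<in> {a..b} - N \<Longrightarrow> y \<in> {a..b} \<Longrightarrow> norm (y-x) < d x \<Longrightarrow>
         norm (F y - F x - (y-x) *\<^sub>R g x) \<le> e1 * norm (y-x)"
      by metis
    show "\<exists>\<gamma>. gauge \<gamma> \<and> (\<forall>D. D tagged_division_of cbox a b \<and> \<gamma> fine D \<longrightarrow>
         norm ((\<Sum>(x, k)\<in>D. measure lborel k *\<^sub>R g0 x) - (F b - F a)) < e)"
    proof (intro exI conjI allI impI)
      show "gauge (\<lambda>x. ball x (d x))" using d(1) gauge_ball_dependent by blast
      fix p assume "p tagged_division_of cbox a b \<and> (\<lambda>x. ball x (d x)) fine p"
      then have ptag: "p tagged_division_of cbox a b" and finep: "(\<lambda>x. ball x (d x)) fine p" by auto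
      have fin: "finite p" using ptag by blast
      have ba: "b - a = (\<Sum>(x,K)\<in>p. Sup K - Inf K)" "F b - F a = (\<Sum>(x,K)\<in>p. F(Sup K) - F(Inf K))"
        using additive_tagged_division_1[where f= "\<lambda>x. x"] additive_tagged_division_1[where f= F]
              \<open>a \<le> b\<close> ptag by auto
      have K: "\<exists>u v. K = {u..v} \<and> u \<le> v \<and> Inf K = u \<and> Sup K = v \<and> x \<in> K \<and> K \<subseteq> {a..b} \<and> K \<subseteq> ball x (d x)"
        if xK: "(x,K) \<in> p" for x K
      proof -
        obtain u v where uv: "K = cbox u v" "x \<in> K" "K \<subseteq> cbox a b"
          using tagged_division_ofD(2-4)[OF ptag xK] by metis
        moreover have "K \<subseteq> ball x (d x)" using fineD[OF finep xK] .
        moreover have "u \<le> v" using uv by simp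
        moreover from this have "Inf K = u" "Sup K = v" using uv(1) by simp_all
        ultimately show ?thesis by (intro exI[of _ u] exI[of _ v]) simp
      qed
      define P where "P = {(x,K) \<in> p. x \<in> N}"
      have P: "P \<subseteq> p" by (auto simp: P_def)
      have "finite P" using P fin finite_subset by blast
      have int: "{Inf (snd i)<..<Sup (snd i)} = interior (snd i)" if "i \<in> P" for i
      proof -
        have "(fst i, snd i) \<in> p" using that P by auto
        from K[OF this] obtain u v where "snd i = {u..v}" "Inf (snd i) = u" "Sup (snd i) = v" by blast
        then show ?thesis by (metis interior_atLeastAtMost_real)
      qed
      have bad: "(\<Sum>i\<in>P. \<bar>F (Sup (snd i)) - F (Inf (snd i))\<bar>) < e / 2"
      proof (rule \<eta>(2))
        show "finite P" by fact
        show "\<forall>i\<in>P. Inf (snd i) \<le> Sup (snd i) \<and> {Inf (snd i)..Sup (snd i)} \<subseteq> {a..b}"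
        proof
          fix i assume "i \<in> P"
          then show "Inf (snd i) \<le> Sup (snd i) \<and> {Inf (snd i)..Sup (snd i)} \<subseteq> {a..b}"
            using K[of "fst i" "snd i"] P by fastforce
        qed
        show disj: "disjoint_family_on (\<lambda>i. {Inf (snd i)<..<Sup (snd i)}) P"
          unfolding disjoint_family_on_def
        proof (intro ballI impI)
          fix i j assume ij: "i \<in> P" "j \<in> P" "i \<noteq> j"
          have "interior (snd i) \<inter> interior (snd j) = {}"
            using tagged_division_ofD(5)[OF ptag, of "fst i" "snd i" "fst j" "snd j"] ij P by auto
          then show "{Inf (snd i)<..<Sup (snd i)} \<inter> {Inf (snd j)<..<Sup (snd j)} = {}"
            using int[OF ij(1)] int[OF ij(2)] by simp
        qed
        show "(\<Sum>i\<in>P. Sup (snd i) - Inf (snd i)) < \<eta>"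
        proof (rule sum_length_disjoint_intervals_le[OF \<open>finite P\<close> disj _ _ Tm T\<eta> \<eta>(1)])
          fix i assume i: "i \<in> P"
          then have pi: "(fst i, snd i) \<in> p" "fst i \<in> N" by (auto simp: P_def)
          from K[OF pi(1)] show "Inf (snd i) \<le> Sup (snd i)" by auto
          from K[OF pi(1)] d(2)[OF pi(2)] show "{Inf (snd i)<..<Sup (snd i)} \<subseteq> T"
            by fastforce
        qed
      qed
      have good: "norm (\<Sum>(x, K) \<in> p - P. (measure lborel K *\<^sub>R g0 x) - (F (Sup K) - F (Inf K)))
          \<le> (\<Sum>n\<in>p - P. e1 * (case n of (x, k) \<Rightarrow> Sup k - Inf k))"
      proof (rule sum_norm_le, safe)
        fix x K assume xK: "(x,K) \<in> p" "(x,K) \<notin> P"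
        then have xN: "x \<notin> N" by (auto simp: P_def)
        obtain u v where k: "K = {u..v}" "u \<le> v" "Inf K = u" "Sup K = v" "x \<in> K" "K \<subseteq> {a..b}"
           "K \<subseteq> ball x (d x)"
          using K[OF xK(1)] by blast
        have x: "x \<in> {a..b} - N" using k xN by auto
        have "u \<in> K" "v \<in> K" using k by auto
        then have uv: "u \<in> {a..b}" "v \<in> {a..b}" "norm (u - x) < d x" "norm (v - x) < d x"
          using subsetD[OF k(6)] subsetD[OF k(7)] by (auto simp: dist_real_def abs_minus_commute)
        \<comment> \<open>The tag lies between \<open>u\<close> and \<open>v\<close>, so the errors
          made at the two ends add up to \<open>e1\<close> times the length of the cell.\<close>
        have "norm ((v - u) *\<^sub>R g x - (F v - F u)) = norm (F u - F x - (u - x) *\<^sub>R g x - (F v - F x - (v - x) *\<^sub>R g x))"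
          by (auto simp: algebra_simps)
        also have "\<dots> \<le> norm (F u - F x - (u - x) *\<^sub>R g x) + norm (F v - F x - (v - x) *\<^sub>R g x)"
          by (rule norm_triangle_ineq4)
        also have "\<dots> \<le> e1 * norm (u - x) + e1 * norm (v - x)"
          using d(3)[OF x uv(1) uv(3)] d(3)[OF x uv(2) uv(4)] by auto
        also have "\<dots> = e1 * (v - u)" using k by (simp add: algebra_simps)
        finally show "norm (measure lborel K *\<^sub>R g0 x - (F (Sup K) - F (Inf K))) \<le> e1 * (Sup K - Inf K)"
          using k xN by (simp add: g0_def)
      qed
      also have "\<dots> \<le> (\<Sum>n\<in>p. e1 * (case n of (x, k) \<Rightarrow> Sup k - Inf k))"
        using K e1(1) fin by (intro sum_mono2) (fastforce intro!: mult_nonneg_nonneg)+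
      also have "\<dots> = e1 * (b - a)" unfolding ba(1) by (simp add: sum_distrib_left case_prod_unfold)
      finally have good: "norm (\<Sum>(x, K) \<in> p - P. (measure lborel K *\<^sub>R g0 x) - (F (Sup K) - F (Inf K))) < e / 2"
        using e1(2) by linarith
      have "(\<Sum>(x, k)\<in>p. measure lborel k *\<^sub>R g0 x) - (F b - F a)
          = (\<Sum>(x, K) \<in> p. (measure lborel K *\<^sub>R g0 x) - (F (Sup K) - F (Inf K)))"
        unfolding ba(2) by (simp add: sum_subtractf case_prod_unfold)
      also have "\<dots> = (\<Sum>(x, K) \<in> p - P. (measure lborel K *\<^sub>R g0 x) - (F (Sup K) - F (Inf K)))
          + (\<Sum>(x, K) \<in> P. (measure lborel K *\<^sub>R g0 x) - (F (Sup K) - F (Inf K)))"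
        using sum.subset_diff[OF P fin] by blast
      also have "(\<Sum>(x, K) \<in> P. (measure lborel K *\<^sub>R g0 x) - (F (Sup K) - F (Inf K)))
          = - (\<Sum>i \<in> P. F (Sup (snd i)) - F (Inf (snd i)))"
        unfolding sum_negf[symmetric] by (rule sum.cong) (auto simp: P_def g0_def)
      finally have "(\<Sum>(x, k)\<in>p. measure lborel k *\<^sub>R g0 x) - (F b - F a) =
         (\<Sum>(x, K) \<in> p - P. (measure lborel K *\<^sub>R g0 x) - (F (Sup K) - F (Inf K))) - (\<Sum>i \<in> P. F (Sup (snd i)) - F (Inf (snd i)))"
        by simp
      moreover have "\<bar>\<Sum>i \<in> P. F (Sup (snd i)) - F (Inf (snd i))\<bar> < e / 2"
        using bad sum_abs[of "\<lambda>i. F (Sup (snd i)) - F (Inf (snd i))" P] by linarith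
      ultimately show "norm ((\<Sum>(x, k)\<in>p. measure lborel k *\<^sub>R g0 x) - (F b - F a)) < e"
        using good by (simp only: real_norm_def)
    qed
  qed
  then have "(g0 has_integral (F b - F a)) {a..b}" by simp
  then show ?thesis
    by (rule has_integral_spike[OF N, rotated]) (auto simp: g0_def)
qed

lemma absolutely_continuous_on_subset:
  "absolutely_continuous_on S f \<Longrightarrow> T \<subseteq> S \<Longrightarrow> absolutely_continuous_on T f"
  unfolding absolutely_continuous_on_def by (meson order_trans)

lemma absolutely_continuous_on_cong:
  assumes "\<And>x. x \<in> S \<Longrightarrow> f x = g x"
  shows "absolutely_continuous_on S f \<longleftrightarrow> absolutely_continuous_on S g"
proof -
  have "absolutely_continuous_on S g" if fg: "\<And>x. x \<in> S \<Longrightarrow> f x = g x" 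
    and ac: "absolutely_continuous_on S f" for f g
    unfolding absolutely_continuous_on_def
  proof (intro allI impI)
    fix \<epsilon> :: real assume "\<epsilon> > 0"
    then obtain \<eta> where "\<eta> > 0" and \<eta>: "\<And>(n::nat) a b.
       (\<forall>i<n. a i \<le> b i \<and> {a i..b i} \<subseteq> S) \<and>
       disjoint_family_on (\<lambda>i. {a i<..<b i}) {..<n} \<and> (\<Sum>i<n. b i - a i) < \<eta>
       \<Longrightarrow> (\<Sum>i<n. \<bar>f (b i) - f (a i)\<bar>) < \<epsilon>"
      using ac unfolding absolutely_continuous_on_def by meson
    show "\<exists>\<eta>>0. \<forall>(n::nat) a b.
       (\<forall>i<n. a i \<le> b i \<and> {a i..b i} \<subseteq> S) \<and>
       disjoint_family_on (\<lambda>i. {a i<..<b i}) {..<n} \<and> (\<Sum>i<n. b i - a i) < \<eta>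
       \<longrightarrow> (\<Sum>i<n. \<bar>g (b i) - g (a i)\<bar>) < \<epsilon>"
    proof (intro exI[of _ \<eta>] conjI allI impI)
      fix n :: nat and a b
      assume *: "(\<forall>i<n. a i \<le> b i \<and> {a i..b i} \<subseteq> S) \<and>
       disjoint_family_on (\<lambda>i. {a i<..<b i}) {..<n} \<and> (\<Sum>i<n. b i - a i) < \<eta>"
      have "(\<Sum>i<n. \<bar>g (b i) - g (a i)\<bar>) = (\<Sum>i<n. \<bar>f (b i) - f (a i)\<bar>)"
        using * by (intro sum.cong) (auto simp: fg subset_iff)
      then show "(\<Sum>i<n. \<bar>g (b i) - g (a i)\<bar>) < \<epsilon>" using \<eta>[OF *] by simp
    qed fact
  qed
  then show ?thesis using assms by metis
qed

text \<open>Covers products with a Lipschitz factor, scalar multiples and Lipschitz functions at once.\<close>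

lemma absolutely_continuous_on_dominated:
  assumes ac: "absolutely_continuous_on S f" and "A \<ge> 0" "B \<ge> 0"
    and le: "\<And>x y. x \<in> S \<Longrightarrow> y \<in> S \<Longrightarrow> x \<le> y \<Longrightarrow> \<bar>g y - g x\<bar> \<le> A * \<bar>f y - f x\<bar> + B * (y - x)"
  shows "absolutely_continuous_on S g"
  unfolding absolutely_continuous_on_def
proof (intro allI impI)
  fix \<epsilon> :: real assume e: "\<epsilon> > 0"
  then have "\<epsilon> / (2 * (A + 1)) > 0" using \<open>A \<ge> 0\<close> by simp
  then obtain \<eta> where "\<eta> > 0" and \<eta>: "\<And>(n::nat) a b.
     (\<forall>i<n. a i \<le> b i \<and> {a i..b i} \<subseteq> S) \<and>
     disjoint_family_on (\<lambda>i. {a i<..<b i}) {..<n} \<and> (\<Sum>i<n. b i - a i) < \<eta>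
     \<Longrightarrow> (\<Sum>i<n. \<bar>f (b i) - f (a i)\<bar>) < \<epsilon> / (2 * (A + 1))"
    using ac unfolding absolutely_continuous_on_def by meson
  show "\<exists>\<eta>>0. \<forall>(n::nat) a b.
     (\<forall>i<n. a i \<le> b i \<and> {a i..b i} \<subseteq> S) \<and>
     disjoint_family_on (\<lambda>i. {a i<..<b i}) {..<n} \<and> (\<Sum>i<n. b i - a i) < \<eta>
     \<longrightarrow> (\<Sum>i<n. \<bar>g (b i) - g (a i)\<bar>) < \<epsilon>"
  proof (intro exI[of _ "min \<eta> (\<epsilon> / (2 * (B + 1)))"] conjI allI impI)
    fix n :: nat and a b
    assume *: "(\<forall>i<n. a i \<le> b i \<and> {a i..b i} \<subseteq> S) \<and>
       disjoint_family_on (\<lambda>i. {a i<..<b i}) {..<n} \<and> (\<Sum>i<n. b i - a i) < min \<eta> (\<epsilon> / (2 * (B + 1)))"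
    have "(\<Sum>i<n. \<bar>g (b i) - g (a i)\<bar>) \<le> (\<Sum>i<n. A * \<bar>f (b i) - f (a i)\<bar> + B * (b i - a i))"
    proof (rule sum_mono)
      fix i assume "i \<in> {..<n}"
      then have "a i \<le> b i" "a i \<in> S" "b i \<in> S" using * by (auto simp: subset_iff)
      then show "\<bar>g (b i) - g (a i)\<bar> \<le> A * \<bar>f (b i) - f (a i)\<bar> + B * (b i - a i)"
        using le by blast
    qed
    also have "\<dots> = A * (\<Sum>i<n. \<bar>f (b i) - f (a i)\<bar>) + B * (\<Sum>i<n. b i - a i)"
      by (simp add: sum.distrib sum_distrib_left)
    also have "\<dots> \<le> A * (\<epsilon> / (2 * (A + 1))) + B * (\<epsilon> / (2 * (B + 1)))"
      using \<eta>[of n a b] * \<open>A \<ge> 0\<close> \<open>B \<ge> 0\<close> by (intro add_mono mult_left_mono) auto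
    also have "\<dots> < \<epsilon> / 2 + \<epsilon> / 2"
      using e \<open>A \<ge> 0\<close> \<open>B \<ge> 0\<close> by (intro add_strict_mono) (auto simp: divide_simps)
    finally show "(\<Sum>i<n. \<bar>g (b i) - g (a i)\<bar>) < \<epsilon>" by simp
  qed (use \<open>\<eta> > 0\<close> e \<open>B \<ge> 0\<close> in auto)
qed

lemma absolutely_continuous_on_lipschitz:
  assumes "B \<ge> 0" "\<And>x y. x \<in> S \<Longrightarrow> y \<in> S \<Longrightarrow> x \<le> y \<Longrightarrow> \<bar>g y - g x\<bar> \<le> B * (y - x)"
  shows "absolutely_continuous_on S g"
proof (rule absolutely_continuous_on_dominated[where f = "\<lambda>_. 0" and A = 0 and B = B])
  show "absolutely_continuous_on S (\<lambda>_. 0)" 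
    unfolding absolutely_continuous_on_def by (auto intro!: exI[of _ 1])
qed (use assms in auto)

lemma absolutely_continuous_on_imp_continuous_on:
  fixes f :: "real \<Rightarrow> real"
  assumes "absolutely_continuous_on S f" "is_interval S"
  shows "continuous_on S f"
  unfolding continuous_on_iff
proof (intro ballI allI impI)
  fix x e :: real assume x: "x \<in> S" and e: "e > 0"
  obtain \<eta> where \<eta>: "\<eta> > 0" 
      "\<And>(P::nat set) l u. finite P \<Longrightarrow> \<forall>i\<in>P. l i \<le> u i \<and> {l i..u i} \<subseteq> S \<Longrightarrow>
       disjoint_family_on (\<lambda>i. {l i<..<u i}) P \<Longrightarrow> (\<Sum>i\<in>P. u i - l i) < \<eta> \<Longrightarrow>
       (\<Sum>i\<in>P. \<bar>f (u i) - f (l i)\<bar>) < e"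
    by (rule absolutely_continuous_on_finite_family[OF assms(1) e]) blast
  have *: "\<bar>f v - f u\<bar> < e" if "u \<in> S" "v \<in> S" "u \<le> v" "v - u < \<eta>" for u v
  proof -
    have "{u..v} \<subseteq> S" using that assms(2) by (meson atLeastAtMost_iff mem_is_interval_1_I subsetI)
    then show ?thesis using \<eta>(2)[of "{0}" "\<lambda>_. u" "\<lambda>_. v"] that by (auto simp: disjoint_family_on_def)
  qed
  show "\<exists>d>0. \<forall>x'\<in>S. dist x' x < d \<longrightarrow> dist (f x') (f x) < e"
  proof (intro exI[of _ \<eta>] conjI ballI impI)
    fix y assume y: "y \<in> S" "dist y x < \<eta>"
    show "dist (f y) (f x) < e"
      using *[of x y] *[of y x] x y by (cases "x \<le> y") (auto simp: dist_real_def abs_minus_commute)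
  qed (rule \<eta>(1))
qed

lemma C1_lipschitz:
  fixes v :: "real \<Rightarrow> real"
  assumes "a \<le> b" and der: "\<And>x. x \<in> {a..b} \<Longrightarrow> (v has_vector_derivative v' x) (at x within {a..b})"
    and cont: "continuous_on {a..b} v'"
  obtains B where "B \<ge> 0" "\<And>x y. x \<in> {a..b} \<Longrightarrow> y \<in> {a..b} \<Longrightarrow> \<bar>v y - v x\<bar> \<le> B * \<bar>y - x\<bar>"
proof -
  have "bounded (v' ` {a..b})" using compact_continuous_image[OF cont] compact_imp_bounded by blast
  then obtain B where B: "B > 0" "\<And>x. x \<in> {a..b} \<Longrightarrow> norm (v' x) \<le> B"
    unfolding bounded_pos by auto
  show thesis
  proof
    show "B \<ge> 0" using B by simp
    fix x y assume xy: "x \<in> {a..b}" "y \<in> {a..b}"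
    have "norm (v y - v x) \<le> B * norm (y - x)"
      by (rule field_differentiable_bound[where S = "{a..b}" and f' = v'])
        (use der B xy in \<open>auto simp: has_real_derivative_iff_has_vector_derivative\<close>)
    then show "\<bar>v y - v x\<bar> \<le> B * \<bar>y - x\<bar>" by simp
  qed
qed

lemma absolutely_continuous_on_mult_C1:
  fixes v :: "real \<Rightarrow> real"
  assumes "a \<le> b" and ac: "absolutely_continuous_on {a..b} f"
    and der: "\<And>x. x \<in> {a..b} \<Longrightarrow> (v has_vector_derivative v' x) (at x within {a..b})"
    and cont: "continuous_on {a..b} v'"
  shows "absolutely_continuous_on {a..b} (\<lambda>x. f x * v x)"
proof -
  obtain B where B: "B \<ge> 0" "\<And>x y. x \<in> {a..b} \<Longrightarrow> y \<in> {a..b} \<Longrightarrow> \<bar>v y - v x\<bar> \<le> B * \<bar>y - x\<bar>"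
    using C1_lipschitz[OF assms(1) der cont] by metis
  have "continuous_on {a..b} v" 
    by (metis der continuous_on_eq_continuous_within has_vector_derivative_continuous)
  then have "bounded (v ` {a..b})" using compact_continuous_image compact_imp_bounded by blast
  then obtain C where C: "C > 0" "\<And>x. x \<in> {a..b} \<Longrightarrow> \<bar>v x\<bar> \<le> C"
    unfolding bounded_pos by auto
  have "continuous_on {a..b} f" using absolutely_continuous_on_imp_continuous_on[OF ac] by (simp add: is_interval_cc)
  then have "bounded (f ` {a..b})" using compact_continuous_image compact_imp_bounded by blast
  then obtain D where D: "D > 0" "\<And>x. x \<in> {a..b} \<Longrightarrow> \<bar>f x\<bar> \<le> D"
    unfolding bounded_pos by auto
  show ?thesis
  proof (rule absolutely_continuous_on_dominated[OF ac, where A = C and B = "D * B"])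
    fix x y assume xy: "x \<in> {a..b}" "y \<in> {a..b}" "x \<le> y"
    have "f y * v y - f x * v x = v y * (f y - f x) + f x * (v y - v x)" by (simp add: algebra_simps)
    then have "\<bar>f y * v y - f x * v x\<bar> \<le> \<bar>v y\<bar> * \<bar>f y - f x\<bar> + \<bar>f x\<bar> * \<bar>v y - v x\<bar>"
      by (metis abs_mult abs_triangle_ineq)
    also have "\<dots> \<le> C * \<bar>f y - f x\<bar> + D * (B * \<bar>y - x\<bar>)"
      by (intro add_mono mult_mono B C D xy) (use C D in auto)
    finally show "\<bar>f y * v y - f x * v x\<bar> \<le> C * \<bar>f y - f x\<bar> + D * B * (y - x)" using xy by simp
  qed (use B C D in auto)
qed

section \<open>The space of square integrable functions\<close>

definition L2_inner :: "(real \<Rightarrow> real) \<Rightarrow> (real \<Rightarrow> real) \<Rightarrow> real" where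
  "L2_inner f g = integral\<^sup>L (lebesgue_on {-1..1}) (\<lambda>x. f x * g x)"

lemma L2_measurable: "f \<in> L2 S \<Longrightarrow> f \<in> borel_measurable (lebesgue_on S)"
  by (simp add: L2_def)

lemma L2_mult_integrable:
  assumes f: "f \<in> L2 S" and g: "g \<in> L2 S"
  shows "integrable (lebesgue_on S) (\<lambda>x. f x * g x)"
proof (rule Bochner_Integration.integrable_bound[where f = "\<lambda>x. \<bar>f x\<bar>\<^sup>2 + \<bar>g x\<bar>\<^sup>2"])
  show "integrable (lebesgue_on S) (\<lambda>x. \<bar>f x\<bar>\<^sup>2 + \<bar>g x\<bar>\<^sup>2)"
    using f g unfolding L2_def by (intro Bochner_Integration.integrable_add) auto
  show "(\<lambda>x. f x * g x) \<in> borel_measurable (lebesgue_on S)"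
    using f g unfolding L2_def by (intro borel_measurable_times) auto
  have "norm (f x * g x) \<le> norm (\<bar>f x\<bar>\<^sup>2 + \<bar>g x\<bar>\<^sup>2)" for x
  proof -
    have "0 \<le> (\<bar>f x\<bar> - \<bar>g x\<bar>)\<^sup>2" by simp
    then have "2 * (\<bar>f x\<bar> * \<bar>g x\<bar>) \<le> \<bar>f x\<bar>\<^sup>2 + \<bar>g x\<bar>\<^sup>2" by (simp add: power2_diff)
    moreover have "0 \<le> \<bar>f x\<bar> * \<bar>g x\<bar>" by simp
    ultimately have "\<bar>f x\<bar> * \<bar>g x\<bar> \<le> \<bar>f x\<bar>\<^sup>2 + \<bar>g x\<bar>\<^sup>2" by linarith
    then show ?thesis by (simp add: abs_mult)
  qed
  then show "AE x in lebesgue_on S. norm (f x * g x) \<le> norm (\<bar>f x\<bar>\<^sup>2 + \<bar>g x\<bar>\<^sup>2)" by simp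
qed

lemma L2_linear_combination:
  assumes f: "f \<in> L2 S" and g: "g \<in> L2 S"
  shows "(\<lambda>x. a * f x + b * g x) \<in> L2 S"
proof -
  have "integrable (lebesgue_on S) (\<lambda>x. a\<^sup>2 * (f x * f x) + (2 * a * b) * (f x * g x) + b\<^sup>2 * (g x * g x))"
    using f g by (intro Bochner_Integration.integrable_add integrable_mult_right L2_mult_integrable)
  moreover have "(\<lambda>x. a\<^sup>2 * (f x * f x) + (2 * a * b) * (f x * g x) + b\<^sup>2 * (g x * g x)) = (\<lambda>x. \<bar>a * f x + b * g x\<bar>\<^sup>2)"
    by (simp add: fun_eq_iff power2_eq_square algebra_simps)
  moreover have "(\<lambda>x. a * f x + b * g x) \<in> borel_measurable (lebesgue_on S)"
    using f g by (intro borel_measurable_add borel_measurable_times borel_measurable_const L2_measurable)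
  ultimately show ?thesis by (simp add: L2_def)
qed

lemma L2_diff: "f \<in> L2 S \<Longrightarrow> g \<in> L2 S \<Longrightarrow> (\<lambda>x. f x - g x) \<in> L2 S"
  using L2_linear_combination[of f S g 1 "-1"] by simp

lemma L2_scale: "f \<in> L2 S \<Longrightarrow> (\<lambda>x. a * f x) \<in> L2 S"
  using L2_linear_combination[of f S f a 0] by simp

lemma L2_zero: "(\<lambda>x. 0) \<in> L2 S"
  by (simp add: L2_def)

text \<open>The derivative of top order is known almost everywhere only, so membership has to pass
  to such a version; measurability passes because Lebesgue measure is complete.\<close>

lemma L2_AE_eq:
  assumes f: "f \<in> L2 S" and S: "S \<in> sets lebesgue" and eq: "AE x in lebesgue_on S. f x = g x"
  shows "g \<in> L2 S"
proof -
  have eq': "AE x in lebesgue. (if x \<in> S then f x else 0) = (if x \<in> S then g x else 0)"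
    using eq S by (subst (asm) AE_restrict_space_iff) (auto elim: eventually_mono)
  have "(\<lambda>x. if x \<in> S then f x else 0) \<in> borel_measurable lebesgue"
    using L2_measurable[OF f] S borel_measurable_if by blast
  then have "(\<lambda>x. if x \<in> S then g x else 0) \<in> borel_measurable lebesgue"
    by (rule borel_measurable_AE[OF _ eq'])
  then have g: "g \<in> borel_measurable (lebesgue_on S)"
    using S borel_measurable_if by blast
  have "integrable (lebesgue_on S) (\<lambda>x. \<bar>f x\<bar>\<^sup>2) \<longleftrightarrow> integrable (lebesgue_on S) (\<lambda>x. \<bar>g x\<bar>\<^sup>2)"
    using L2_measurable[OF f] g eq by (intro integrable_cong_AE) (auto elim: eventually_mono)
  then show ?thesis using f g by (simp add: L2_def)
qed

lemma L2_bounded: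
  assumes "f \<in> borel_measurable (lebesgue_on S)" "S \<in> lmeasurable" "\<And>x. x \<in> S \<Longrightarrow> \<bar>f x\<bar> \<le> B"
  shows "f \<in> L2 S"
proof -
  interpret finite_measure "lebesgue_on S" using assms(2) finite_measure_lebesgue_on by blast
  have "integrable (lebesgue_on S) (\<lambda>x. \<bar>f x\<bar>\<^sup>2)"
  proof (rule integrable_const_bound[where B = "B\<^sup>2"])
    show "AE x in lebesgue_on S. norm (\<bar>f x\<bar>\<^sup>2) \<le> B\<^sup>2"
      using assms(3) by (intro AE_I2) (auto simp: space_restrict_space intro: power2_le_iff_abs_le[THEN iffD2] abs_le_square_iff[THEN iffD1] order_trans[OF _ abs_ge_self])
  qed (use assms(1) in auto)
  then show ?thesis using assms(1) by (simp add: L2_def)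
qed

lemma L2_norm_nonneg [simp]: "0 \<le> L2_norm f"
  by (simp add: L2_norm_def)

lemma L2_norm_power2: "(L2_norm f)\<^sup>2 = L2_inner f f"
  by (simp add: L2_norm_def L2_inner_def power2_eq_square)

lemma L2_inner_commute: "L2_inner f g = L2_inner g f"
  by (simp add: L2_inner_def mult.commute)

lemma L2_inner_linear:
  assumes "f \<in> L2 {-1..1}" "g \<in> L2 {-1..1}" "h \<in> L2 {-1..1}"
  shows "L2_inner (\<lambda>x. a * f x + b * g x) h = a * L2_inner f h + b * L2_inner g h"
proof -
  have "L2_inner (\<lambda>x. a * f x + b * g x) h = integral\<^sup>L (lebesgue_on {-1..1}) (\<lambda>x. a * (f x * h x) + b * (g x * h x))"
    by (simp add: L2_inner_def algebra_simps)
  also have "\<dots> = integral\<^sup>L (lebesgue_on {-1..1}) (\<lambda>x. a * (f x * h x)) + integral\<^sup>L (lebesgue_on {-1..1}) (\<lambda>x. b * (g x * h x))"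
    by (rule Bochner_Integration.integral_add) (intro integrable_mult_right L2_mult_integrable assms)+
  finally show ?thesis by (simp add: L2_inner_def)
qed

lemma L2_inner_diff:
  assumes "f \<in> L2 {-1..1}" "g \<in> L2 {-1..1}" "h \<in> L2 {-1..1}"
  shows "L2_inner (\<lambda>x. f x - g x) h = L2_inner f h - L2_inner g h"
  using L2_inner_linear[OF assms, of 1 "-1"] by simp

lemma L2_inner_scale: "L2_inner (\<lambda>x. a * f x) h = a * L2_inner f h"
  by (simp add: L2_inner_def mult.assoc)

lemma L2_norm_scale: "L2_norm (\<lambda>x. a * f x) = \<bar>a\<bar> * L2_norm f"
proof -
  have "(\<lambda>x. \<bar>a * f x\<bar>\<^sup>2) = (\<lambda>x. a\<^sup>2 * \<bar>f x\<bar>\<^sup>2)" by (simp add: power_mult_distrib abs_mult)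
  then show ?thesis by (simp add: L2_norm_def real_sqrt_mult)
qed

lemma L2_inner_cong_AE:
  assumes "f \<in> L2 {-1..1}" "f' \<in> L2 {-1..1}" "g \<in> L2 {-1..1}" "g' \<in> L2 {-1..1}"
    "AE x in lebesgue_on {-1..1}. f x = f' x" "AE x in lebesgue_on {-1..1}. g x = g' x"
  shows "L2_inner f g = L2_inner f' g'"
  unfolding L2_inner_def
proof (rule integral_cong_AE)
  show "AE x in lebesgue_on {-1..1}. f x * g x = f' x * g' x" using assms(5,6) by eventually_elim simp
qed (use assms in \<open>auto simp: L2_def intro!: borel_measurable_times\<close>)

lemma L2_norm_cong_AE:
  assumes "f \<in> L2 {-1..1}" "f' \<in> L2 {-1..1}" "AE x in lebesgue_on {-1..1}. f x = f' x"
  shows "L2_norm f = L2_norm f'"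
  using L2_inner_cong_AE[OF assms(1,2,1,2,3,3)] by (metis L2_norm_power2 L2_norm_nonneg power2_eq_iff_nonneg)

lemma L2_inner_self_eq_0:
  assumes "f \<in> L2 {-1..1}" "L2_inner f f = 0"
  shows "AE x in lebesgue_on {-1..1}. f x = 0"
proof -
  have "AE x in lebesgue_on {-1..1}. f x * f x = 0"
    using integral_nonneg_eq_0_iff_AE[OF L2_mult_integrable[OF assms(1) assms(1)]] assms(2)
    by (simp add: L2_inner_def)
  then show ?thesis by simp
qed

text \<open>Weighting each function by the norm of the other makes the two square terms equal, and
  the Cauchy-Schwarz defect splits off as a factor. Both the inequality and its equality case are
  read off from this, without dividing by a norm.\<close>

lemma L2_norm_diff_scaled:
  assumes "f \<in> L2 {-1..1}" "g \<in> L2 {-1..1}"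
  shows "L2_inner (\<lambda>x. L2_norm g * f x - L2_norm f * g x) (\<lambda>x. L2_norm g * f x - L2_norm f * g x)
    = 2 * L2_norm f * L2_norm g * (L2_norm f * L2_norm g - L2_inner f g)"
proof -
  define c d where "c = L2_norm g" and "d = - L2_norm f"
  have h: "(\<lambda>x. c * f x + d * g x) \<in> L2 {-1..1}" using assms L2_linear_combination by blast
  have "L2_inner (\<lambda>x. c * f x + d * g x) (\<lambda>x. c * f x + d * g x)
     = c * L2_inner f (\<lambda>x. c * f x + d * g x) + d * L2_inner g (\<lambda>x. c * f x + d * g x)"
    by (rule L2_inner_linear) (use assms h in auto)
  also have "L2_inner f (\<lambda>x. c * f x + d * g x) = c * L2_inner f f + d * L2_inner f g"
    using L2_inner_linear[OF assms assms(1), of c d] by (simp add: L2_inner_commute)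
  also have "L2_inner g (\<lambda>x. c * f x + d * g x) = c * L2_inner f g + d * L2_inner g g"
    using L2_inner_linear[OF assms assms(2), of c d] by (simp add: L2_inner_commute)
  finally show ?thesis
    by (simp add: c_def d_def L2_norm_power2[symmetric] power2_eq_square algebra_simps)
qed

lemma L2_norm_eq_0_imp_inner:
  assumes "f \<in> L2 {-1..1}" "g \<in> L2 {-1..1}" "L2_norm f = 0"
  shows "L2_inner f g = 0"
proof -
  have "AE x in lebesgue_on {-1..1}. f x = 0"
    using L2_inner_self_eq_0[OF assms(1)] L2_norm_power2[of f] assms(3) by simp
  then have "L2_inner f g = L2_inner (\<lambda>x. 0) g"
    using L2_inner_cong_AE[OF assms(1) L2_zero assms(2,2)] by simp
  then show ?thesis by (simp add: L2_inner_def)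
qed

lemma L2_Cauchy_Schwarz:
  assumes "f \<in> L2 {-1..1}" "g \<in> L2 {-1..1}"
  shows "\<bar>L2_inner f g\<bar> \<le> L2_norm f * L2_norm g"
proof -
  have le: "L2_inner f g \<le> L2_norm f * L2_norm g" if f: "f \<in> L2 {-1..1}" for f
  proof (cases "L2_norm f = 0 \<or> L2_norm g = 0")
    case True
    then have "L2_inner f g = 0"
      using L2_norm_eq_0_imp_inner f assms(2) L2_inner_commute by metis
    then show ?thesis by simp
  next
    case False
    then have pos: "0 < 2 * L2_norm f * L2_norm g"
      by (metis L2_norm_nonneg less_eq_real_def mult_pos_pos zero_less_numeral)
    have "0 \<le> 2 * L2_norm f * L2_norm g * (L2_norm f * L2_norm g - L2_inner f g)"
      using L2_norm_diff_scaled[OF f assms(2)] L2_norm_power2 by (metis zero_le_power2)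
    then show ?thesis using pos by (simp add: zero_le_mult_iff)
  qed
  \<comment> \<open>The bound from below is the one-sided inequality for \<open>-f\<close>.\<close>
  have "- L2_inner f g \<le> L2_norm f * L2_norm g"
    using le[OF L2_scale[OF assms(1), of "-1"]] L2_inner_scale[of "-1" f g] L2_norm_scale[of "-1" f] by simp
  then show ?thesis using le[OF assms(1)] by simp
qed

lemma L2_Cauchy_Schwarz_eq:
  assumes "f \<in> L2 {-1..1}" "g \<in> L2 {-1..1}" "L2_inner f g = L2_norm f * L2_norm g"
  shows "AE x in lebesgue_on {-1..1}. L2_norm g * f x = L2_norm f * g x"
proof -
  have "(\<lambda>x. L2_norm g * f x - L2_norm f * g x) \<in> L2 {-1..1}"
    using assms by (intro L2_diff L2_scale)
  from L2_inner_self_eq_0[OF this] show ?thesis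
    using L2_norm_diff_scaled[OF assms(1,2)] assms(3) by simp
qed

lemma L2_norm_diff_power2:
  assumes "f \<in> L2 {-1..1}" "g \<in> L2 {-1..1}"
  shows "(L2_norm (\<lambda>x. f x - g x))\<^sup>2 = (L2_norm f)\<^sup>2 - 2 * L2_inner f g + (L2_norm g)\<^sup>2"
proof -
  have h: "(\<lambda>x. f x - g x) \<in> L2 {-1..1}" using assms L2_diff by blast
  have "L2_inner (\<lambda>x. f x - g x) (\<lambda>x. f x - g x) = L2_inner (\<lambda>x. f x - g x) f - L2_inner (\<lambda>x. f x - g x) g"
    by (subst (1 2 3) L2_inner_commute[of _ "\<lambda>x. f x - g x"] | subst L2_inner_diff[OF assms h])+
       (metis L2_inner_commute L2_inner_diff assms h)
  then show ?thesis
    using L2_inner_diff[OF assms assms(1)] L2_inner_diff[OF assms assms(2)]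
    by (simp add: L2_norm_power2 L2_inner_commute)
qed

lemma L2_norm_triangle:
  assumes "f \<in> L2 {-1..1}" "g \<in> L2 {-1..1}"
  shows "\<bar>L2_norm f - L2_norm g\<bar> \<le> L2_norm (\<lambda>x. f x - g x)"
proof (rule power2_le_imp_le)
  have "L2_inner f g \<le> L2_norm f * L2_norm g" using L2_Cauchy_Schwarz[OF assms] by linarith
  then show "\<bar>L2_norm f - L2_norm g\<bar>\<^sup>2 \<le> (L2_norm (\<lambda>x. f x - g x))\<^sup>2"
    by (simp add: L2_norm_diff_power2[OF assms] power2_diff)
qed simp

section \<open>Linear systems\<close>

text \<open>The finite-dimensional alternative by which uniqueness for the homogeneous boundary
  value problem becomes existence. Injectivity excludes determinant 0, and a right inverse of the
  matrix provides the solution.\<close>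

lemma square_system_solvable:
  fixes M :: "nat \<Rightarrow> nat \<Rightarrow> real" and b :: "nat \<Rightarrow> real"
  assumes inj: "\<And>\<alpha>. (\<And>s. s < n \<Longrightarrow> (\<Sum>j<n. M s j * \<alpha> j) = 0) \<Longrightarrow> (\<And>j. j < n \<Longrightarrow> \<alpha> j = 0)"
  obtains \<alpha> where "\<And>s. s < n \<Longrightarrow> (\<Sum>j<n. M s j * \<alpha> j) = b s"
proof -
  define A where "A = mat n n (\<lambda>(i, j). M i j)"
  have A: "A \<in> carrier_mat n n" by (simp add: A_def)
  have mv: "vec_index (A *\<^sub>v v) s = (\<Sum>j<n. M s j * vec_index v j)" if "v \<in> carrier_vec n" "s < n" for v s
    using that by (auto simp: A_def scalar_prod_def atLeast0LessThan intro!: sum.cong)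
  have "Determinant.det A \<noteq> 0"
  proof
    assume "Determinant.det A = 0"
    then obtain v where v: "v \<in> carrier_vec n" "v \<noteq> 0\<^sub>v n" "A *\<^sub>v v = 0\<^sub>v n"
      using det_0_iff_vec_prod_zero_field[OF A] by blast
    have "vec_index v j = 0" if "j < n" for j
    proof (rule inj[OF _ that])
      fix s assume "s < n"
      then show "(\<Sum>j<n. M s j * vec_index v j) = 0" using mv[OF v(1)] v(3) by simp
    qed
    then have "v = 0\<^sub>v n" using v(1) by (intro eq_vecI) auto
    then show False using v(2) by simp
  qed
  then obtain B where B: "B \<in> carrier_mat n n" "A * B = 1\<^sub>m n"
    using det_non_zero_imp_unit[OF A] by (auto simp: Units_def ring_mat_simps)
  define v where "v = B *\<^sub>v vec n b"
  have v: "v \<in> carrier_vec n" using B by (simp add: v_def)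
  have "A *\<^sub>v v = vec n b"
    using assoc_mult_mat_vec[OF A B(1), of "vec n b"] B(2) by (simp add: v_def)
  then have "(\<Sum>j<n. M s j * vec_index v j) = b s" if "s < n" for s
    using mv[OF v that] that by simp
  then show thesis by (rule that)
qed

section \<open>Integration by parts\<close>

text \<open>\<open>deriv_on\<close> nests total derivative operators; naming all derivatives in
  advance as a chain \<open>P\<close> lets later arguments work with explicit functions. The limit
  condition makes the derivative within \<open>S\<close> unique at each point.\<close>

lemma deriv_on_eq_chain:
  assumes lim: "\<And>x. x \<in> S \<Longrightarrow> at x within S \<noteq> bot"
    and der: "\<And>s x. s < n \<Longrightarrow> x \<in> S \<Longrightarrow> (P s has_vector_derivative P (Suc s) x) (at x within S)"
    and f: "\<And>x. x \<in> S \<Longrightarrow> f x = P 0 x"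
  shows "s \<le> n \<Longrightarrow> x \<in> S \<Longrightarrow> deriv_on S s f x = P s x"
proof (induction s arbitrary: x)
  case 0
  then show ?case using f by simp
next
  case (Suc s)
  have "(deriv_on S s f has_vector_derivative P (Suc s) x) (at x within S)"
    by (rule has_vector_derivative_transform[OF Suc.prems(2) _ der]) (use Suc in auto)
  then show ?case using vector_derivative_within[OF lim[OF Suc.prems(2)]] by simp
qed

text \<open>Covers \<open>s = n\<close> too, one order beyond the chain, where a derivative may
  exist at some points only: off t for \<open>G r\<close>, off a null set for a general function of
  L_2^r.\<close>

lemma deriv_on_chain_has_vector_derivative:
  assumes lim: "\<And>x. x \<in> S \<Longrightarrow> at x within S \<noteq> bot"
    and der: "\<And>s x. s < n \<Longrightarrow> x \<in> S \<Longrightarrow> (P s has_vector_derivative P (Suc s) x) (at x within S)"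
    and f: "\<And>x. x \<in> S \<Longrightarrow> f x = P 0 x"
    and s: "s \<le> n" and x: "x \<in> S" and D: "(P s has_vector_derivative D) (at x within S)"
  shows "(deriv_on S s f has_vector_derivative D) (at x within S)"
  by (rule has_vector_derivative_transform[OF x _ D]) (use deriv_on_eq_chain[OF lim der f s] in auto)

lemma at_within_Icc_neq_bot: "a < b \<Longrightarrow> x \<in> {a..b} \<Longrightarrow> at x within {a..b::real} \<noteq> bot"
  by (metis islimpt_Icc trivial_limit_within)

lemma at_within_open_neq_bot: "open S \<Longrightarrow> x \<in> S \<Longrightarrow> at (x::real) within S \<noteq> bot"
  by (metis at_neq_bot at_within_open)

lemma L2_deriv_has_vector_derivative:
  assumes "f \<in> L2_deriv S r" "s < r - 1" "x \<in> S"
  shows "(deriv_on S s f has_vector_derivative deriv_on S (Suc s) f x) (at x within S)"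
proof -
  have "deriv_on S s f differentiable (at x within S)" using assms by (auto simp: L2_deriv_def)
  then show ?thesis by (simp add: vector_derivative_works[symmetric])
qed

text \<open>Turns the almost-everywhere clause into the negligible exceptional set asked for by the
  fundamental theorem.\<close>

lemma L2_deriv_top:
  assumes "f \<in> L2_deriv S r" "r \<ge> 1" "S \<in> sets lebesgue"
  obtains N where "negligible N" "\<And>x. x \<in> S - N \<Longrightarrow> 
     (deriv_on S (r - 1) f has_vector_derivative deriv_on S r f x) (at x within S)"
proof -
  have "AE x in lebesgue_on S. deriv_on S (r - 1) f differentiable (at x within S)"
    using assms unfolding L2_deriv_def by simp
  then have "AE x in lebesgue. x \<in> S \<longrightarrow> deriv_on S (r - 1) f differentiable (at x within S)"
    using assms(3) by (simp add: AE_restrict_space_iff)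
  then obtain N where N: "N \<in> null_sets lebesgue" 
    "{x. \<not> (x \<in> S \<longrightarrow> deriv_on S (r - 1) f differentiable (at x within S))} \<subseteq> N"
    unfolding eventually_ae_filter by auto
  show thesis
  proof
    show "negligible N" using N negligible_iff_null_sets by blast
    fix x assume "x \<in> S - N"
    then have "deriv_on S (r - 1) f differentiable (at x within S)" using N by blast
    then have "(deriv_on S (r - 1) f has_vector_derivative deriv_on S (Suc (r - 1)) f x) (at x within S)"
      by (simp add: vector_derivative_works[symmetric])
    then show "(deriv_on S (r - 1) f has_vector_derivative deriv_on S r f x) (at x within S)"
      using \<open>r \<ge> 1\<close> by simp
  qed
qed

lemma L2_deriv_continuous:
  assumes "f \<in> L2_deriv S r" "s \<le> r - 1" "is_interval S"
  shows "continuous_on S (deriv_on S s f)"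
proof (cases "s = r - 1")
  case True
  then show ?thesis using assms absolutely_continuous_on_imp_continuous_on unfolding L2_deriv_def by simp
next
  case False
  then have "s < r - 1" using assms by simp
  then show ?thesis using L2_deriv_has_vector_derivative[OF assms(1)]
    by (metis continuous_on_eq_continuous_within has_vector_derivative_continuous)
qed

lemma chain_continuous_on:
  assumes "\<And>x. x \<in> S \<Longrightarrow> (p has_vector_derivative p' x) (at x within S)"
  shows "continuous_on S p"
  by (metis assms continuous_on_eq_continuous_within has_vector_derivative_continuous)

text \<open>The alternating sum is an antiderivative of the integrand: by the product rule its
  derivative telescopes.\<close>

lemma integration_by_parts_chain:
  fixes F v :: "nat \<Rightarrow> real \<Rightarrow> real"
  assumes "a \<le> b"
    and F: "\<And>i x. i < n \<Longrightarrow> x \<in> {a..b} \<Longrightarrow> (F i has_vector_derivative F (Suc i) x) (at x within {a..b})"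
    and v: "\<And>i x. i < n \<Longrightarrow> x \<in> {a..b} \<Longrightarrow> (v i has_vector_derivative v (Suc i) x) (at x within {a..b})"
  shows "((\<lambda>x. F n x * v 0 x - (-1)^n * (F 0 x * v n x)) has_integral
     ((\<Sum>j<n. (-1)^j * (F (n - 1 - j) b * v j b)) - (\<Sum>j<n. (-1)^j * (F (n - 1 - j) a * v j a)))) {a..b}"
proof (rule fundamental_theorem_of_calculus[OF \<open>a \<le> b\<close>])
  fix x assume x: "x \<in> {a..b}"
  have "((\<lambda>x. \<Sum>j<n. (-1)^j * (F (n - 1 - j) x * v j x)) has_vector_derivative
      (\<Sum>j<n. (-1)^j * (F (n - 1 - j) x * v (Suc j) x + F (Suc (n - 1 - j)) x * v j x))) (at x within {a..b})"
  proof (rule has_vector_derivative_sum)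
    fix j assume "j \<in> {..<n}"
    then have j: "j < n" "n - 1 - j < n" by auto
    show "((\<lambda>x. (-1)^j * (F (n - 1 - j) x * v j x)) has_vector_derivative
      (-1)^j * (F (n - 1 - j) x * v (Suc j) x + F (Suc (n - 1 - j)) x * v j x)) (at x within {a..b})"
      by (intro has_vector_derivative_mult_right has_vector_derivative_mult F v j x)
  qed
  also have "(\<Sum>j<n. (-1)^j * (F (n - 1 - j) x * v (Suc j) x + F (Suc (n - 1 - j)) x * v j x))
     = (\<Sum>j<n. (-1)^j * (F (n - j) x * v j x) - (-1)^(Suc j) * (F (n - Suc j) x * v (Suc j) x))"
    by (intro sum.cong refl) (auto simp: algebra_simps Suc_diff_Suc)
  also have "\<dots> = F n x * v 0 x - (-1)^n * (F 0 x * v n x)"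
    using sum_lessThan_telescope'[of "\<lambda>j. (-1)^j * (F (n - j) x * v j x)" n] by simp
  finally show "((\<lambda>x. \<Sum>j<n. (-1)^j * (F (n - 1 - j) x * v j x)) has_vector_derivative
      F n x * v 0 x - (-1)^n * (F 0 x * v n x)) (at x within {a..b})" .
qed

text \<open>Only \<open>F (n - 1)\<close> may fail to be differentiable somewhere. Its product with
  \<open>v 0\<close> is split off and handled by the theorem for absolutely continuous functions;
  what remains is the classical formula of order n - 1 for \<open>F\<close> and the shifted chain
  \<open>v (Suc j)\<close>.\<close>

lemma integration_by_parts_chain_absolutely_continuous:
  fixes F v :: "nat \<Rightarrow> real \<Rightarrow> real"
  assumes "a \<le> b" "n \<ge> 1"
    and F: "\<And>i x. i < n - 1 \<Longrightarrow> x \<in> {a..b} \<Longrightarrow> (F i has_vector_derivative F (Suc i) x) (at x within {a..b})"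
    and ac: "absolutely_continuous_on {a..b} (F (n - 1))"
    and N: "negligible N" "\<And>x. x \<in> {a..b} - N \<Longrightarrow> (F (n - 1) has_vector_derivative F n x) (at x within {a..b})"
    and v: "\<And>i x. i < n \<Longrightarrow> x \<in> {a..b} \<Longrightarrow> (v i has_vector_derivative v (Suc i) x) (at x within {a..b})"
    and cv: "continuous_on {a..b} (v n)"
  shows "((\<lambda>x. F n x * v 0 x - (-1)^n * (F 0 x * v n x)) has_integral
     ((\<Sum>j<n. (-1)^j * (F (n - 1 - j) b * v j b)) - (\<Sum>j<n. (-1)^j * (F (n - 1 - j) a * v j a)))) {a..b}"
proof -
  obtain m where m: "n = Suc m" using \<open>n \<ge> 1\<close> by (cases n) auto
  \<comment> \<open>For \<open>n = 1\<close> this is \<open>cv\<close>; for larger \<open>n\<close>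
    it follows from the differentiability of \<open>v 1\<close>.\<close>
  have c1: "continuous_on {a..b} (v 1)"
    using chain_continuous_on[of "{a..b}" "v 1" "v 2"] v[of 1] cv m by (cases m) (auto simp: numeral_2_eq_2)
  have ac1: "absolutely_continuous_on {a..b} (\<lambda>x. F m x * v 0 x)"
    by (rule absolutely_continuous_on_mult_C1[OF \<open>a \<le> b\<close>, where v' = "v 1"]) (use ac m v[of 0] c1 in auto)
  have 1: "((\<lambda>x. F m x * v 1 x + F n x * v 0 x) has_integral (F m b * v 0 b - F m a * v 0 a)) {a..b}"
  proof (rule fundamental_theorem_of_calculus_absolutely_continuous[OF \<open>a \<le> b\<close> ac1 N(1)])
    fix x assume "x \<in> {a..b} - N"
    then show "((\<lambda>x. F m x * v 0 x) has_vector_derivative F m x * v 1 x + F n x * v 0 x) (at x within {a..b})"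
      using N(2)[of x] v[of 0 x] m by (auto intro!: has_vector_derivative_mult)
  qed
  have 2: "((\<lambda>x. F m x * v (Suc 0) x - (-1)^m * (F 0 x * v (Suc m) x)) has_integral
     ((\<Sum>j<m. (-1)^j * (F (m - 1 - j) b * v (Suc j) b)) - (\<Sum>j<m. (-1)^j * (F (m - 1 - j) a * v (Suc j) a)))) {a..b}"
    by (rule integration_by_parts_chain[OF \<open>a \<le> b\<close>, where v = "\<lambda>j. v (Suc j)"]) (use F v m in auto)
  have B: "(\<Sum>j<n. (-1)^j * (F (n - 1 - j) x * v j x)) = F m x * v 0 x - (\<Sum>j<m. (-1)^j * (F (m - 1 - j) x * v (Suc j) x))" for x
    unfolding m sum.lessThan_Suc_shift by (simp add: sum_negf)
  show ?thesis
    unfolding B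
    by (rule has_integral_eq_rhs[OF has_integral_eq[OF _ has_integral_diff[OF 1 2]]]) (simp_all add: m algebra_simps)
qed

section \<open>Functions glued at t and the Green identity\<close>

definition glue :: "real \<Rightarrow> (real \<Rightarrow> real) \<Rightarrow> (real \<Rightarrow> real) \<Rightarrow> real \<Rightarrow> real" where
  "glue t p q x = (if x \<le> t then p x else q x)"

lemma L2_glue:
  assumes "-1 \<le> t" "t \<le> 1" "continuous_on {-1..t} p" "continuous_on {t..1} q"
  shows "glue t p q \<in> L2 {-1..1}"
proof -
  \<comment> \<open>Clamping the argument extends both pieces continuously to the whole line, which
    makes the glued function Borel.\<close>
  define p' where "p' x = p (max (-1) (min x t))" for x
  define q' where "q' x = q (max t (min x 1))" for x
  have "continuous_on UNIV p'" unfolding p'_def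
    by (rule continuous_on_compose2[OF assms(3)]) (use assms in \<open>auto intro!: continuous_intros\<close>)
  moreover have "continuous_on UNIV q'" unfolding q'_def
    by (rule continuous_on_compose2[OF assms(4)]) (use assms in \<open>auto intro!: continuous_intros\<close>)
  ultimately have [measurable]: "p' \<in> borel_measurable borel" "q' \<in> borel_measurable borel"
    by (simp_all add: borel_measurable_continuous_onI)
  have "glue t p' q' \<in> borel_measurable borel" unfolding glue_def by measurable
  then have "glue t p' q' \<in> borel_measurable (lebesgue_on {-1..1})"
    by (intro measurable_restrict_space1 measurable_completion) simp
  moreover have "glue t p' q' x = glue t p q x" if "x \<in> {-1..1}" for x
    using that by (auto simp: glue_def p'_def q'_def)
  ultimately have meas: "glue t p q \<in> borel_measurable (lebesgue_on {-1..1})"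
    by (subst measurable_cong[where g = "glue t p' q'"]) (auto simp: space_restrict_space)
  have "bounded (p ` {-1..t})" "bounded (q ` {t..1})"
    using assms compact_continuous_image compact_imp_bounded by blast+
  then obtain B C where "\<And>x. x \<in> {-1..t} \<Longrightarrow> \<bar>p x\<bar> \<le> B" "\<And>x. x \<in> {t..1} \<Longrightarrow> \<bar>q x\<bar> \<le> C"
    unfolding bounded_pos by (metis imageI real_norm_def)
  then show ?thesis
    by (intro L2_bounded[OF meas, where B = "max B C"]) (auto simp: glue_def le_max_iff_disj)
qed

lemma L2_continuous:
  assumes "continuous_on {-1..1} f" shows "f \<in> L2 {-1..1}"
proof -
  have "glue 1 f f \<in> L2 {-1..1}" using assms by (intro L2_glue) auto
  moreover have "glue 1 f f = f" by (auto simp: glue_def)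
  ultimately show ?thesis by simp
qed

text \<open>The closed halves are used so that one-sided limits at t become the values
  \<open>L s t\<close> and \<open>R s t\<close>.\<close>

definition piecewise_chain :: "nat \<Rightarrow> real \<Rightarrow> (nat \<Rightarrow> real \<Rightarrow> real) \<Rightarrow> (nat \<Rightarrow> real \<Rightarrow> real) \<Rightarrow> bool" where
  "piecewise_chain n t L R \<longleftrightarrow>
     (\<forall>s<n. \<forall>x\<in>{-1..t}. (L s has_vector_derivative L (Suc s) x) (at x within {-1..t})) \<and>
     (\<forall>s<n. \<forall>x\<in>{t..1}. (R s has_vector_derivative R (Suc s) x) (at x within {t..1})) \<and>
     continuous_on {-1..t} (L n) \<and> continuous_on {t..1} (R n)"

lemma piecewise_chain_continuous:
  assumes "piecewise_chain n t L R" "s \<le> n"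
  shows "continuous_on {-1..t} (L s)" "continuous_on {t..1} (R s)"
  using assms chain_continuous_on[of "{-1..t}" "L s" "L (Suc s)"] chain_continuous_on[of "{t..1}" "R s" "R (Suc s)"]
  unfolding piecewise_chain_def by (cases "s = n"; auto)+

lemma piecewise_chain_mono: "piecewise_chain n t L R \<Longrightarrow> m \<le> n \<Longrightarrow> piecewise_chain m t L R"
  using piecewise_chain_continuous[of n t L R m] unfolding piecewise_chain_def by auto

lemma piecewise_chain_L2:
  assumes "piecewise_chain n t L R" "s \<le> n" "-1 < t" "t < 1"
  shows "glue t (L s) (R s) \<in> L2 {-1..1}"
  using piecewise_chain_continuous[OF assms(1,2)] assms by (intro L2_glue) auto

text \<open>Integration by parts on the two halves leaves boundary sums at -1, t and 1. Those at the
  outer ends vanish with \<open>L\<close> and \<open>R\<close>, and the difference of the two sums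
  at t sees only the jumps of the chain, since the derivatives of \<open>f\<close> up to order r - 1
  are continuous there.\<close>

lemma green_identity:
  assumes t: "-1 < t" "t < 1" and k: "k < r"
    and pc: "piecewise_chain r t L R"
    and bc: "\<And>s. s < r \<Longrightarrow> L s (-1) = 0" "\<And>s. s < r \<Longrightarrow> R s 1 = 0"
    and jump: "\<And>s. s < r \<Longrightarrow> R s t - L s t = (if s = r - k - 1 then c else 0)"
    and f: "f \<in> L2_deriv {-1..1} r"
  shows "L2_inner (deriv_on {-1..1} r f) (glue t (L 0) (R 0)) - (-1)^r * L2_inner f (glue t (L r) (R r))
    = - ((-1)^(r - k - 1) * c * deriv_on {-1..1} k f t)"
proof -
  define F where "F s = deriv_on {-1..1} s f" for s
  have r: "r \<ge> 1" using k by simp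
  obtain N where N: "negligible N" "\<And>x. x \<in> {-1..1} - N \<Longrightarrow> (F (r - 1) has_vector_derivative F r x) (at x within {-1..1})"
    using L2_deriv_top[OF f r] unfolding F_def by auto
  have ac: "absolutely_continuous_on {-1..1} (F (r - 1))" using f by (simp add: L2_deriv_def F_def)
  have Fd: "(F i has_vector_derivative F (Suc i) x) (at x within {-1..1})" if "i < r - 1" "x \<in> {-1..1}" for i x
    using L2_deriv_has_vector_derivative[OF f that] by (simp add: F_def)
  have sub: "(h has_vector_derivative D) (at x within {-1..t})" "(h has_vector_derivative D) (at x within {t..1})"
    if "(h has_vector_derivative D) (at x within {-1..1})" for h :: "real \<Rightarrow> real" and D x
    using that t by (auto intro: has_vector_derivative_within_subset)
  define B where "B v x = (\<Sum>j<r. (-1)^j * (F (r - 1 - j) x * v j x))" for v x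
  define g where "g x = F r x * glue t (L 0) (R 0) x - (-1)^r * (F 0 x * glue t (L r) (R r) x)" for x
  have "((\<lambda>x. F r x * L 0 x - (-1)^r * (F 0 x * L r x)) has_integral (B L t - B L (-1))) {-1..t}"
    unfolding B_def
  proof (rule integration_by_parts_chain_absolutely_continuous[OF _ r _ _ N(1)])
    show "absolutely_continuous_on {-1..t} (F (r - 1))"
      by (rule absolutely_continuous_on_subset[OF ac]) (use t in auto)
  qed (use pc t sub(1)[OF Fd] sub(1)[OF N(2)] in \<open>auto simp: piecewise_chain_def\<close>)
  then have 1: "(g has_integral (B L t - B L (-1))) {-1..t}"
    by (rule has_integral_spike_finite[of "{t}", rotated 2]) (auto simp: g_def glue_def)
  have "((\<lambda>x. F r x * R 0 x - (-1)^r * (F 0 x * R r x)) has_integral (B R 1 - B R t)) {t..1}"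
    unfolding B_def
  proof (rule integration_by_parts_chain_absolutely_continuous[OF _ r _ _ N(1)])
    show "absolutely_continuous_on {t..1} (F (r - 1))"
      by (rule absolutely_continuous_on_subset[OF ac]) (use t in auto)
  qed (use pc t sub(2)[OF Fd] sub(2)[OF N(2)] in \<open>auto simp: piecewise_chain_def\<close>)
  then have 2: "(g has_integral (B R 1 - B R t)) {t..1}"
    by (rule has_integral_spike_finite[of "{t}", rotated 2]) (auto simp: g_def glue_def)
  have "(g has_integral (B L t - B L (-1) + (B R 1 - B R t))) {-1..1}"
    using has_integral_combine[OF _ _ 1 2] t by simp
  moreover have "B L (-1) = 0" "B R 1 = 0" using bc by (auto simp: B_def)
  \<comment> \<open>The only surviving index is j = r-k-1, which is paired with the derivative of
    \<open>f\<close> of order r-1-j = k.\<close>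
  moreover have "B R t - B L t = (-1)^(r - k - 1) * c * F k t"
  proof -
    have "B R t - B L t = (\<Sum>j<r. (-1)^j * (F (r - 1 - j) t * (R j t - L j t)))"
      by (simp add: B_def sum_subtractf algebra_simps)
    also have "\<dots> = (\<Sum>j<r. if j = r - k - 1 then (-1)^j * (F (r - 1 - j) t * c) else 0)"
      by (intro sum.cong) (auto simp: jump)
    also have "\<dots> = (-1)^(r - k - 1) * c * F k t" using k by (simp add: sum.delta)
    finally show ?thesis .
  qed
  ultimately have int: "(g has_integral (- ((-1)^(r - k - 1) * c * F k t))) {-1..1}" by (simp add: algebra_simps)
  have Fr: "F r \<in> L2 {-1..1}" using f by (simp add: L2_deriv_def F_def)
  have F0: "F 0 \<in> L2 {-1..1}" 
    using L2_continuous[OF L2_deriv_continuous[OF f, of 0]] by (simp add: F_def is_interval_cc)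
  have G: "glue t (L 0) (R 0) \<in> L2 {-1..1}" "glue t (L r) (R r) \<in> L2 {-1..1}"
    using piecewise_chain_L2[OF pc _ t] by auto
  have i1: "integrable (lebesgue_on {-1..1}) (\<lambda>x. F r x * glue t (L 0) (R 0) x)"
    and i2: "integrable (lebesgue_on {-1..1}) (\<lambda>x. (-1)^r * (F 0 x * glue t (L r) (R r) x))"
    by (intro L2_mult_integrable Fr G integrable_mult_right F0)+
  have ig: "integrable (lebesgue_on {-1..1}) g" 
    unfolding g_def by (rule Bochner_Integration.integrable_diff[OF i1 i2])
  have "integral\<^sup>L (lebesgue_on {-1..1}) g = integral {-1..1} g"
    by (rule lebesgue_integral_eq_integral[OF ig]) simp
  also have "\<dots> = - ((-1)^(r - k - 1) * c * F k t)" using int by (rule integral_unique)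
  also have "integral\<^sup>L (lebesgue_on {-1..1}) g = L2_inner (F r) (glue t (L 0) (R 0)) - (-1)^r * L2_inner (F 0) (glue t (L r) (R r))"
    unfolding g_def L2_inner_def using Bochner_Integration.integral_diff[OF i1 i2] by simp
  finally show ?thesis by (simp add: F_def)
qed

section \<open>The Green function\<close>

text \<open>\<open>eq'\<close> is demanded at t only: the two pieces may have a kink there while the
  formula is still wanted at the other points.\<close>

lemma glue_has_vector_derivative:
  assumes t: "-1 < t" "t < 1"
    and p: "\<And>x. x \<in> {-1..t} \<Longrightarrow> (p has_vector_derivative p' x) (at x within {-1..t})"
    and q: "\<And>x. x \<in> {t..1} \<Longrightarrow> (q has_vector_derivative q' x) (at x within {t..1})"
    and eq: "p t = q t" and x: "x \<in> {-1..1}" and eq': "x = t \<Longrightarrow> p' t = q' t"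
  shows "(glue t p q has_vector_derivative glue t p' q' x) (at x within {-1..1})"
proof -
  have S: "{-1..1} = {-1..t} \<union> {t..1}" using t by auto
  have cl: "closure {-1..t} \<inter> closure {t..1} = {t}" using t by auto
  have ins: "{-1..t} \<union> {t} = {-1..t}" "{t..1} \<union> {t} = {t..1}" using t by auto
  have "((\<lambda>x. if x \<in> {-1..t} then p x else q x) has_vector_derivative
    (if x \<in> {-1..t} then p' x else q' x)) (at x within {-1..1})"
    by (rule has_vector_derivative_If_within_closures[OF _ S])
       (use x S p q eq eq' cl ins in \<open>auto simp: insert_absorb\<close>)
  then show ?thesis
    by (rule has_vector_derivative_eq_rhs[OF has_vector_derivative_transform[OF x, rotated]])
       (use x in \<open>auto simp: glue_def\<close>)
qed

text \<open>Survives a kink at t, because an increment across t is split there. This is how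
  \<open>G (2 * r - 1)\<close> turns out absolutely continuous.\<close>

lemma glue_lipschitz:
  fixes p q p' q' :: "real \<Rightarrow> real"
  assumes t: "-1 < t" "t < 1"
    and p: "\<And>x. x \<in> {-1..t} \<Longrightarrow> (p has_vector_derivative p' x) (at x within {-1..t})"
    and q: "\<And>x. x \<in> {t..1} \<Longrightarrow> (q has_vector_derivative q' x) (at x within {t..1})"
    and "continuous_on {-1..t} p'" "continuous_on {t..1} q'" and eq: "p t = q t"
  obtains B where "B \<ge> 0" "\<And>x y. x \<in> {-1..1} \<Longrightarrow> y \<in> {-1..1} \<Longrightarrow> x \<le> y \<Longrightarrow> \<bar>glue t p q y - glue t p q x\<bar> \<le> B * (y - x)"
proof -
  obtain B where B: "B \<ge> 0" "\<And>x y. x \<in> {-1..t} \<Longrightarrow> y \<in> {-1..t} \<Longrightarrow> \<bar>p y - p x\<bar> \<le> B * \<bar>y - x\<bar>"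
    using C1_lipschitz[of "-1" t p p'] assms by (metis less_eq_real_def)
  obtain C where C: "C \<ge> 0" "\<And>x y. x \<in> {t..1} \<Longrightarrow> y \<in> {t..1} \<Longrightarrow> \<bar>q y - q x\<bar> \<le> C * \<bar>y - x\<bar>"
    using C1_lipschitz[of t 1 q q'] assms by (metis less_eq_real_def)
  show thesis
  proof
    show "max B C \<ge> 0" using B by simp
    fix x y :: real assume xy: "x \<in> {-1..1}" "y \<in> {-1..1}" "x \<le> y"
    have le: "B * d \<le> max B C * d" "C * d \<le> max B C * d" if "d \<ge> 0" for d
      using that by (auto intro: mult_right_mono)
    consider "y \<le> t" | "x \<le> t" "t < y" | "t < x" using xy by linarith
    then show "\<bar>glue t p q y - glue t p q x\<bar> \<le> max B C * (y - x)"
    proof cases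
      case 1
      then show ?thesis using B(2)[of x y] le(1)[of "y - x"] xy by (auto simp: glue_def)
    next
      case 2
      have "\<bar>glue t p q y - glue t p q x\<bar> \<le> \<bar>q y - q t\<bar> + \<bar>p t - p x\<bar>"
        using 2 eq by (auto simp: glue_def)
      also have "\<dots> \<le> max B C * (y - t) + max B C * (t - x)"
      proof (rule add_mono)
        show "\<bar>q y - q t\<bar> \<le> max B C * (y - t)"
          using order_trans[OF C(2)[of t y] le(2)[of "\<bar>y - t\<bar>"]] 2 xy t by simp
        show "\<bar>p t - p x\<bar> \<le> max B C * (t - x)"
          using order_trans[OF B(2)[of x t] le(1)[of "\<bar>t - x\<bar>"]] 2 xy t by simp
      qed
      finally show ?thesis by (simp add: algebra_simps)
    next
      case 3
      then show ?thesis using C(2)[of x y] le(2)[of "y - x"] xy by (auto simp: glue_def)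
    qed
  qed
qed

text \<open>\<open>L s\<close> and \<open>R s\<close> are the derivatives of order \<open>s\<close> of the solution on the closed intervals
  left and right of \<open>t\<close>. The factor \<open>\<gamma>\<close> scales the jump, so that \<open>\<gamma> = 0\<close> is the homogeneous
  problem.\<close>

definition green_chain ::
  "nat \<Rightarrow> nat \<Rightarrow> real \<Rightarrow> real \<Rightarrow> real \<Rightarrow> (nat \<Rightarrow> real \<Rightarrow> real) \<Rightarrow> (nat \<Rightarrow> real \<Rightarrow> real) \<Rightarrow> bool" where
  "green_chain r k \<mu> t \<gamma> L R \<longleftrightarrow> piecewise_chain (2 * r) t L R \<and>
     (\<forall>x\<in>{-1..t}. L (2 * r) x = (-1)^(r + 1) * \<mu> * L 0 x) \<and>
     (\<forall>x\<in>{t..1}. R (2 * r) x = (-1)^(r + 1) * \<mu> * R 0 x) \<and>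
     (\<forall>s<r. L s (-1) = 0 \<and> R s 1 = 0) \<and>
     (\<forall>s<2 * r. R s t - L s t = (if s = r - k - 1 then (-1)^(k + 1) * \<gamma> else 0))"

locale green =
  fixes r k :: nat and \<mu> t \<gamma> :: real and L R :: "nat \<Rightarrow> real \<Rightarrow> real"
  assumes k: "k < r" and t: "-1 < t" "t < 1" and gc: "green_chain r k \<mu> t \<gamma> L R"
begin

abbreviation G :: "nat \<Rightarrow> real \<Rightarrow> real" where "G s \<equiv> glue t (L s) (R s)"

lemma pc: "piecewise_chain (2 * r) t L R" using gc by (simp add: green_chain_def)

lemma G_L2: "s \<le> 2 * r \<Longrightarrow> G s \<in> L2 {-1..1}"
  using piecewise_chain_L2[OF pc _ t] .

lemma G_top: "x \<in> {-1..1} \<Longrightarrow> G (2 * r) x = (-1)^(r + 1) * \<mu> * G 0 x"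
  using gc unfolding green_chain_def glue_def by auto

text \<open>The jump occurs at order r - k - 1, which is below r.\<close>

lemma match: "r \<le> s \<Longrightarrow> s < 2 * r \<Longrightarrow> L s t = R s t"
proof -
  assume s: "r \<le> s" "s < 2 * r"
  have "R s t - L s t = (if s = r - k - 1 then (-1)^(k + 1) * \<gamma> else 0)"
    using gc s unfolding green_chain_def by blast
  then show ?thesis using s k by (simp split: if_splits)
qed

text \<open>At t the derivative of order 2r is left out: \<open>G (2 * r)\<close> is a multiple of
  \<open>G 0\<close>, and \<open>G 0\<close> jumps when k = r - 1 and \<gamma> is nonzero.\<close>

lemma G_deriv:
  assumes "r \<le> s" "s < 2 * r" "x \<in> {-1..1}" "x = t \<Longrightarrow> Suc s < 2 * r"
  shows "(G s has_vector_derivative G (Suc s) x) (at x within {-1..1})"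
  by (rule glue_has_vector_derivative[OF t _ _ _ assms(3)])
     (use pc match assms in \<open>auto simp: piecewise_chain_def\<close>)

text \<open>Makes \<open>G r\<close> an admissible choice of f in the reproducing identity. Its
  derivatives of order below r are continuous across t by \<open>match\<close>; the one of order r
  is claimed off t only, and the Lipschitz bound of the glued function gives absolute
  continuity.\<close>

lemma
  shows G_deriv_on: "\<And>s x. s < r \<Longrightarrow> x \<in> {-1..1} \<Longrightarrow> deriv_on {-1..1} s (G r) x = G (r + s) x"
    and G_deriv_on_top: "\<And>x. x \<in> {-1..1} \<Longrightarrow> x \<noteq> t \<Longrightarrow> deriv_on {-1..1} r (G r) x = G (2 * r) x"
    and G_L2_deriv: "G r \<in> L2_deriv {-1..1} r"
proof -
  have lim: "at x within {-1..1} \<noteq> bot" if "x \<in> {-1..1::real}" for x using at_within_Icc_neq_bot[of "-1" 1 x] that by simp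
  have ch: "(G (r + s) has_vector_derivative G (r + Suc s) x) (at x within {-1..1})" if "s < r - 1" "x \<in> {-1..1}" for s x
    using G_deriv[of "r + s" x] that by simp
  show 1: "deriv_on {-1..1} s (G r) x = G (r + s) x" if "s < r" "x \<in> {-1..1}" for s x
    by (rule deriv_on_eq_chain[where n = "r - 1" and P = "\<lambda>s. G (r + s)"]) (use lim ch that in auto)
  have 2: "(deriv_on {-1..1} (r - 1) (G r) has_vector_derivative G (2 * r) x) (at x within {-1..1})"
    if "x \<in> {-1..1}" "x \<noteq> t" for x
  proof (rule deriv_on_chain_has_vector_derivative[where n = "r - 1" and P = "\<lambda>s. G (r + s)"])
    show "(G (r + (r - 1)) has_vector_derivative G (2 * r) x) (at x within {-1..1})"
      using G_deriv[of "r + (r - 1)" x] that k by (simp add: mult_2)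
  qed (use lim ch that in auto)
  show 3: "deriv_on {-1..1} r (G r) x = G (2 * r) x" if "x \<in> {-1..1}" "x \<noteq> t" for x
  proof -
    have "deriv_on {-1..1} (Suc (r - 1)) (G r) x = G (2 * r) x"
      using vector_derivative_within[OF lim 2] that by simp
    then show ?thesis using k by simp
  qed
  have AEt: "AE x in lebesgue_on {-1..1}. x \<noteq> t"
    by (simp add: AE_restrict_space_iff) (metis (mono_tags, lifting) AE_lborel_singleton AE_completion eventually_mono)
  show "G r \<in> L2_deriv {-1..1} r"
    unfolding L2_deriv_def
  proof (intro CollectI conjI allI impI ballI)
    fix j x assume j: "j < r - 1" "x \<in> {-1..1::real}"
    have "(deriv_on {-1..1} j (G r) has_vector_derivative G (r + Suc j) x) (at x within {-1..1})"
      by (rule deriv_on_chain_has_vector_derivative[where n = "r - 1" and P = "\<lambda>s. G (r + s)"])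
         (use lim ch j in auto)
    then show "deriv_on {-1..1} j (G r) differentiable (at x within {-1..1})"
      using differentiableI_vector by blast
  next
    have L: "\<And>x. x \<in> {-1..t} \<Longrightarrow> (L (2 * r - 1) has_vector_derivative L (2 * r) x) (at x within {-1..t})"
      and R: "\<And>x. x \<in> {t..1} \<Longrightarrow> (R (2 * r - 1) has_vector_derivative R (2 * r) x) (at x within {t..1})"
      using pc k unfolding piecewise_chain_def by (metis One_nat_def Suc_pred diff_less gr_implies_not0 lessI mult_pos_pos neq0_conv pos2 zero_less_Suc)+
    have m: "L (2 * r - 1) t = R (2 * r - 1) t" using match[of "2 * r - 1"] k by simp
    obtain B where B: "B \<ge> 0" "\<And>x y. x \<in> {-1..1} \<Longrightarrow> y \<in> {-1..1} \<Longrightarrow> x \<le> y \<Longrightarrow> 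
       \<bar>G (2 * r - 1) y - G (2 * r - 1) x\<bar> \<le> B * (y - x)"
      using glue_lipschitz[OF t L R piecewise_chain_continuous[OF pc order_refl] m] by metis
    have "absolutely_continuous_on {-1..1} (G (2 * r - 1))"
      by (rule absolutely_continuous_on_lipschitz[OF B])
    moreover have "deriv_on {-1..1} (r - 1) (G r) x = G (2 * r - 1) x" if "x \<in> {-1..1}" for x
      using 1[of "r - 1" x] k that by (simp add: mult_2)
    ultimately show "absolutely_continuous_on {-1..1} (deriv_on {-1..1} (r - 1) (G r))"
      using absolutely_continuous_on_cong by blast
  next
    have "AE x in lebesgue_on {-1..1}. x \<in> {-1..1} \<and> x \<noteq> t" 
      using AEt by (auto simp: AE_restrict_space_iff)
    then show "AE x in lebesgue_on {-1..1}. deriv_on {-1..1} (r - 1) (G r) differentiable (at x within {-1..1})"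
      by (rule eventually_mono) (use 2 differentiableI_vector in blast)
    have "AE x in lebesgue_on {-1..1}. G (2 * r) x = deriv_on {-1..1} r (G r) x"
      by (rule eventually_mono[OF \<open>AE x in lebesgue_on {-1..1}. x \<in> {-1..1} \<and> x \<noteq> t\<close>]) (use 3 in auto)
    then show "deriv_on {-1..1} r (G r) \<in> L2 {-1..1}"
      by (intro L2_AE_eq[OF G_L2[of "2 * r"]]) auto
  qed
qed

lemma G_deriv_on_AE: "AE x in lebesgue_on {-1..1}. deriv_on {-1..1} r (G r) x = (-1)^(r + 1) * \<mu> * G 0 x"
proof -
  have "AE x in lebesgue. x \<noteq> t"
    by (metis (mono_tags, lifting) AE_lborel_singleton AE_completion eventually_mono)
  then show ?thesis
    unfolding AE_restrict_space_iff
    by (auto simp: AE_restrict_space_iff G_deriv_on_top G_top elim!: eventually_mono)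
qed

text \<open>The sign of the jump is chosen for this: (-1)^(r-k-1) from integration by parts times
  (-1)^(k+1) is (-1)^r, which no longer depends on k and is cancelled by multiplying with
  \<sigma>.\<close>

lemma reproducing:
  assumes f: "f \<in> L2_deriv {-1..1} r"
  shows "\<gamma> * deriv_on {-1..1} k f t = L2_inner f (G r) + (-1)^(r + 1) * L2_inner (deriv_on {-1..1} r f) (G 0)"
proof -
  have eq: "L2_inner (deriv_on {-1..1} r f) (G 0) - (-1)^r * L2_inner f (G r)
    = - ((-1)^(r - k - 1) * ((-1)^(k + 1) * \<gamma>) * deriv_on {-1..1} k f t)"
    by (rule green_identity[OF t k _ _ _ _ f])
       (use gc piecewise_chain_mono[OF pc, of r] in \<open>auto simp: green_chain_def\<close>)
  have "(-1)^(r - k - 1) * (-1::real)^(k + 1) = (-1)^r"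
  proof -
    have e: "r - k - 1 + (k + 1) = r" using k by simp
    show ?thesis by (simp only: power_add[symmetric] e)
  qed
  then have e: "(-1)^(r - k - 1) * ((-1)^(k + 1) * \<gamma>) * deriv_on {-1..1} k f t = (-1)^r * (\<gamma> * deriv_on {-1..1} k f t)"
    by (simp only: mult.assoc[symmetric])
  define \<sigma> where "\<sigma> = (-1::real)^r"
  have \<sigma>: "\<sigma> * \<sigma> = 1" by (simp add: \<sigma>_def flip: power_mult_distrib)
  have "\<sigma> * (L2_inner (deriv_on {-1..1} r f) (G 0) - \<sigma> * L2_inner f (G r)) = - (\<sigma> * (\<sigma> * (\<gamma> * deriv_on {-1..1} k f t)))"
    using eq unfolding e \<sigma>_def by simp
  then have "\<sigma> * L2_inner (deriv_on {-1..1} r f) (G 0) - \<sigma> * \<sigma> * L2_inner f (G r) = - (\<sigma> * \<sigma> * (\<gamma> * deriv_on {-1..1} k f t))"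
    by (simp only: right_diff_distrib mult.assoc)
  then show ?thesis unfolding \<sigma> by (simp add: \<sigma>_def)
qed

end

text \<open>The reproducing identity is applied to the r-th derivative of another Green function,
  whose own r-th derivative is a multiple of that function by \<open>G_deriv_on_AE\<close>; the two
  signs multiply to 1.\<close>

lemma (in green) reproducing_green:
  assumes "green r k \<mu>' t \<gamma>' L' R'"
  shows "\<gamma> * glue t (L' (r + k)) (R' (r + k)) t
    = L2_inner (glue t (L' r) (R' r)) (G r) + \<mu>' * L2_inner (glue t (L' 0) (R' 0)) (G 0)"
proof -
  interpret g: green r k \<mu>' t \<gamma>' L' R' by fact
  have "L2_inner (deriv_on {-1..1} r (g.G r)) (G 0) = L2_inner (\<lambda>x. (-1)^(r + 1) * \<mu>' * g.G 0 x) (G 0)"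
    by (rule L2_inner_cong_AE[OF _ _ _ _ g.G_deriv_on_AE])
       (use g.G_L2_deriv L2_scale[OF g.G_L2[of 0]] G_L2 in \<open>auto simp: L2_deriv_def simp del: power_Suc\<close>)
  also have "\<dots> = (-1)^(r + 1) * \<mu>' * L2_inner (g.G 0) (G 0)" by (rule L2_inner_scale)
  finally have "\<gamma> * deriv_on {-1..1} k (g.G r) t = L2_inner (g.G r) (G r) + ((-1)^(r + 1) * (-1)^(r + 1)) * \<mu>' * L2_inner (g.G 0) (G 0)"
    using reproducing[OF g.G_L2_deriv] by simp
  moreover have "((-1)^(r + 1) * (-1)^(r + 1)) = (1::real)" by (simp flip: power_mult_distrib)
  ultimately show ?thesis using g.G_deriv_on[of k t] t k by simp
qed

section \<open>Uniqueness for the homogeneous problem\<close>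

lemma AE_eq_0_continuous:
  fixes f :: "real \<Rightarrow> real"
  assumes "continuous_on {a..b} f" "AE x in lebesgue_on S. f x = 0" "{a..b} \<subseteq> S" "S \<in> sets lebesgue" "a < b" "x \<in> {a..b}"
  shows "f x = 0"
proof -
  have c: "continuous_on {a..b} (\<lambda>x. \<bar>f x\<bar>)" using assms by (intro continuous_intros)
  have "AE x in lebesgue. x \<in> S \<longrightarrow> f x = 0"
    using assms(2,4) by (simp add: AE_restrict_space_iff)
  then have "AE x in lebesgue. x \<in> {a..b} \<longrightarrow> f x = 0"
    by (rule eventually_mono) (use assms(3) in auto)
  then have "AE x in lebesgue_on {a..b}. f x = 0" by (simp add: AE_restrict_space_iff)
  then have "integral\<^sup>L (lebesgue_on {a..b}) (\<lambda>x. \<bar>f x\<bar>) = integral\<^sup>L (lebesgue_on {a..b}) (\<lambda>x. 0)"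
    using continuous_imp_measurable_on_sets_lebesgue[OF c] by (intro integral_cong_AE) (auto elim: eventually_mono)
  then have "\<forall>x\<in>{a..b}. \<bar>f x\<bar> = 0" using integralL_eq_0_iff[OF c \<open>a < b\<close>] by simp
  then show ?thesis using assms(6) by simp
qed

lemma (in green) eq_0_if_AE:
  assumes "AE x in lebesgue_on {-1..1}. G s x = 0" "s \<le> 2 * r"
  shows "\<And>x. x \<in> {-1..t} \<Longrightarrow> L s x = 0" "\<And>x. x \<in> {t..1} \<Longrightarrow> R s x = 0"
proof -
  have *: "AE x in lebesgue. x \<in> {-1..1} \<longrightarrow> G s x = 0"
    using assms(1) by (simp add: AE_restrict_space_iff)
  have "AE x in lebesgue. x \<in> {-1..t} \<longrightarrow> L s x = 0"
    using * by (rule eventually_mono) (use t in \<open>auto simp: glue_def\<close>)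
  then have aeL: "AE x in lebesgue_on {-1..t}. L s x = 0" by (simp add: AE_restrict_space_iff)
  show "x \<in> {-1..t} \<Longrightarrow> L s x = 0" for x
    by (rule AE_eq_0_continuous[OF piecewise_chain_continuous(1)[OF pc assms(2)] aeL order_refl _ t(1)]) auto
  \<comment> \<open>At t the glued function takes the value of the left piece, so t is removed
    before reading off \<open>R\<close>.\<close>
  have "AE x in lebesgue. x \<noteq> t"
    by (metis (mono_tags, lifting) AE_lborel_singleton AE_completion eventually_mono)
  with * have "AE x in lebesgue. x \<in> {t..1} \<longrightarrow> R s x = 0"
    by eventually_elim (use t in \<open>auto simp: glue_def split: if_splits\<close>)
  then have aeR: "AE x in lebesgue_on {t..1}. R s x = 0" by (simp add: AE_restrict_space_iff)
  show "x \<in> {t..1} \<Longrightarrow> R s x = 0" for x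
    by (rule AE_eq_0_continuous[OF piecewise_chain_continuous(2)[OF pc assms(2)] aeR order_refl _ t(2)]) auto
qed

text \<open>With \<gamma> = 0 the left side of \<open>reproducing_green\<close> vanishes, so the
  energy ||G r||^2 + \<mu> ||G 0||^2 is 0. The claim about \<open>L r\<close> serves to recover the
  coefficients in \<open>green_exists\<close>.\<close>

lemma (in green) homogeneous_eq_0:
  assumes "\<gamma> = 0" "\<mu> > 0"
  shows "x \<in> {-1..t} \<Longrightarrow> L 0 x = 0" "x \<in> {t..1} \<Longrightarrow> R 0 x = 0" "x \<in> {-1..t} \<Longrightarrow> L r x = 0"
proof -
  have "(L2_norm (G r))\<^sup>2 + \<mu> * (L2_norm (G 0))\<^sup>2 = 0"
    using reproducing_green[of \<mu> \<gamma> L R] assms(1) green_axioms by (simp add: L2_norm_power2)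
  then have "(L2_norm (G 0))\<^sup>2 = 0 \<and> (L2_norm (G r))\<^sup>2 = 0" using \<open>\<mu> > 0\<close>
    by (smt (verit) mult_nonneg_nonneg mult_eq_0_iff zero_le_power2)
  then have "AE x in lebesgue_on {-1..1}. G 0 x = 0" "AE x in lebesgue_on {-1..1}. G r x = 0"
    using L2_inner_self_eq_0 G_L2 by (simp_all add: L2_norm_power2)
  then show "x \<in> {-1..t} \<Longrightarrow> L 0 x = 0" "x \<in> {t..1} \<Longrightarrow> R 0 x = 0" "x \<in> {-1..t} \<Longrightarrow> L r x = 0"
    using eq_0_if_AE[of 0] eq_0_if_AE(1)[of r] by simp_all
qed

lemma green_unique:
  assumes "green r k \<mu> t \<gamma> L R" "green r k \<mu> t \<gamma> L' R'" "\<mu> > 0"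
  shows "x \<in> {-1..t} \<Longrightarrow> L 0 x = L' 0 x" "x \<in> {t..1} \<Longrightarrow> R 0 x = R' 0 x"
proof -
  interpret a: green r k \<mu> t \<gamma> L R by fact
  interpret b: green r k \<mu> t \<gamma> L' R' by fact
  have "piecewise_chain (2 * r) t (\<lambda>s x. L s x - L' s x) (\<lambda>s x. R s x - R' s x)"
    using a.pc b.pc unfolding piecewise_chain_def
    by (auto intro!: has_vector_derivative_diff continuous_on_diff)
  then have "green_chain r k \<mu> t 0 (\<lambda>s x. L s x - L' s x) (\<lambda>s x. R s x - R' s x)"
    using a.gc b.gc unfolding green_chain_def by (auto simp: algebra_simps)
  then interpret d: green r k \<mu> t 0 "\<lambda>s x. L s x - L' s x" "\<lambda>s x. R s x - R' s x"
    using a.k a.t by unfold_locales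
  show "x \<in> {-1..t} \<Longrightarrow> L 0 x = L' 0 x" "x \<in> {t..1} \<Longrightarrow> R 0 x = R' 0 x"
    using d.homogeneous_eq_0(1,2)[OF _ \<open>\<mu> > 0\<close>] by simp_all
qed

section \<open>The boundary value problem\<close>

text \<open>On the open interval \<open>w\<close> differs by a constant from an antiderivative of
  \<open>g\<close> that lives on the closed one.\<close>

lemma extend_antiderivative:
  fixes w g :: "real \<Rightarrow> real"
  assumes "a < b" and cont: "continuous_on {a..b} g"
    and der: "\<And>x. x \<in> {a<..<b} \<Longrightarrow> (w has_vector_derivative g x) (at x)"
  obtains W where "\<And>x. x \<in> {a..b} \<Longrightarrow> (W has_vector_derivative g x) (at x within {a..b})"
    "\<And>x. x \<in> {a<..<b} \<Longrightarrow> w x = W x"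
proof -
  obtain V where V: "\<And>x. x \<in> {a..b} \<Longrightarrow> (V has_vector_derivative g x) (at x within {a..b})"
    using antiderivative_continuous[OF cont] by metis
  have "((\<lambda>x. w x - V x) has_vector_derivative 0) (at x within {a<..<b})" if "x \<in> {a<..<b}" for x
  proof -
    have "(V has_vector_derivative g x) (at x within {a<..<b})"
      by (rule has_vector_derivative_within_subset[OF V]) (use that in auto)
    moreover have "(w has_vector_derivative g x) (at x within {a<..<b})"
      using der[OF that] has_vector_derivative_at_within by blast
    ultimately show ?thesis using has_vector_derivative_diff by fastforce
  qed
  then obtain c where c: "\<And>x. x \<in> {a<..<b} \<Longrightarrow> w x - V x = c"
    using has_vector_derivative_zero_constant[of "{a<..<b}" "\<lambda>x. w x - V x"] by auto
  show thesis
  proof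
    show "((\<lambda>x. V x + c) has_vector_derivative g x) (at x within {a..b})" if "x \<in> {a..b}" for x
      using has_vector_derivative_add[OF V[OF that] has_vector_derivative_const] by simp
    show "w x = V x + c" if "x \<in> {a<..<b}" for x using c[OF that] by simp
  qed
qed

lemma tendsto_at_right_agree:
  fixes v P :: "real \<Rightarrow> real"
  assumes "a < b" "continuous_on {a..b} P" "\<And>x. x \<in> {a<..<b} \<Longrightarrow> v x = P x"
  shows "(v \<longlongrightarrow> P a) (at_right a)"
proof -
  have "(P \<longlongrightarrow> P a) (at_right a)" using continuous_on_Icc_at_rightD assms by blast
  moreover have "eventually (\<lambda>x. P x = v x) (at_right a)"
    unfolding eventually_at_right[OF \<open>a < b\<close>] using assms by (intro exI[of _ b]) auto
  ultimately show ?thesis by (rule Lim_transform_eventually)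
qed

lemma tendsto_at_left_agree:
  fixes v P :: "real \<Rightarrow> real"
  assumes "a < b" "continuous_on {a..b} P" "\<And>x. x \<in> {a<..<b} \<Longrightarrow> v x = P x"
  shows "(v \<longlongrightarrow> P b) (at_left b)"
proof -
  have "(P \<longlongrightarrow> P b) (at_left b)" using continuous_on_Icc_at_leftD assms by blast
  moreover have "eventually (\<lambda>x. P x = v x) (at_left b)"
    unfolding eventually_at_left[OF \<open>a < b\<close>] using assms by (intro exI[of _ a]) auto
  ultimately show ?thesis by (rule Lim_transform_eventually)
qed

text \<open>Since \<open>v\<^sup>(\<^sup>n\<^sup>) = c v\<close> has limits at the end points, integrating it down extends every
  derivative continuously to the closed interval.\<close>

lemma extend_chain_closed:
  fixes v :: "nat \<Rightarrow> real \<Rightarrow> real"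
  assumes "a < b" "n \<ge> 1"
    and der: "\<And>s x. s < n \<Longrightarrow> x \<in> {a<..<b} \<Longrightarrow> (v s has_vector_derivative v (Suc s) x) (at x)"
    and top: "\<And>x. x \<in> {a<..<b} \<Longrightarrow> v n x = c * v 0 x"
    and lims: "(v 0 \<longlongrightarrow> p) (at_right a)" "(v 0 \<longlongrightarrow> q) (at_left b)"
  obtains P where "\<And>s x. s < n \<Longrightarrow> x \<in> {a..b} \<Longrightarrow> (P s has_vector_derivative P (Suc s) x) (at x within {a..b})"
    "\<And>x. x \<in> {a..b} \<Longrightarrow> P n x = c * P 0 x" "\<And>s x. s \<le> n \<Longrightarrow> x \<in> {a<..<b} \<Longrightarrow> v s x = P s x"
proof -
  define h where "h x = (if x = a then p else if x = b then q else v 0 x)" for x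
  have hc: "continuous_on {a..b} h"
  proof (rule continuous_on_IccI[OF _ _ _ \<open>a < b\<close>])
    have "eventually (\<lambda>x. v 0 x = h x) (at_right a)"
      unfolding eventually_at_right[OF \<open>a < b\<close>] using \<open>a < b\<close> by (intro exI[of _ b]) (auto simp: h_def)
    then have "(h \<longlongrightarrow> p) (at_right a)" using lims(1) Lim_transform_eventually by blast
    then show "(h \<longlongrightarrow> h a) (at_right a)" by (simp add: h_def)
    have "eventually (\<lambda>x. v 0 x = h x) (at_left b)"
      unfolding eventually_at_left[OF \<open>a < b\<close>] using \<open>a < b\<close> by (intro exI[of _ a]) (auto simp: h_def)
    then have "(h \<longlongrightarrow> q) (at_left b)" using lims(2) Lim_transform_eventually by blast
    then show "(h \<longlongrightarrow> h b) (at_left b)" using \<open>a < b\<close> by (simp add: h_def)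
    fix x assume x: "a < x" "x < b"
    have "(v 0 \<longlongrightarrow> v 0 x) (at x)"
      using der[of 0 x] \<open>n \<ge> 1\<close> x has_vector_derivative_continuous isCont_def by fastforce
    moreover have "eventually (\<lambda>y. y \<in> {a<..<b}) (at x)"
      using x eventually_at_in_open'[of "{a<..<b}" x] by simp
    then have "eventually (\<lambda>y. v 0 y = h y) (at x)"
      by (rule eventually_mono) (auto simp: h_def)
    ultimately have "(h \<longlongrightarrow> v 0 x) (at x)" using Lim_transform_eventually by blast
    then show "(h \<longlongrightarrow> h x) (at x)" using x by (simp add: h_def)
  qed
  have "\<exists>P. P n = (\<lambda>x. c * h x) \<and>
     (\<forall>s. n - m \<le> s \<and> s < n \<longrightarrow> (\<forall>x\<in>{a..b}. (P s has_vector_derivative P (Suc s) x) (at x within {a..b}))) \<and>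
     (\<forall>s. n - m \<le> s \<and> s \<le> n \<longrightarrow> (\<forall>x\<in>{a<..<b}. v s x = P s x))" if "m \<le> n" for m
    using that
  proof (induction m)
    case 0
    then show ?case by (intro exI[of _ "\<lambda>_ x. c * h x"]) (auto simp: h_def top)
  next
    case (Suc m)
    then obtain P where P: "P n = (\<lambda>x. c * h x)"
      "\<And>s x. n - m \<le> s \<Longrightarrow> s < n \<Longrightarrow> x \<in> {a..b} \<Longrightarrow> (P s has_vector_derivative P (Suc s) x) (at x within {a..b})"
      "\<And>s x. n - m \<le> s \<Longrightarrow> s \<le> n \<Longrightarrow> x \<in> {a<..<b} \<Longrightarrow> v s x = P s x" by auto
    define i where "i = n - Suc m"
    have i: "i < n" "Suc i = n - m" using Suc.prems by (auto simp: i_def)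
    have c: "continuous_on {a..b} (P (Suc i))"
    proof (cases "Suc i = n")
      case True
      then show ?thesis using P(1) hc by (auto intro!: continuous_intros)
    next
      case False
      then show ?thesis using chain_continuous_on[of "{a..b}" "P (Suc i)" "P (Suc (Suc i))"] P(2)[of "Suc i"] i by auto
    qed
    have "(v i has_vector_derivative P (Suc i) x) (at x)" if "x \<in> {a<..<b}" for x
      using der[OF i(1) that] P(3)[of "Suc i" x] i that by simp
    then obtain W where W: "\<And>x. x \<in> {a..b} \<Longrightarrow> (W has_vector_derivative P (Suc i) x) (at x within {a..b})"
      "\<And>x. x \<in> {a<..<b} \<Longrightarrow> v i x = W x"
      using extend_antiderivative[OF \<open>a < b\<close> c] by metis
    have s: "s = i \<or> n - m \<le> s" if "n - Suc m \<le> s" for s using that i by (auto simp: i_def)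
    show ?case
    proof (intro exI[of _ "P(i := W)"] conjI allI impI ballI)
      show "(P(i := W)) n = (\<lambda>x. c * h x)" using P(1) i by simp
    next
      fix s x assume "n - Suc m \<le> s \<and> s < n" and x: "x \<in> {a..b}"
      then show "((P(i := W)) s has_vector_derivative (P(i := W)) (Suc s) x) (at x within {a..b})"
        using s[of s] W(1)[OF x] P(2)[of s x] i by (cases "s = i") auto
    next
      fix s x assume "n - Suc m \<le> s \<and> s \<le> n" and x: "x \<in> {a<..<b}"
      then show "v s x = (P(i := W)) s x"
        using s[of s] W(2)[OF x] P(3)[of s x] i by (cases "s = i") auto
    qed
  qed
  from this[of n] obtain P where P: "P n = (\<lambda>x. c * h x)"
      "\<And>s x. s < n \<Longrightarrow> x \<in> {a..b} \<Longrightarrow> (P s has_vector_derivative P (Suc s) x) (at x within {a..b})"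
      "\<And>s x. s \<le> n \<Longrightarrow> x \<in> {a<..<b} \<Longrightarrow> v s x = P s x" by auto
  have c0: "continuous_on {a..b} (P 0)" using chain_continuous_on[of "{a..b}" "P 0" "P 1"] P(2)[of 0] \<open>n \<ge> 1\<close> by auto
  \<comment> \<open>\<open>P 0\<close> came out of the integration, \<open>h\<close> out of the
    limits; once their end values agree, \<open>c * h x\<close> may be read as
    \<open>c * P 0 x\<close>.\<close>
  have "P 0 a = p" 
    using tendsto_unique[OF _ tendsto_at_right_agree[OF \<open>a < b\<close> c0, of "v 0"] lims(1)] P(3)[of 0] by simp
  moreover have "P 0 b = q"
    using tendsto_unique[OF _ tendsto_at_left_agree[OF \<open>a < b\<close> c0, of "v 0"] lims(2)] P(3)[of 0] by simp
  ultimately have "h x = P 0 x" if "x \<in> {a..b}" for x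
    using P(3)[of 0 x] that by (cases "x = a \<or> x = b") (auto simp: h_def)
  then show thesis using that[of P] P by simp
qed

text \<open>Links the derivatives on one half, to which \<open>L2_deriv\<close> refers, with those
  on the punctured interval.\<close>

lemma deriv_on_open_subset:
  assumes "open S" "open T" "S \<subseteq> T"
  shows "x \<in> S \<Longrightarrow> deriv_on T s u x = deriv_on S s u x"
proof (induction s arbitrary: x)
  case (Suc s)
  have "eventually (\<lambda>y. y \<in> S) (nhds x)" using Suc.prems assms(1) eventually_nhds_in_open by blast
  then have "eventually (\<lambda>y. y \<in> UNIV \<longrightarrow> deriv_on T s u y = deriv_on S s u y) (nhds x)"
    by (rule eventually_mono) (use Suc.IH in auto)
  then have "vector_derivative (deriv_on T s u) (at x) = vector_derivative (deriv_on S s u) (at x)"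
    by (rule vector_derivative_cong_eq) auto
  moreover have "at x within T = at x" "at x within S = at x"
    using assms Suc.prems by (auto intro!: at_within_open)
  ultimately show ?case by simp
qed simp

text \<open>Stated for any \<open>S\<close> inside \<open>{a..b}\<close>, as it serves the open
  halves of the punctured interval as well as \<open>{-1..1}\<close>; bounds come from the compact
  interval.\<close>

lemma L2_deriv_chain:
  assumes "a < b" "n \<ge> 1" and S: "S \<subseteq> {a..b}" "S \<in> lmeasurable"
    and lim: "\<And>x. x \<in> S \<Longrightarrow> at x within S \<noteq> bot"
    and P: "\<And>s x. s < n \<Longrightarrow> x \<in> {a..b} \<Longrightarrow> (P s has_vector_derivative P (Suc s) x) (at x within {a..b})"
    and c: "continuous_on {a..b} (P n)" and u: "\<And>x. x \<in> S \<Longrightarrow> u x = P 0 x"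
  shows "u \<in> L2_deriv S n" "\<And>s x. s \<le> n \<Longrightarrow> x \<in> S \<Longrightarrow> deriv_on S s u x = P s x"
proof -
  have ch: "(P s has_vector_derivative P (Suc s) x) (at x within S)" if "s < n" "x \<in> S" for s x
    by (rule has_vector_derivative_within_subset[OF P]) (use that S in auto)
  show 1: "deriv_on S s u x = P s x" if "s \<le> n" "x \<in> S" for s x
    by (rule deriv_on_eq_chain[OF lim ch u that])
  have 2: "deriv_on S s u differentiable (at x within S)" if "s < n" "x \<in> S" for s x
    using deriv_on_chain_has_vector_derivative[OF lim ch u _ _ ch[of s x]] that differentiableI_vector
    by (metis less_imp_le)
  show "u \<in> L2_deriv S n"
    unfolding L2_deriv_def
  proof (intro CollectI conjI allI impI ballI)
    fix j x assume "j < n - 1" "x \<in> S"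
    then show "deriv_on S j u differentiable (at x within S)" using 2 by simp
  next
    have "\<And>x. x \<in> {a..b} \<Longrightarrow> (P (n - 1) has_vector_derivative P n x) (at x within {a..b})"
      using P[of "n - 1"] \<open>n \<ge> 1\<close> by simp
    then obtain B where B: "B \<ge> 0" "\<And>x y. x \<in> {a..b} \<Longrightarrow> y \<in> {a..b} \<Longrightarrow> \<bar>P (n - 1) y - P (n - 1) x\<bar> \<le> B * \<bar>y - x\<bar>"
      using C1_lipschitz[of a b "P (n - 1)" "P n"] c \<open>a < b\<close> by (metis less_imp_le)
    have "absolutely_continuous_on S (P (n - 1))"
    proof (rule absolutely_continuous_on_lipschitz[OF B(1)])
      fix x y assume "x \<in> S" "y \<in> S" "x \<le> y"
      then show "\<bar>P (n - 1) y - P (n - 1) x\<bar> \<le> B * (y - x)" using B(2)[of x y] S by (simp add: subset_iff)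
    qed
    then show "absolutely_continuous_on S (deriv_on S (n - 1) u)"
      using absolutely_continuous_on_cong[of S "deriv_on S (n - 1) u" "P (n - 1)"] 1[of "n - 1"] by simp
  next
    show "AE x in lebesgue_on S. deriv_on S (n - 1) u differentiable (at x within S)"
      using 2[of "n - 1"] \<open>n \<ge> 1\<close> by (intro AE_I2) (simp add: space_restrict_space)
  next
    have "bounded (P n ` {a..b})" using c compact_continuous_image compact_imp_bounded by blast
    then obtain B where B: "\<And>x. x \<in> {a..b} \<Longrightarrow> \<bar>P n x\<bar> \<le> B"
      unfolding bounded_pos by (metis imageI real_norm_def)
    have "continuous_on S (deriv_on S n u)"
      by (rule continuous_on_eq[OF continuous_on_subset[OF c S(1)]]) (use 1[of n] in auto)
    then have "deriv_on S n u \<in> borel_measurable (lebesgue_on S)"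
      by (rule continuous_imp_measurable_on_sets_lebesgue) (use S in auto)
    then show "deriv_on S n u \<in> L2 S"
      by (rule L2_bounded[where B = B]) (use 1[of n] B S in auto)
  qed
qed

section \<open>Passage between solutions and chains\<close>

lemma punctured_open: "open (punctured t)"
  by (auto simp: punctured_def)

text \<open>The chain is the continuous extension of all derivatives to the closed halves, so that
  the limits in the boundary and jump conditions become values of \<open>L\<close> and
  \<open>R\<close>.\<close>

lemma bvp_solution_imp_green:
  assumes bvp: "bvp_solution r k \<mu> t u" and k: "k < r" and t: "-1 < t" "t < 1"
  obtains L R where "green r k \<mu> t 1 L R"
    "\<And>x. x \<in> punctured t \<Longrightarrow> u x = glue t (L 0) (R 0) x"
proof -
  let ?D = "\<lambda>s. deriv_on (punctured t) s u"
  let ?c = "(-1)^(r + 1) * \<mu>"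
  have open_sub: "{-1<..<t} \<subseteq> punctured t" "{t<..<1} \<subseteq> punctured t" by (auto simp: punctured_def)
  have diff: "?D s differentiable (at x)" if "s < 2 * r" "x \<in> punctured t" for s x
  \<comment> \<open>\<open>L2_deriv\<close> gives differentiability everywhere for orders below 2r -
    1 and almost everywhere for 2r - 1, where the clause of \<open>bvp_solution\<close> takes
    over.\<close>
  proof (cases "s = 2 * r - 1")
    case True
    then show ?thesis using bvp that by (simp add: bvp_solution_def)
  next
    case False
    then have s: "s < 2 * r - 1" using that by simp
    have *: "?D s differentiable (at x)" if "x \<in> S" "open S" "S \<subseteq> punctured t" "u \<in> L2_deriv S (2 * r)" for S
    proof -
      have "(deriv_on S s u has_vector_derivative deriv_on S (Suc s) u x) (at x within S)"
        using L2_deriv_has_vector_derivative[OF that(4) s that(1)] .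
      then have "(?D s has_vector_derivative deriv_on S (Suc s) u x) (at x within S)"
        by (rule has_vector_derivative_transform[OF that(1), rotated])
           (use deriv_on_open_subset[OF that(2) punctured_open that(3)] in auto)
      then show ?thesis using at_within_open[OF that(1,2)] differentiableI_vector by metis
    qed
    from that(2) consider "x \<in> {-1<..<t}" | "x \<in> {t<..<1}" by (auto simp: punctured_def)
    then show ?thesis
      by cases (use *[OF _ _ open_sub(1)] *[OF _ _ open_sub(2)] bvp in \<open>auto simp: bvp_solution_def\<close>)
  qed
  have der: "(?D s has_vector_derivative ?D (Suc s) x) (at x)" if "s < 2 * r" "x \<in> punctured t" for s x
    using diff[OF that] at_within_open[OF that(2) punctured_open]
    by (simp add: vector_derivative_works[symmetric])
  have top: "?D (2 * r) x = ?c * ?D 0 x" if "x \<in> punctured t" for x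
  proof -
    have "(-1) ^ r * ?D (2 * r) x + \<mu> * u x = 0" using bvp that by (simp add: bvp_solution_def)
    then have "(-1)^r * ((-1) ^ r * ?D (2 * r) x) = - ((-1)^r * (\<mu> * u x))" 
      by (metis add_eq_0_iff2 mult_minus_right)
    moreover have "(-1)^r * ((-1) ^ r * ?D (2 * r) x) = ?D (2 * r) x"
      by (simp flip: mult.assoc power_mult_distrib)
    ultimately show ?thesis by simp
  qed
  have bc: "(?D s \<longlongrightarrow> 0) (at_right (-1))" "(?D s \<longlongrightarrow> 0) (at_left 1)" if "s < r" for s
    using bvp that by (auto simp: bvp_solution_def)
  have jump: "\<exists>p q. (?D s \<longlongrightarrow> p) (at_right t) \<and> (?D s \<longlongrightarrow> q) (at_left t) \<and>
        p - q = (-1) ^ (k + 1) * (if s = r - k - 1 then 1 else 0)" if "s < 2 * r" for s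
    using bvp that unfolding bvp_solution_def by blast
  obtain p q where pq: "(?D 0 \<longlongrightarrow> p) (at_right t)" "(?D 0 \<longlongrightarrow> q) (at_left t)"
    using jump[of 0] k by auto
  have n: "2 * r \<ge> 1" using k by simp
  obtain L where L: "\<And>s x. s < 2 * r \<Longrightarrow> x \<in> {-1..t} \<Longrightarrow> (L s has_vector_derivative L (Suc s) x) (at x within {-1..t})"
    "\<And>x. x \<in> {-1..t} \<Longrightarrow> L (2 * r) x = ?c * L 0 x" "\<And>s x. s \<le> 2 * r \<Longrightarrow> x \<in> {-1<..<t} \<Longrightarrow> ?D s x = L s x"
  proof (rule extend_chain_closed[OF t(1) n, where v = ?D])
    show "(?D 0 \<longlongrightarrow> 0) (at_right (-1))" using bc(1)[of 0] k by simp
    show "(?D 0 \<longlongrightarrow> q) (at_left t)" by fact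
    show "(?D s has_vector_derivative ?D (Suc s) x) (at x)" if "s < 2 * r" "x \<in> {-1<..<t}" for s x
      using der that open_sub(1) by blast
    show "?D (2 * r) x = ?c * ?D 0 x" if "x \<in> {-1<..<t}" for x
      using top that open_sub(1) by blast
  next
    fix P
    assume "\<And>s x. s < 2 * r \<Longrightarrow> x \<in> {-1..t} \<Longrightarrow> (P s has_vector_derivative P (Suc s) x) (at x within {-1..t})"
      "\<And>x. x \<in> {-1..t} \<Longrightarrow> P (2 * r) x = ?c * P 0 x" "\<And>s x. s \<le> 2 * r \<Longrightarrow> x \<in> {-1<..<t} \<Longrightarrow> ?D s x = P s x"
    then show thesis by (rule that)
  qed
  obtain R where R: "\<And>s x. s < 2 * r \<Longrightarrow> x \<in> {t..1} \<Longrightarrow> (R s has_vector_derivative R (Suc s) x) (at x within {t..1})"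
    "\<And>x. x \<in> {t..1} \<Longrightarrow> R (2 * r) x = ?c * R 0 x" "\<And>s x. s \<le> 2 * r \<Longrightarrow> x \<in> {t<..<1} \<Longrightarrow> ?D s x = R s x"
  proof (rule extend_chain_closed[OF t(2) n, where v = ?D])
    show "(?D 0 \<longlongrightarrow> p) (at_right t)" by fact
    show "(?D 0 \<longlongrightarrow> 0) (at_left 1)" using bc(2)[of 0] k by simp
    show "(?D s has_vector_derivative ?D (Suc s) x) (at x)" if "s < 2 * r" "x \<in> {t<..<1}" for s x
      using der that open_sub(2) by blast
    show "?D (2 * r) x = ?c * ?D 0 x" if "x \<in> {t<..<1}" for x
      using top that open_sub(2) by blast
  next
    fix P
    assume "\<And>s x. s < 2 * r \<Longrightarrow> x \<in> {t..1} \<Longrightarrow> (P s has_vector_derivative P (Suc s) x) (at x within {t..1})"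
      "\<And>x. x \<in> {t..1} \<Longrightarrow> P (2 * r) x = ?c * P 0 x" "\<And>s x. s \<le> 2 * r \<Longrightarrow> x \<in> {t<..<1} \<Longrightarrow> ?D s x = P s x"
    then show thesis by (rule that)
  qed
  have Lc: "continuous_on {-1..t} (L s)" if "s < 2 * r" for s
    using chain_continuous_on[of "{-1..t}" "L s" "L (Suc s)"] L(1) that by simp
  have Rc: "continuous_on {t..1} (R s)" if "s < 2 * r" for s
    using chain_continuous_on[of "{t..1}" "R s" "R (Suc s)"] R(1) that by simp
  have pc: "piecewise_chain (2 * r) t L R"
    unfolding piecewise_chain_def
  proof (intro conjI)
    show "continuous_on {-1..t} (L (2 * r))"
      by (rule continuous_on_eq[where f = "\<lambda>x. ?c * L 0 x"])
         (use L(2) Lc[of 0] k in \<open>auto intro!: continuous_intros\<close>)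
    show "continuous_on {t..1} (R (2 * r))"
      by (rule continuous_on_eq[where f = "\<lambda>x. ?c * R 0 x"])
         (use R(2) Rc[of 0] k in \<open>auto intro!: continuous_intros\<close>)
  qed (use L R in auto)
  have Lv: "L s (-1) = 0" "R s 1 = 0" if "s < r" for s
  proof -
    have s: "s < 2 * r" using that by simp
    show "L s (-1) = 0"
      using tendsto_unique[OF _ tendsto_at_right_agree[OF t(1) Lc[OF s], of "?D s"] bc(1)[OF that]] L(3)[of s] s by simp
    show "R s 1 = 0"
      using tendsto_unique[OF _ tendsto_at_left_agree[OF t(2) Rc[OF s], of "?D s"] bc(2)[OF that]] R(3)[of s] s by simp
  qed
  have J: "R s t - L s t = (if s = r - k - 1 then (-1)^(k + 1) * 1 else 0)" if s: "s < 2 * r" for s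
  proof -
    obtain p q where pq: "(?D s \<longlongrightarrow> p) (at_right t)" "(?D s \<longlongrightarrow> q) (at_left t)"
        "p - q = (-1) ^ (k + 1) * (if s = r - k - 1 then 1 else 0)" using jump[OF s] by blast
    have "R s t = p"
      using tendsto_unique[OF _ tendsto_at_right_agree[OF t(2) Rc[OF s], of "?D s"] pq(1)] R(3)[of s] s by simp
    moreover have "L s t = q"
      using tendsto_unique[OF _ tendsto_at_left_agree[OF t(1) Lc[OF s], of "?D s"] pq(2)] L(3)[of s] s by simp
    ultimately show ?thesis using pq(3) by simp
  qed
  show thesis
  proof
    show "green r k \<mu> t 1 L R"
      by unfold_locales (use k t pc L(2) R(2) Lv J in \<open>auto simp: green_chain_def\<close>)
    show "u x = glue t (L 0) (R 0) x" if "x \<in> punctured t" for x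
      using that L(3)[of 0 x] R(3)[of 0 x] by (auto simp: punctured_def glue_def)
  qed
qed

context green begin

lemma deriv_on_punctured:
  assumes u: "\<And>x. x \<in> punctured t \<Longrightarrow> u x = G 0 x" and "x \<in> punctured t"
  shows "s \<le> 2 * r \<Longrightarrow> deriv_on (punctured t) s u x = G s x"
    and "s < 2 * r \<Longrightarrow> (deriv_on (punctured t) s u has_vector_derivative G (Suc s) x) (at x)"
proof -
  have lim: "at x within punctured t \<noteq> bot" if "x \<in> punctured t" for x
    using that punctured_open by (intro at_within_open_neq_bot)
  have ch: "(G s has_vector_derivative G (Suc s) x) (at x within punctured t)" if s: "s < 2 * r" and x: "x \<in> punctured t" for s x
  proof -
    have *: "(G s has_vector_derivative G (Suc s) x) (at x)"
      if "x \<in> S" "open S" "S \<subseteq> T" "(P has_vector_derivative G (Suc s) x) (at x within T)" "\<And>y. y \<in> S \<Longrightarrow> G s y = P y" for S T P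
    proof -
      have "(P has_vector_derivative G (Suc s) x) (at x within S)"
        using has_vector_derivative_within_subset that by blast
      then have "(G s has_vector_derivative G (Suc s) x) (at x within S)"
        by (rule has_vector_derivative_transform[OF that(1), rotated]) (use that(5) in auto)
      then show ?thesis using at_within_open[OF that(1,2)] by simp
    qed
    from x consider "x \<in> {-1<..<t}" | "x \<in> {t<..<1}" by (auto simp: punctured_def)
    then have "(G s has_vector_derivative G (Suc s) x) (at x)"
    proof cases
      case 1
      show ?thesis
        by (rule *[where S = "{-1<..<t}" and T = "{-1..t}" and P = "L s"])
           (use 1 pc s in \<open>auto simp: glue_def piecewise_chain_def\<close>)
    next
      case 2
      show ?thesis
        by (rule *[where S = "{t<..<1}" and T = "{t..1}" and P = "R s"])
           (use 2 pc s in \<open>auto simp: glue_def piecewise_chain_def\<close>)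
    qed
    then show ?thesis by (rule has_vector_derivative_at_within)
  qed
  show "deriv_on (punctured t) s u x = G s x" if "s \<le> 2 * r"
    by (rule deriv_on_eq_chain[OF lim ch u that \<open>x \<in> punctured t\<close>])
  show "(deriv_on (punctured t) s u has_vector_derivative G (Suc s) x) (at x)" if "s < 2 * r"
    using deriv_on_chain_has_vector_derivative[OF lim ch u less_imp_le[OF that] \<open>x \<in> punctured t\<close> ch[OF that \<open>x \<in> punctured t\<close>]]
      at_within_open[OF \<open>x \<in> punctured t\<close> punctured_open] by simp
qed

text \<open>Converse of \<open>bvp_solution_imp_green\<close>: the end values of the continuous
  \<open>L s\<close> and \<open>R s\<close> are the limits asked for.\<close>

lemma bvp_solution:
  assumes u: "\<And>x. x \<in> punctured t \<Longrightarrow> u x = G 0 x" and "\<gamma> = 1"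
  shows "bvp_solution r k \<mu> t u"
proof -
  let ?D = "\<lambda>s. deriv_on (punctured t) s u"
  have n: "2 * r \<ge> 1" using k by simp
  have DL: "?D s x = L s x" if "s \<le> 2 * r" "x \<in> {-1<..<t}" for s x
    using deriv_on_punctured(1)[OF u, of x s] that by (auto simp: punctured_def glue_def)
  have DR: "?D s x = R s x" if "s \<le> 2 * r" "x \<in> {t<..<1}" for s x
    using deriv_on_punctured(1)[OF u, of x s] that by (auto simp: punctured_def glue_def)
  show ?thesis
    unfolding bvp_solution_def
  proof (intro conjI ballI allI impI)
    show "u \<in> L2_deriv {-1<..<t} (2 * r)"
      by (rule L2_deriv_chain(1)[OF t(1) n, where P = L])
         (use pc DL[of 0] at_within_open_neq_bot[of "{-1<..<t}"] in \<open>auto simp: piecewise_chain_def\<close>)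
    show "u \<in> L2_deriv {t<..<1} (2 * r)"
      by (rule L2_deriv_chain(1)[OF t(2) n, where P = R])
         (use pc DR[of 0] at_within_open_neq_bot[of "{t<..<1}"] in \<open>auto simp: piecewise_chain_def\<close>)
  next
    fix x assume x: "x \<in> punctured t"
    show "deriv_on (punctured t) (2 * r - 1) u differentiable (at x)"
      using deriv_on_punctured(2)[OF u x, of "2 * r - 1"] k differentiableI_vector by auto
    have "x \<in> {-1..1}" using x t by (auto simp: punctured_def)
    then have "(-1)^r * ?D (2 * r) x = (-1)^r * ((-1)^(r + 1) * \<mu> * u x)"
      using deriv_on_punctured(1)[OF u x, of "2 * r"] G_top u[OF x] by simp
    also have "\<dots> = ((-1)^r * (-1)^r) * (- (\<mu> * u x))" by simp
    also have "\<dots> = - (\<mu> * u x)" by (simp only: flip: power_mult_distrib) simp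
    finally show "(-1) ^ r * ?D (2 * r) x + \<mu> * u x = 0" by simp
  next
    fix s assume s: "s < r"
    have c: "continuous_on {-1..t} (L s)" "continuous_on {t..1} (R s)"
      using piecewise_chain_continuous[OF pc, of s] s by auto
    have z: "L s (-1) = 0" "R s 1 = 0" using gc s by (auto simp: green_chain_def)
    show "(?D s \<longlongrightarrow> 0) (at_right (-1))"
      using tendsto_at_right_agree[OF t(1) c(1), of "?D s"] DL[of s] s z by simp
    show "(?D s \<longlongrightarrow> 0) (at_left 1)"
      using tendsto_at_left_agree[OF t(2) c(2), of "?D s"] DR[of s] s z by simp
  next
    fix s assume s: "s < 2 * r"
    have c: "continuous_on {-1..t} (L s)" "continuous_on {t..1} (R s)"
      using piecewise_chain_continuous[OF pc, of s] s by auto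
    have "R s t - L s t = (if s = r - k - 1 then (-1)^(k + 1) * \<gamma> else 0)"
      using gc s unfolding green_chain_def by blast
    then have "R s t - L s t = (-1)^(k + 1) * (if s = r - k - 1 then 1 else 0)" using \<open>\<gamma> = 1\<close> by simp
    moreover have "(?D s \<longlongrightarrow> R s t) (at_right t)"
      using tendsto_at_right_agree[OF t(2) c(2), of "?D s"] DR[of s] s by simp
    moreover have "(?D s \<longlongrightarrow> L s t) (at_left t)"
      using tendsto_at_left_agree[OF t(1) c(1), of "?D s"] DL[of s] s by simp
    ultimately show "\<exists>p q. (?D s \<longlongrightarrow> p) (at_right t) \<and> (?D s \<longlongrightarrow> q) (at_left t) \<and>
        p - q = (-1) ^ (k + 1) * (if s = r - k - 1 then 1 else 0)" by blast
  qed
qed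

text \<open>The definite description is legitimate: any competitor yields a chain by
  \<open>bvp_solution_imp_green\<close>, and \<open>green_unique\<close> identifies it with the
  given one.\<close>

lemma u_sol_eq:
  assumes "\<gamma> = 1" "\<mu> > 0"
  shows "u_sol r k \<mu> t = (\<lambda>x. if x \<in> punctured t then G 0 x else 0)"
  unfolding u_sol_def
proof (rule the_equality)
  show "bvp_solution r k \<mu> t (\<lambda>x. if x \<in> punctured t then G 0 x else 0) \<and>
    (\<forall>x. x \<notin> punctured t \<longrightarrow> (if x \<in> punctured t then G 0 x else 0) = 0)"
    using bvp_solution[OF _ assms(1)] by simp
  fix v assume v: "bvp_solution r k \<mu> t v \<and> (\<forall>x. x \<notin> punctured t \<longrightarrow> v x = 0)"
  obtain L' R' where LR: "green r k \<mu> t 1 L' R'" "\<And>x. x \<in> punctured t \<Longrightarrow> v x = glue t (L' 0) (R' 0) x"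
    using bvp_solution_imp_green[OF conjunct1[OF v] k t] by metis
  have "green r k \<mu> t 1 L R" using green_axioms assms(1) by simp
  from green_unique[OF LR(1) this assms(2)] have "glue t (L' 0) (R' 0) x = G 0 x" if "x \<in> {-1..1}" for x
    using that by (simp add: glue_def)
  moreover have "x \<in> punctured t \<Longrightarrow> x \<in> {-1..1}" for x using t by (auto simp: punctured_def)
  ultimately show "v = (\<lambda>x. if x \<in> punctured t then G 0 x else 0)"
    using v LR(2) by (auto simp: fun_eq_iff)
qed

lemma AE_punctured: "AE x in lebesgue_on {-1..1}. x \<in> punctured t"
proof -
  have "AE x in lebesgue. x \<noteq> y" for y :: real
    by (metis (mono_tags, lifting) AE_lborel_singleton AE_completion eventually_mono)
  from this[of t] this[of 1] this[of "-1"]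
  have "AE x in lebesgue. x \<in> {-1..1} \<longrightarrow> x \<in> punctured t"
    by eventually_elim (auto simp: punctured_def)
  then show ?thesis by (simp add: AE_restrict_space_iff)
qed

lemma L2_norm_u:
  assumes "\<gamma> = 1" "\<mu> > 0"
  shows "L2_norm (u_sol r k \<mu> t) = L2_norm (G 0)" "s \<le> 2 * r \<Longrightarrow> L2_norm (u_deriv r k \<mu> t s) = L2_norm (G s)"
proof -
  have *: "L2_norm (u_deriv r k \<mu> t s) = L2_norm (G s)" if "s \<le> 2 * r" for s
  proof -
    have eq: "u_deriv r k \<mu> t s x = G s x" if "x \<in> punctured t" for x
      unfolding u_deriv_def
      by (rule deriv_on_punctured(1)) (use that \<open>s \<le> 2 * r\<close> u_sol_eq[OF assms] in auto)
    have ae: "AE x in lebesgue_on {-1..1}. G s x = u_deriv r k \<mu> t s x"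
      using AE_punctured by (rule eventually_mono) (simp add: eq)
    show ?thesis
      using L2_norm_cong_AE[OF G_L2[OF that] L2_AE_eq[OF G_L2[OF that] _ ae] ae] by simp
  qed
  from * show "s \<le> 2 * r \<Longrightarrow> L2_norm (u_deriv r k \<mu> t s) = L2_norm (G s)" .
  show "L2_norm (u_sol r k \<mu> t) = L2_norm (G 0)" using *[of 0] by (simp add: u_deriv_def)
qed

end

text \<open>The derivative of order \<open>s\<close> of the solution of \<open>y\<^sup>(\<^sup>N\<^sup>) = a y\<close> with initial values
  \<open>y\<^sup>(\<^sup>j\<^sup>)(0) = \<delta>\<^sub>i\<^sub>j\<close> for \<open>j < N\<close>.\<close>

definition power_sol :: "real \<Rightarrow> nat \<Rightarrow> nat \<Rightarrow> nat \<Rightarrow> real \<Rightarrow> real" where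
  "power_sol a N i s x = (\<Sum>m. (if (m + s) mod N = i then a ^ ((m + s) div N) else 0) / fact m * x ^ m)"

lemma power_sol_summable:
  "summable (\<lambda>m. (if (m + s) mod N = i then a ^ ((m + s) div N) else 0) / fact m * (x::real) ^ m)"
proof (rule summable_comparison_test')
  \<comment> \<open>\<open>A\<close> is at least 1 so that the exponent \<open>(m + s) div N\<close>
    may be raised to \<open>m + s\<close>; the majorant is then an exponential series.\<close>
  define A where "A = max 1 \<bar>a\<bar>"
  have A: "A \<ge> 1" "\<bar>a\<bar> \<le> A" by (auto simp: A_def)
  show "summable (\<lambda>m. A ^ s * (inverse (fact m) * (A * \<bar>x\<bar>) ^ m))"
    by (intro summable_mult summable_exp)
  fix m :: nat
  have "\<bar>if (m + s) mod N = i then a ^ ((m + s) div N) else 0\<bar> \<le> A ^ (m + s)"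
  proof -
    have "\<bar>a\<bar> ^ ((m + s) div N) \<le> A ^ ((m + s) div N)" using A by (intro power_mono) auto
    also have "\<dots> \<le> A ^ (m + s)" using A by (intro power_increasing div_le_dividend) auto
    finally show ?thesis using A by (auto simp: power_abs)
  qed
  then have "\<bar>if (m + s) mod N = i then a ^ ((m + s) div N) else 0\<bar> / fact m * \<bar>x\<bar> ^ m \<le> A ^ (m + s) / fact m * \<bar>x\<bar> ^ m"
    by (intro mult_right_mono divide_right_mono) auto
  then show "norm ((if (m + s) mod N = i then a ^ ((m + s) div N) else 0) / fact m * x ^ m)
     \<le> A ^ s * (inverse (fact m) * (A * \<bar>x\<bar>) ^ m)"
    by (simp add: abs_mult power_abs power_add power_mult_distrib field_simps split: if_splits)
qed

text \<open>Termwise differentiation shifts the summation index, and apart from the factorial the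
  coefficients depend on \<open>m + s\<close> alone, so the shift is absorbed into
  \<open>s\<close>.\<close>

lemma power_sol_deriv: "(power_sol a N i s has_vector_derivative power_sol a N i (Suc s) x) (at x within S)"
proof -
  define c where "c m = (if (m + s) mod N = i then a ^ ((m + s) div N) else 0) / fact m" for m
  have "((\<lambda>x. \<Sum>n. c n * x^n) has_field_derivative (\<Sum>n. diffs c n * x^n)) (at x)"
    by (rule termdiffs_strong_converges_everywhere) (simp only: c_def power_sol_summable)
  moreover have "(\<lambda>x. \<Sum>n. c n * x^n) = power_sol a N i s" by (simp add: fun_eq_iff power_sol_def c_def)
  moreover have "diffs c m = (if (m + Suc s) mod N = i then a ^ ((m + Suc s) div N) else 0) / fact m" for m
    unfolding diffs_def c_def by (simp add: field_simps del: of_nat_Suc)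
  then have "(\<Sum>n. diffs c n * x^n) = power_sol a N i (Suc s) x" by (simp add: power_sol_def)
  ultimately have "(power_sol a N i s has_field_derivative power_sol a N i (Suc s) x) (at x)" by simp
  then show ?thesis
    using has_real_derivative_iff_has_vector_derivative has_vector_derivative_at_within by blast
qed

text \<open>Adding \<open>N\<close> to \<open>s\<close> keeps the residue and raises the quotient by
  1, which costs one factor \<open>a\<close>. For \<open>s = 0\<close> this is the differential
  equation.\<close>

lemma power_sol_period: "N > 0 \<Longrightarrow> power_sol a N i (s + N) x = a * power_sol a N i s x"
proof -
  assume N: "N > 0"
  have "power_sol a N i (s + N) x = (\<Sum>m. a * ((if (m + s) mod N = i then a ^ ((m + s) div N) else 0) / fact m * x ^ m))"
    unfolding power_sol_def
  proof (rule suminf_cong)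
    fix m
    have "(m + (s + N)) mod N = (m + s) mod N" "(m + (s + N)) div N = Suc ((m + s) div N)"
      using N by (simp_all flip: add.assoc)
    then show "(if (m + (s + N)) mod N = i then a ^ ((m + (s + N)) div N) else 0) / fact m * x ^ m =
         a * ((if (m + s) mod N = i then a ^ ((m + s) div N) else 0) / fact m * x ^ m)" by simp
  qed
  then show ?thesis unfolding power_sol_def using suminf_mult[OF power_sol_summable] by simp
qed

lemma power_sol_at_0: "s < N \<Longrightarrow> power_sol a N i s 0 = (if s = i then 1 else 0)"
  unfolding power_sol_def by (subst powser_zero) simp

text \<open>Shooting from -1: the form of \<open>L\<close> builds in the boundary conditions at -1
  and that of \<open>R\<close> the jump at t, which leaves r conditions at 1 for r coefficients.
  This square system is injective because a solution with \<gamma> = 0 vanishes.\<close>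

lemma green_exists:
  assumes k: "k < r" and t: "-1 < t" "t < 1" and "\<mu> > 0"
  obtains L R where "green r k \<mu> t 1 L R"
proof -
  define a where "a = (-1)^(r + 1) * \<mu>"
  define e where "e = power_sol a (2 * r)"
  have e_top: "e i (2 * r) x = a * e i 0 x" for i x
    using power_sol_period[of "2 * r" a i 0 x] k by (simp add: e_def)
  \<comment> \<open>The solutions \<open>e (r + j)\<close> based at -1 have zero initial values of
    all orders below r; \<alpha> lists the initial values of orders r to 2r - 1.\<close>
  define L where "L \<alpha> s x = (\<Sum>j<r. e (r + j) s (x + 1) * \<alpha> j)" for \<alpha> :: "nat \<Rightarrow> real" and s x
  \<comment> \<open>Among the orders below 2r, \<open>e (r - k - 1)\<close> based at t has its only
    nonzero initial value at order r - k - 1, so adding it creates exactly the prescribed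
    jump.\<close>
  define R where "R \<alpha> \<gamma> s x = L \<alpha> s x + (-1)^(k + 1) * \<gamma> * e (r - k - 1) s (x - t)" for \<alpha> \<gamma> s x
  have shift: "((\<lambda>x. e i s (x + c)) has_vector_derivative e i (Suc s) (x + c)) (at x within S)" for i s x c S
  proof -
    have "((\<lambda>x. x + c) has_vector_derivative 1) (at x within S)" by (auto intro!: derivative_eq_intros)
    from vector_diff_chain_within[OF this, of "e i s" "e i (Suc s) (x + c)"]
    show ?thesis using power_sol_deriv[of a "2 * r" i s "x + c"] by (simp add: e_def o_def)
  qed
  have dL: "(L \<alpha> s has_vector_derivative L \<alpha> (Suc s) x) (at x within S)" for \<alpha> s x S
    unfolding L_def by (intro has_vector_derivative_sum has_vector_derivative_mult_left shift)
  have dR: "(R \<alpha> \<gamma> s has_vector_derivative R \<alpha> \<gamma> (Suc s) x) (at x within S)" for \<alpha> \<gamma> s x S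
    unfolding R_def using shift[of "r - k - 1" s "-t" x S]
    by (intro has_vector_derivative_add dL has_vector_derivative_mult_right) simp
  have L0: "L \<alpha> s (-1) = (if r \<le> s then \<alpha> (s - r) else 0)" if "s < 2 * r" for \<alpha> s
  proof -
    have "L \<alpha> s (-1) = (\<Sum>j<r. if j = s - r \<and> r \<le> s then \<alpha> j else 0)"
      unfolding L_def using that by (intro sum.cong) (auto simp: e_def power_sol_at_0)
    also have "\<dots> = (if r \<le> s then \<alpha> (s - r) else 0)" using that by (auto simp: sum.delta)
    finally show ?thesis .
  qed
  have gr: "green r k \<mu> t \<gamma> (L \<alpha>) (R \<alpha> \<gamma>)"
    \<comment> \<open>The conditions at 1, where the argument \<open>x + 1\<close> in
      \<open>L\<close> equals 2.\<close>
    if sys: "\<And>s. s < r \<Longrightarrow> (\<Sum>j<r. e (r + j) s 2 * \<alpha> j) = - ((-1)^(k + 1) * \<gamma> * e (r - k - 1) s (1 - t))" for \<alpha> \<gamma>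
  proof
    have "piecewise_chain (2 * r) t (L \<alpha>) (R \<alpha> \<gamma>)"
      unfolding piecewise_chain_def by (intro conjI allI impI ballI dL dR chain_continuous_on[OF dL] chain_continuous_on[OF dR])
    moreover have Lt: "L \<alpha> (2 * r) x = a * L \<alpha> 0 x" for x
      unfolding L_def e_top sum_distrib_left by (simp add: mult.assoc)
    moreover have "R \<alpha> \<gamma> (2 * r) x = a * R \<alpha> \<gamma> 0 x" for x
      unfolding R_def e_top Lt by (simp add: algebra_simps)
    moreover have "L \<alpha> s (-1) = 0" "R \<alpha> \<gamma> s 1 = 0" if "s < r" for s
      using L0[of s \<alpha>] that sys[OF that] by (auto simp: R_def L_def)
    moreover have "R \<alpha> \<gamma> s t - L \<alpha> s t = (if s = r - k - 1 then (-1)^(k + 1) * \<gamma> else 0)" if "s < 2 * r" for s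
      using that by (simp add: R_def e_def power_sol_at_0)
    ultimately show "green_chain r k \<mu> t \<gamma> (L \<alpha>) (R \<alpha> \<gamma>)"
      unfolding green_chain_def a_def by simp
  qed (use k t in auto)
  obtain \<alpha> where "\<And>s. s < r \<Longrightarrow> (\<Sum>j<r. e (r + j) s 2 * \<alpha> j) = - ((-1)^(k + 1) * 1 * e (r - k - 1) s (1 - t))"
  proof (rule square_system_solvable[where n = r and M = "\<lambda>s j. e (r + j) s 2"])
    fix \<alpha> j assume 0: "\<And>s. s < r \<Longrightarrow> (\<Sum>j<r. e (r + j) s 2 * \<alpha> j) = 0" and j: "j < r"
    interpret g: green r k \<mu> t 0 "L \<alpha>" "R \<alpha> 0" by (rule gr) (use 0 in simp)
    \<comment> \<open>\<open>L r\<close> vanishes on an interval, hence so do all its derivatives,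
      and their values at -1 are the coefficients.\<close>
    have "x \<in> {-1..t} \<Longrightarrow> L \<alpha> (r + i) x = 0" for i x
    proof (induction i arbitrary: x)
      case 0
      then show ?case using g.homogeneous_eq_0(3)[OF refl \<open>\<mu> > 0\<close>] by simp
    next
      case (Suc i)
      have "((\<lambda>x. 0) has_vector_derivative L \<alpha> (Suc (r + i)) x) (at x within {-1..t})"
        by (rule has_vector_derivative_transform[OF Suc.prems _ dL]) (use Suc.IH in simp)
      then show ?case
        using vector_derivative_unique_within[OF at_within_Icc_neq_bot[OF t(1) Suc.prems] has_vector_derivative_const] by force
    qed
    then have "L \<alpha> (r + j) (-1) = 0" using t by simp
    then show "\<alpha> j = 0" using L0[of "r + j" \<alpha>] j by simp
  next
    fix \<alpha>
    assume "\<And>s. s < r \<Longrightarrow> (\<Sum>j<r. e (r + j) s 2 * \<alpha> j) = - ((-1)^(k + 1) * 1 * e (r - k - 1) s (1 - t))"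
    then show thesis by (rule that)
  qed
  then have "green r k \<mu> t 1 (L \<alpha>) (R \<alpha> 1)" by (rule gr)
  then show thesis by (rule that)
qed

section \<open>Test functions and scaling\<close>

lemma L2_deriv_poly:
  assumes "r \<ge> 1"
  shows "(\<lambda>x. poly p (x - t)) \<in> L2_deriv {-1..1} r"
    "\<And>s x. s \<le> r \<Longrightarrow> x \<in> {-1..1} \<Longrightarrow> deriv_on {-1..1} s (\<lambda>x. poly p (x - t)) x = poly ((pderiv ^^ s) p) (x - t)"
proof -
  have d: "((\<lambda>x. poly ((pderiv ^^ s) p) (x - t)) has_vector_derivative poly ((pderiv ^^ Suc s) p) (x - t)) (at x within S)" for s x S
  proof -
    have "((\<lambda>x. poly ((pderiv ^^ s) p) (x - t)) has_field_derivative poly (pderiv ((pderiv ^^ s) p)) (x - t) * 1) (at x)"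
      by (rule DERIV_chain2[OF poly_DERIV]) (auto intro!: derivative_eq_intros)
    then show ?thesis
      by (simp add: has_real_derivative_iff_has_vector_derivative has_vector_derivative_at_within)
  qed
  show "(\<lambda>x. poly p (x - t)) \<in> L2_deriv {-1..1} r"
    "\<And>s x. s \<le> r \<Longrightarrow> x \<in> {-1..1} \<Longrightarrow> deriv_on {-1..1} s (\<lambda>x. poly p (x - t)) x = poly ((pderiv ^^ s) p) (x - t)"
    by (rule L2_deriv_chain[where a = "-1" and b = 1 and P = "\<lambda>s x. poly ((pderiv ^^ s) p) (x - t)"];
        use assms d at_within_Icc_neq_bot[of "-1" "1::real"] chain_continuous_on[OF d] in \<open>simp del: funpow.simps\<close>)+
qed

text \<open>To be evaluated at x - t. The factor y^k/k! normalizes the k-th derivative at 0, and 1 -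
  y^2/4 lies in [0,1] for |y| <= 2 and equals 1 at y = 0 only, so its powers concentrate there. The
  4 is the square of the length of [-1,1].\<close>

definition test_poly :: "nat \<Rightarrow> nat \<Rightarrow> real poly" where
  "test_poly k N = Polynomial.smult (1 / fact k) (monom 1 k * [:1, 0, -1/4:] ^ N)"

text \<open>The power has constant coefficient 1, so the coefficient of y^k is 1/k!.\<close>

lemma test_poly_deriv_0: "poly ((pderiv ^^ k) (test_poly k N)) 0 = 1"
proof -
  have "coeff ([:1, 0, -1/4:] ^ N :: real poly) 0 = 1"
    by (simp flip: poly_0_coeff_0 add: poly_power)
  then show ?thesis
    by (simp add: poly_0_coeff_0 coeff_higher_pderiv test_poly_def coeff_monom_mult pochhammer_fact[symmetric])
qed

lemma test_poly_0_higher_deriv: "k < r \<Longrightarrow> (pderiv ^^ r) (test_poly k 0) = 0"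
  by (rule poly_eqI) (simp add: coeff_higher_pderiv test_poly_def)

lemma poly_test_poly: "poly (test_poly k N) y = y ^ k / fact k * (1 - y\<^sup>2 / 4) ^ N"
  by (simp add: test_poly_def poly_monom poly_power power2_eq_square)

text \<open>Dominated convergence: 1 - (x - t)^2/4 lies in [0,1) off t, and the case
  \<open>N = 0\<close> is a majorant.\<close>

lemma test_poly_norm_tendsto_0:
  assumes t: "-1 < t" "t < 1"
  shows "(\<lambda>N. L2_norm (\<lambda>x. poly (test_poly k N) (x - t))) \<longlonglongrightarrow> 0"
proof -
  have L2: "(\<lambda>x. poly (test_poly k N) (x - t)) \<in> L2 {-1..1}" for N
    by (intro L2_continuous continuous_intros)
  have rng: "0 \<le> 1 - (x - t)\<^sup>2 / 4 \<and> 1 - (x - t)\<^sup>2 / 4 \<le> 1" if "x \<in> {-1..1}" for x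
  proof -
    have "\<bar>x - t\<bar> \<le> 2" using that t by auto
    then have "(x - t)\<^sup>2 \<le> 2\<^sup>2" by (metis abs_le_square_iff abs_numeral)
    then show ?thesis by simp
  qed
  have "(\<lambda>N. integral\<^sup>L (lebesgue_on {-1..1}) (\<lambda>x. \<bar>poly (test_poly k N) (x - t)\<bar>\<^sup>2))
      \<longlonglongrightarrow> integral\<^sup>L (lebesgue_on {-1..1::real}) (\<lambda>x. 0)"
  proof (rule Bochner_Integration.integral_dominated_convergence[where f = "\<lambda>x. 0" and s = "\<lambda>N x. \<bar>poly (test_poly k N) (x - t)\<bar>\<^sup>2" and w = "\<lambda>x. \<bar>poly (test_poly k 0) (x - t)\<bar>\<^sup>2"])
    show "integrable (lebesgue_on {-1..1}) (\<lambda>x. \<bar>poly (test_poly k 0) (x - t)\<bar>\<^sup>2)"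
      using L2[of 0] by (simp add: L2_def)
    show "(\<lambda>x. \<bar>poly (test_poly k N) (x - t)\<bar>\<^sup>2) \<in> borel_measurable (lebesgue_on {-1..1})" for N
      using L2[of N] unfolding L2_def by (auto intro: borel_measurable_integrable)
    have "AE x in lebesgue. x \<noteq> t"
      by (metis (mono_tags, lifting) AE_lborel_singleton AE_completion eventually_mono)
    then have "AE x in lebesgue. x \<in> {-1..1} \<longrightarrow> (\<lambda>N. \<bar>poly (test_poly k N) (x - t)\<bar>\<^sup>2) \<longlonglongrightarrow> 0"
    proof (rule eventually_mono, intro impI)
      fix x assume "x \<noteq> t" "x \<in> {-1..1}"
      then have "0 \<le> 1 - (x - t)\<^sup>2 / 4" "1 - (x - t)\<^sup>2 / 4 < 1" using rng[of x] by auto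
      then have "(\<lambda>N. \<bar>(x - t) ^ k / fact k * (1 - (x - t)\<^sup>2 / 4) ^ N\<bar>\<^sup>2) \<longlonglongrightarrow> \<bar>(x - t) ^ k / fact k * 0\<bar>\<^sup>2"
        by (intro tendsto_intros LIMSEQ_realpow_zero) auto
      then show "(\<lambda>N. \<bar>poly (test_poly k N) (x - t)\<bar>\<^sup>2) \<longlonglongrightarrow> 0"
        by (simp add: poly_test_poly)
    qed
    then show "AE x in lebesgue_on {-1..1}. (\<lambda>N. \<bar>poly (test_poly k N) (x - t)\<bar>\<^sup>2) \<longlonglongrightarrow> 0"
      by (simp add: AE_restrict_space_iff)
    show "AE x in lebesgue_on {-1..1}. norm (\<bar>poly (test_poly k N) (x - t)\<bar>\<^sup>2) \<le> \<bar>poly (test_poly k 0) (x - t)\<bar>\<^sup>2" for N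
    proof (rule AE_I2)
      fix x assume "x \<in> space (lebesgue_on {-1..1::real})"
      then have "0 \<le> 1 - (x - t)\<^sup>2 / 4" "1 - (x - t)\<^sup>2 / 4 \<le> 1" using rng[of x] by (auto simp: space_restrict_space)
      then have "\<bar>(1 - (x - t)\<^sup>2 / 4) ^ N\<bar> \<le> 1" by (simp add: power_abs power_le_one)
      then have "\<bar>(x - t) ^ k / fact k\<bar> * \<bar>(1 - (x - t)\<^sup>2 / 4) ^ N\<bar> \<le> \<bar>(x - t) ^ k / fact k\<bar> * 1"
        by (intro mult_left_mono) auto
      then have "\<bar>poly (test_poly k N) (x - t)\<bar> \<le> \<bar>poly (test_poly k 0) (x - t)\<bar>"
        by (simp only: poly_test_poly abs_mult power_0 mult_1_right abs_one)
      then show "norm (\<bar>poly (test_poly k N) (x - t)\<bar>\<^sup>2) \<le> \<bar>poly (test_poly k 0) (x - t)\<bar>\<^sup>2"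
        using power_mono[of "\<bar>poly (test_poly k N) (x - t)\<bar>" "\<bar>poly (test_poly k 0) (x - t)\<bar>" 2] by simp
    qed
  qed auto
  then have "(\<lambda>N. sqrt (integral\<^sup>L (lebesgue_on {-1..1}) (\<lambda>x. \<bar>poly (test_poly k N) (x - t)\<bar>\<^sup>2))) \<longlonglongrightarrow> sqrt 0"
    by (intro tendsto_real_sqrt) simp
  then show ?thesis by (simp add: L2_norm_def)
qed

text \<open>Shows that the functional is bounded by no multiple of the L2 norm, so that
  \<open>U\<close> has to contribute in \<open>D_bound\<close>.\<close>

lemma exists_small_test_function:
  assumes "k < r" "-1 < t" "t < 1" "\<epsilon> > 0"
  obtains f where "f \<in> L2_deriv {-1..1} r" "deriv_on {-1..1} k f t = 1" "L2_norm f < \<epsilon>"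
proof -
  have "eventually (\<lambda>N. L2_norm (\<lambda>x. poly (test_poly k N) (x - t)) < \<epsilon>) sequentially"
    using order_tendstoD(2)[OF test_poly_norm_tendsto_0] assms by blast
  then obtain N where N: "L2_norm (\<lambda>x. poly (test_poly k N) (x - t)) < \<epsilon>"
    unfolding eventually_sequentially by blast
  show thesis
  proof (rule that[OF _ _ N])
    show "(\<lambda>x. poly (test_poly k N) (x - t)) \<in> L2_deriv {-1..1} r"
      using assms by (intro L2_deriv_poly(1)) auto
    show "deriv_on {-1..1} k (\<lambda>x. poly (test_poly k N) (x - t)) t = 1"
      using L2_deriv_poly(2)[of r k t] assms test_poly_deriv_0[of k N] by simp
  qed
qed

text \<open>With the r-th derivative gone, the reproducing identity reduces to its first term, so
  such a function tests w alone.\<close>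

lemma exists_flat_test_function:
  assumes "k < r" "-1 < t" "t < 1"
  obtains f where "f \<in> L2_deriv {-1..1} r" "deriv_on {-1..1} k f t = 1"
    "\<And>x. x \<in> {-1..1} \<Longrightarrow> deriv_on {-1..1} r f x = 0"
proof
  show "(\<lambda>x. poly (test_poly k 0) (x - t)) \<in> L2_deriv {-1..1} r"
    using assms by (intro L2_deriv_poly(1)) auto
  show "deriv_on {-1..1} k (\<lambda>x. poly (test_poly k 0) (x - t)) t = 1"
    using L2_deriv_poly(2)[of r k t] assms test_poly_deriv_0[of k 0] by simp
  show "deriv_on {-1..1} r (\<lambda>x. poly (test_poly k 0) (x - t)) x = 0" if "x \<in> {-1..1}" for x
    using L2_deriv_poly(2)[of r r x "test_poly k 0" t] assms test_poly_0_higher_deriv[of k r] that by simp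
qed

text \<open>For order r the claim holds almost everywhere: where the derivative of order r - 1 is
  not differentiable, the value of \<open>vector_derivative\<close> is unspecified and need not
  scale.\<close>

lemma L2_deriv_scale:
  assumes f: "f \<in> L2_deriv {-1..1} r" and "r \<ge> 1"
  shows "(\<lambda>x. c * f x) \<in> L2_deriv {-1..1} r"
    "s < r \<Longrightarrow> x \<in> {-1..1} \<Longrightarrow> deriv_on {-1..1} s (\<lambda>x. c * f x) x = c * deriv_on {-1..1} s f x"
    "AE x in lebesgue_on {-1..1}. c * deriv_on {-1..1} r f x = deriv_on {-1..1} r (\<lambda>x. c * f x) x"
proof -
  let ?S = "{-1..1::real}"
  have lim: "at x within ?S \<noteq> bot" if "x \<in> ?S" for x using at_within_Icc_neq_bot[of "-1" 1 x] that by simp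
  let ?P = "\<lambda>s x. c * deriv_on ?S s f x"
  have ch: "(?P s has_vector_derivative ?P (Suc s) x) (at x within ?S)" if "s < r - 1" "x \<in> ?S" for s x
    by (rule has_vector_derivative_mult_right[OF L2_deriv_has_vector_derivative[OF f that]])
  have 1: "deriv_on ?S s (\<lambda>x. c * f x) x = ?P s x" if "s \<le> r - 1" "x \<in> ?S" for s x
    by (rule deriv_on_eq_chain[where n = "r - 1" and P = ?P, OF lim ch]) (use that in auto)
  show "s < r \<Longrightarrow> x \<in> ?S \<Longrightarrow> deriv_on ?S s (\<lambda>x. c * f x) x = c * deriv_on ?S s f x" using 1 by simp
  have hvd: "(deriv_on ?S s (\<lambda>x. c * f x) has_vector_derivative D) (at x within ?S)"
    if "s \<le> r - 1" "x \<in> ?S" "(?P s has_vector_derivative D) (at x within ?S)" for s x D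
    by (rule deriv_on_chain_has_vector_derivative[where n = "r - 1" and P = ?P, OF lim ch]) (use that in auto)
  obtain N where N: "negligible N" "\<And>x. x \<in> ?S - N \<Longrightarrow> 
     (deriv_on ?S (r - 1) f has_vector_derivative deriv_on ?S r f x) (at x within ?S)"
    by (rule L2_deriv_top[OF f \<open>r \<ge> 1\<close>]) auto
  have top: "(deriv_on ?S (r - 1) (\<lambda>x. c * f x) has_vector_derivative ?P r x) (at x within ?S)" if "x \<in> ?S - N" for x
    by (rule hvd[OF _ _ has_vector_derivative_mult_right[OF N(2)[OF that]]]) (use that in auto)
  have "AE x in lebesgue. x \<notin> N" by (rule AE_not_in) (use N(1) negligible_iff_null_sets in blast)
  then have "AE x in lebesgue. x \<in> ?S \<longrightarrow> x \<in> ?S - N" by (rule eventually_mono) auto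
  then have ae: "AE x in lebesgue_on ?S. x \<in> ?S - N" by (simp add: AE_restrict_space_iff)
  show eq: "AE x in lebesgue_on ?S. ?P r x = deriv_on ?S r (\<lambda>x. c * f x) x"
  proof (rule eventually_mono[OF ae])
    fix x assume x: "x \<in> ?S - N"
    have "deriv_on ?S (Suc (r - 1)) (\<lambda>x. c * f x) x = ?P r x"
      using vector_derivative_within[OF lim top[OF x]] x by simp
    then show "?P r x = deriv_on ?S r (\<lambda>x. c * f x) x" using \<open>r \<ge> 1\<close> by simp
  qed
  show "(\<lambda>x. c * f x) \<in> L2_deriv ?S r"
    unfolding L2_deriv_def
  proof (intro CollectI conjI allI impI ballI)
    fix j x assume j: "j < r - 1" "x \<in> ?S"
    show "deriv_on ?S j (\<lambda>x. c * f x) differentiable (at x within ?S)"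
      using hvd[OF _ j(2) ch[OF j]] j differentiableI_vector by auto
  next
    have ac: "absolutely_continuous_on ?S (deriv_on ?S (r - 1) f)" using f by (simp add: L2_deriv_def)
    have "absolutely_continuous_on ?S (?P (r - 1))"
      by (rule absolutely_continuous_on_dominated[OF ac, where A = "\<bar>c\<bar>" and B = 0])
         (auto simp: abs_mult simp flip: right_diff_distrib)
    then show "absolutely_continuous_on ?S (deriv_on ?S (r - 1) (\<lambda>x. c * f x))"
      using absolutely_continuous_on_cong[of ?S "deriv_on ?S (r - 1) (\<lambda>x. c * f x)" "?P (r - 1)"] 1 by simp
  next
    show "AE x in lebesgue_on ?S. deriv_on ?S (r - 1) (\<lambda>x. c * f x) differentiable (at x within ?S)"
      by (rule eventually_mono[OF ae]) (use top differentiableI_vector in blast)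
    show "deriv_on ?S r (\<lambda>x. c * f x) \<in> L2 ?S"
      by (rule L2_AE_eq[OF L2_scale _ eq]) (use f in \<open>auto simp: L2_deriv_def\<close>)
  qed
qed

lemma L2_deriv_L2:
  assumes "f \<in> L2_deriv {-1..1} r"
  shows "f \<in> L2 {-1..1}" "deriv_on {-1..1} r f \<in> L2 {-1..1}"
  using L2_continuous[OF L2_deriv_continuous[OF assms, of 0]] assms by (auto simp: L2_deriv_def)

section \<open>Optimal recovery\<close>

text \<open>Keeps of the differential equation only what the extremal argument consumes:
  \<open>U \<mu>\<close> stands for u and \<open>W \<mu>\<close> for its r-th derivative, linked by
  \<open>W_deriv\<close> and the reproducing identity.\<close>

locale recovery =
  fixes r k :: nat and t :: real and U W :: "real \<Rightarrow> real \<Rightarrow> real"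
  assumes k: "k < r" and t: "-1 < t" "t < 1"
    and U_L2: "\<mu> > 0 \<Longrightarrow> U \<mu> \<in> L2 {-1..1}"
    and W_L2_deriv: "\<mu> > 0 \<Longrightarrow> W \<mu> \<in> L2_deriv {-1..1} r"
    and W_deriv: "\<mu> > 0 \<Longrightarrow> AE x in lebesgue_on {-1..1}. deriv_on {-1..1} r (W \<mu>) x = (-1)^(r + 1) * \<mu> * U \<mu> x"
    and representation: "\<mu> > 0 \<Longrightarrow> f \<in> L2_deriv {-1..1} r \<Longrightarrow>
       deriv_on {-1..1} k f t = L2_inner f (W \<mu>) + (-1)^(r + 1) * L2_inner (deriv_on {-1..1} r f) (U \<mu>)"
begin

abbreviation D :: "(real \<Rightarrow> real) \<Rightarrow> real" where "D f \<equiv> deriv_on {-1..1} k f t"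

lemma W_L2: "\<mu> > 0 \<Longrightarrow> W \<mu> \<in> L2 {-1..1}"
  using L2_deriv_L2(1)[OF W_L2_deriv] .

lemma sign_square: "(-1)^(r + 1) * (-1)^(r + 1) = (1::real)"
  by (simp flip: power_mult_distrib)

text \<open>The representation for \<mu> applied to \<open>W \<nu>\<close>, the two signs
  multiplying to 1. Exchanging the parameters changes only the factor of the second inner
  product.\<close>

lemma D_W:
  assumes "\<nu> > 0" "\<mu> > 0"
  shows "D (W \<nu>) = L2_inner (W \<nu>) (W \<mu>) + \<nu> * L2_inner (U \<nu>) (U \<mu>)"
proof -
  have "L2_inner (deriv_on {-1..1} r (W \<nu>)) (U \<mu>) = L2_inner (\<lambda>x. (-1)^(r + 1) * \<nu> * U \<nu> x) (U \<mu>)"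
    by (rule L2_inner_cong_AE[OF _ _ _ _ W_deriv])
       (use assms L2_deriv_L2(2)[OF W_L2_deriv] L2_scale[OF U_L2] U_L2 in \<open>auto simp del: power_Suc\<close>)
  also have "\<dots> = (-1)^(r + 1) * \<nu> * L2_inner (U \<nu>) (U \<mu>)" by (rule L2_inner_scale)
  finally have "D (W \<nu>) = L2_inner (W \<nu>) (W \<mu>) + ((-1)^(r + 1) * (-1)^(r + 1)) * \<nu> * L2_inner (U \<nu>) (U \<mu>)"
    using representation[OF assms(2) W_L2_deriv[OF assms(1)]] by simp
  then show ?thesis by (simp only: sign_square mult_1)
qed

lemma D_W_self: "\<mu> > 0 \<Longrightarrow> D (W \<mu>) = (L2_norm (W \<mu>))\<^sup>2 + \<mu> * (L2_norm (U \<mu>))\<^sup>2"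
  using D_W[of \<mu> \<mu>] by (simp add: L2_norm_power2)

text \<open>Subtracting the linear method turns \<open>f\<close> into \<open>f - g\<close> in the
  first term of the identity, so the data error meets \<open>W\<close> and the smoothness bound
  meets \<open>U\<close>.\<close>

lemma recovery_bound:
  assumes "\<mu> > 0" and f: "f \<in> L2_deriv {-1..1} r" and g: "g \<in> L2 {-1..1}"
  shows "\<bar>D f - L2_inner g (W \<mu>)\<bar> \<le> L2_norm (\<lambda>x. f x - g x) * L2_norm (W \<mu>) + L2_norm (deriv_on {-1..1} r f) * L2_norm (U \<mu>)"
proof -
  have "D f - L2_inner g (W \<mu>) = L2_inner (\<lambda>x. f x - g x) (W \<mu>) + (-1)^(r + 1) * L2_inner (deriv_on {-1..1} r f) (U \<mu>)"
    using representation[OF assms(1) f] L2_inner_diff[OF L2_deriv_L2(1)[OF f] g W_L2[OF assms(1)]] by simp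
  then have "\<bar>D f - L2_inner g (W \<mu>)\<bar> \<le> \<bar>L2_inner (\<lambda>x. f x - g x) (W \<mu>)\<bar> + \<bar>(-1)^(r + 1) * L2_inner (deriv_on {-1..1} r f) (U \<mu>)\<bar>"
    by (simp only: abs_triangle_ineq)
  also have "\<bar>(-1)^(r + 1) * L2_inner (deriv_on {-1..1} r f) (U \<mu>)\<bar> = \<bar>L2_inner (deriv_on {-1..1} r f) (U \<mu>)\<bar>"
    by (simp add: abs_mult power_abs)
  also have "\<bar>L2_inner (\<lambda>x. f x - g x) (W \<mu>)\<bar> + \<bar>L2_inner (deriv_on {-1..1} r f) (U \<mu>)\<bar>
      \<le> L2_norm (\<lambda>x. f x - g x) * L2_norm (W \<mu>) + L2_norm (deriv_on {-1..1} r f) * L2_norm (U \<mu>)"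
    by (rule add_mono[OF L2_Cauchy_Schwarz[OF L2_diff[OF L2_deriv_L2(1)[OF f] g] W_L2[OF assms(1)]]
        L2_Cauchy_Schwarz[OF L2_deriv_L2(2)[OF f] U_L2[OF assms(1)]]])
  finally show ?thesis .
qed

lemma D_bound:
  assumes "\<mu> > 0" and f: "f \<in> L2_deriv {-1..1} r"
  shows "\<bar>D f\<bar> \<le> L2_norm f * L2_norm (W \<mu>) + L2_norm (deriv_on {-1..1} r f) * L2_norm (U \<mu>)"
  using recovery_bound[OF assms L2_zero] by (simp add: L2_inner_def)

text \<open>For a flat test function \<open>D_bound\<close> leaves 1 <= ||f|| ||W \<mu>||, and
  \<open>f\<close> does not depend on \<mu>.\<close>

lemma norm_W_lower_bound:
  obtains m where "m > 0" "\<And>\<mu>. \<mu> > 0 \<Longrightarrow> m \<le> L2_norm (W \<mu>)"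
proof -
  obtain f where f: "f \<in> L2_deriv {-1..1} r" "D f = 1" "\<And>x. x \<in> {-1..1} \<Longrightarrow> deriv_on {-1..1} r f x = 0"
    using exists_flat_test_function[OF k t] by metis
  have "AE x in lebesgue_on {-1..1}. deriv_on {-1..1} r f x = 0"
    using f(3) by (intro AE_I2) (simp add: space_restrict_space)
  then have "L2_norm (deriv_on {-1..1} r f) = L2_norm (\<lambda>x. 0)"
    by (intro L2_norm_cong_AE L2_deriv_L2[OF f(1)] L2_zero)
  then have "L2_norm (deriv_on {-1..1} r f) = 0" by (simp add: L2_norm_def)
  then have le: "1 \<le> L2_norm f * L2_norm (W \<mu>)" if "\<mu> > 0" for \<mu>
    using D_bound[OF that f(1)] f(2) by simp
  have "L2_norm f \<noteq> 0" using le[of 1] by fastforce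
  then have pos: "L2_norm f > 0" using L2_norm_nonneg less_eq_real_def by metis
  show thesis
  proof
    show "1 / L2_norm f > 0" using pos by simp
    show "1 / L2_norm f \<le> L2_norm (W \<mu>)" if "\<mu> > 0" for \<mu>
      using le[OF that] pos by (simp add: field_simps)
  qed
qed

lemma norm_W_pos: "\<mu> > 0 \<Longrightarrow> L2_norm (W \<mu>) > 0"
  using norm_W_lower_bound by (metis less_le_trans)

text \<open>If \<open>U \<mu>\<close> vanished, \<open>D_bound\<close> would bound the functional by
  a multiple of the L2 norm, against \<open>exists_small_test_function\<close>.\<close>

lemma norm_U_pos:
  assumes "\<mu> > 0"
  shows "L2_norm (U \<mu>) > 0"
proof (rule ccontr)
  assume "\<not> L2_norm (U \<mu>) > 0"
  then have 0: "L2_norm (U \<mu>) = 0" using L2_norm_nonneg[of "U \<mu>"] by linarith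
  obtain f where f: "f \<in> L2_deriv {-1..1} r" "D f = 1" "L2_norm f < 1 / L2_norm (W \<mu>)"
    using exists_small_test_function[OF k t, of "1 / L2_norm (W \<mu>)"] norm_W_pos[OF assms] by auto
  have "1 \<le> L2_norm f * L2_norm (W \<mu>)" using D_bound[OF assms f(1)] f(2) 0 by simp
  then show False using f(3) norm_W_pos[OF assms] by (simp add: field_simps)
qed

text \<open>\<open>D (W \<mu>)\<close> is the left side, and in the representation for \<nu> a sum
  of mixed inner products, each at most half the sum of the squares. With \<nu> = 1 it limits the
  growth of \<open>U \<mu>\<close> as \<mu> tends to 0.\<close>

lemma energy_le:
  assumes "\<mu> > 0" "\<nu> > 0"
  shows "(L2_norm (W \<mu>))\<^sup>2 + \<mu> * (L2_norm (U \<mu>))\<^sup>2 \<le> (L2_norm (W \<nu>))\<^sup>2 + \<mu> * (L2_norm (U \<nu>))\<^sup>2"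
proof -
  have *: "2 * L2_inner f g \<le> (L2_norm f)\<^sup>2 + (L2_norm g)\<^sup>2" if "f \<in> L2 {-1..1}" "g \<in> L2 {-1..1}" for f g
    using L2_norm_diff_power2[OF that] zero_le_power2[of "L2_norm (\<lambda>x. f x - g x)"] by linarith
  have "2 * ((L2_norm (W \<mu>))\<^sup>2 + \<mu> * (L2_norm (U \<mu>))\<^sup>2) = 2 * L2_inner (W \<mu>) (W \<nu>) + \<mu> * (2 * L2_inner (U \<mu>) (U \<nu>))"
    using D_W_self[OF assms(1)] D_W[OF assms] by (simp add: algebra_simps)
  also have "\<dots> \<le> ((L2_norm (W \<mu>))\<^sup>2 + (L2_norm (W \<nu>))\<^sup>2) + \<mu> * ((L2_norm (U \<mu>))\<^sup>2 + (L2_norm (U \<nu>))\<^sup>2)"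
    using assms by (intro add_mono mult_left_mono * W_L2 U_L2) auto
  finally show ?thesis by (simp add: algebra_simps)
qed

text \<open>The two orders of \<open>D_W\<close> are added and compared with the expanded squares.
  The factor \<mu> - \<nu>, left over from the asymmetry of \<open>D_W\<close>, makes this a
  stability estimate.\<close>

lemma difference_identity:
  assumes "\<nu> > 0" "\<mu> > 0"
  shows "(L2_norm (\<lambda>x. W \<nu> x - W \<mu> x))\<^sup>2 + \<nu> * (L2_norm (\<lambda>x. U \<nu> x - U \<mu> x))\<^sup>2
    = (\<mu> - \<nu>) * L2_inner (\<lambda>x. U \<nu> x - U \<mu> x) (U \<mu>)"
proof -
  have dif: "L2_inner (\<lambda>x. U \<nu> x - U \<mu> x) (U \<mu>) = L2_inner (U \<nu>) (U \<mu>) - (L2_norm (U \<mu>))\<^sup>2"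
    using L2_inner_diff[OF U_L2[OF assms(1)] U_L2[OF assms(2)] U_L2[OF assms(2)]] by (simp add: L2_norm_power2)
  have "(L2_norm (W \<nu>))\<^sup>2 + \<nu> * (L2_norm (U \<nu>))\<^sup>2 = L2_inner (W \<nu>) (W \<mu>) + \<nu> * L2_inner (U \<nu>) (U \<mu>)"
    using D_W[OF assms] D_W_self[OF assms(1)] by simp
  moreover have "(L2_norm (W \<mu>))\<^sup>2 + \<mu> * (L2_norm (U \<mu>))\<^sup>2 = L2_inner (W \<nu>) (W \<mu>) + \<mu> * L2_inner (U \<nu>) (U \<mu>)"
    using D_W[OF assms(2,1)] D_W_self[OF assms(2)] by (simp add: L2_inner_commute)
  ultimately show ?thesis
    unfolding dif L2_norm_diff_power2[OF W_L2[OF assms(1)] W_L2[OF assms(2)]] L2_norm_diff_power2[OF U_L2[OF assms(1)] U_L2[OF assms(2)]]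
    by (simp add: algebra_simps)
qed

text \<open>With d and e the norms of the differences, \<open>difference_identity\<close> and
  Cauchy-Schwarz give e^2 + \<nu> d^2 <= c d, hence d <= c/\<nu> and then e^2 <= c^2/\<nu>.\<close>

lemma norm_differences:
  assumes "\<nu> > 0" "\<mu> > 0"
  shows "\<bar>L2_norm (U \<nu>) - L2_norm (U \<mu>)\<bar> \<le> \<bar>\<mu> - \<nu>\<bar> * L2_norm (U \<mu>) / \<nu>"
    and "\<bar>L2_norm (W \<nu>) - L2_norm (W \<mu>)\<bar> \<le> \<bar>\<mu> - \<nu>\<bar> * L2_norm (U \<mu>) / sqrt \<nu>"
proof -
  define d where "d = L2_norm (\<lambda>x. U \<nu> x - U \<mu> x)"
  define e where "e = L2_norm (\<lambda>x. W \<nu> x - W \<mu> x)"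
  define c where "c = \<bar>\<mu> - \<nu>\<bar> * L2_norm (U \<mu>)"
  have nn: "d \<ge> 0" "e \<ge> 0" "c \<ge> 0" by (auto simp: d_def e_def c_def)
  have "e\<^sup>2 + \<nu> * d\<^sup>2 \<le> \<bar>(\<mu> - \<nu>) * L2_inner (\<lambda>x. U \<nu> x - U \<mu> x) (U \<mu>)\<bar>"
    using difference_identity[OF assms] by (simp add: d_def e_def)
  also have "\<dots> \<le> \<bar>\<mu> - \<nu>\<bar> * (d * L2_norm (U \<mu>))"
    unfolding abs_mult d_def using assms by (intro mult_left_mono L2_Cauchy_Schwarz L2_diff U_L2) auto
  finally have main: "e\<^sup>2 + \<nu> * d\<^sup>2 \<le> c * d" by (simp add: c_def mult_ac)
  have d_le: "d \<le> c / \<nu>"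
  proof (cases "d = 0")
    case True
    then show ?thesis using nn assms by simp
  next
    case False
    have "\<nu> * d\<^sup>2 \<le> c * d" using main zero_le_power2[of e] by linarith
    then have "d * (\<nu> * d) \<le> d * c" by (simp add: power2_eq_square mult_ac)
    then have "\<nu> * d \<le> c" using False nn by (simp add: mult_le_cancel_left)
    then show ?thesis using assms by (simp add: field_simps)
  qed
  have "e\<^sup>2 \<le> c * d" using main assms by (smt (verit) mult_nonneg_nonneg zero_le_power2)
  also have "\<dots> \<le> c * (c / \<nu>)" using d_le nn by (intro mult_left_mono) auto
  also have "\<dots> = (c / sqrt \<nu>)\<^sup>2" using assms by (simp add: power2_eq_square)
  finally have e_le: "e \<le> c / sqrt \<nu>" using nn assms by (intro power2_le_imp_le[of e]) auto
  show "\<bar>L2_norm (U \<nu>) - L2_norm (U \<mu>)\<bar> \<le> \<bar>\<mu> - \<nu>\<bar> * L2_norm (U \<mu>) / \<nu>"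
    using L2_norm_triangle[OF U_L2[OF assms(1)] U_L2[OF assms(2)]] d_le by (simp add: d_def c_def)
  show "\<bar>L2_norm (W \<nu>) - L2_norm (W \<mu>)\<bar> \<le> \<bar>\<mu> - \<nu>\<bar> * L2_norm (U \<mu>) / sqrt \<nu>"
    using L2_norm_triangle[OF W_L2[OF assms(1)] W_L2[OF assms(2)]] e_le by (simp add: e_def c_def)
qed

section \<open>Continuity in the parameter and its two limits\<close>

lemma continuous_on_norms: "continuous_on {0<..} (\<lambda>\<mu>. L2_norm (U \<mu>))" "continuous_on {0<..} (\<lambda>\<mu>. L2_norm (W \<mu>))"
proof -
  \<comment> \<open>Both estimates have the form |\<mu> - \<nu>| c(\<mu>) / h(\<nu>), with h the
    identity for \<open>U\<close> and the square root for \<open>W\<close>.\<close>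
  have *: "continuous_on {0<..} g" if le: "\<And>\<mu> \<nu>. \<mu> > 0 \<Longrightarrow> \<nu> > 0 \<Longrightarrow> \<bar>g \<nu> - g \<mu>\<bar> \<le> \<bar>\<mu> - \<nu>\<bar> * c \<mu> / h \<nu>"
    and h: "\<And>\<mu>. \<mu> > 0 \<Longrightarrow> h \<mu> > 0" "continuous_on {0<..} h" for g h c :: "real \<Rightarrow> real"
    unfolding continuous_on_def
  proof
    fix \<mu> :: real assume "\<mu> \<in> {0<..}"
    then have \<mu>: "\<mu> > 0" by simp
    have "((\<lambda>\<nu>. \<bar>\<mu> - \<nu>\<bar> * c \<mu> / h \<nu>) \<longlongrightarrow> \<bar>\<mu> - \<mu>\<bar> * c \<mu> / h \<mu>) (at \<mu> within {0<..})"
    proof (intro tendsto_divide tendsto_mult tendsto_rabs tendsto_diff tendsto_const tendsto_ident_at)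
      show "(h \<longlongrightarrow> h \<mu>) (at \<mu> within {0<..})" using h(2) \<mu> by (simp add: continuous_on_def)
      show "h \<mu> \<noteq> 0" using h(1)[OF \<mu>] by simp
    qed
    then have "((\<lambda>\<nu>. \<bar>\<mu> - \<nu>\<bar> * c \<mu> / h \<nu>) \<longlongrightarrow> 0) (at \<mu> within {0<..})" by simp
    then have "((\<lambda>\<nu>. g \<nu> - g \<mu>) \<longlongrightarrow> 0) (at \<mu> within {0<..})"
      by (rule Lim_null_comparison[rotated]) (use le \<mu> in \<open>auto simp: eventually_at_filter\<close>)
    then show "(g \<longlongrightarrow> g \<mu>) (at \<mu> within {0<..})" by (rule LIM_zero_cancel)
  qed
  show "continuous_on {0<..} (\<lambda>\<mu>. L2_norm (U \<mu>))"
    by (rule *[where c = "\<lambda>\<mu>. L2_norm (U \<mu>)" and h = "\<lambda>\<nu>. \<nu>"]) (use norm_differences(1) in \<open>auto intro!: continuous_intros\<close>)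
  show "continuous_on {0<..} (\<lambda>\<mu>. L2_norm (W \<mu>))"
    by (rule *[where c = "\<lambda>\<mu>. L2_norm (U \<mu>)" and h = sqrt]) (use norm_differences(2) in \<open>auto intro!: continuous_intros\<close>)
qed

text \<open>\<open>energy_le\<close> against the parameter 1 bounds \<mu> ||U \<mu>||^2 by
  \<open>K\<close>, so \<mu> ||U \<mu>|| is at most of order sqrt \<mu>, while ||W \<mu>|| stays
  above \<open>m\<close>.\<close>

lemma exists_small_parameter:
  assumes "\<delta> > 0"
  obtains \<mu> where "0 < \<mu>" "\<mu> \<le> 1" "\<delta> * \<mu> * L2_norm (U \<mu>) \<le> L2_norm (W \<mu>)"
proof -
  obtain m where m: "m > 0" "\<And>\<mu>. \<mu> > 0 \<Longrightarrow> m \<le> L2_norm (W \<mu>)" using norm_W_lower_bound by metis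
  define K where "K = (L2_norm (W 1))\<^sup>2 + (L2_norm (U 1))\<^sup>2 + 1"
  have K: "K > 0" by (simp add: K_def add_nonneg_pos)
  \<comment> \<open>Chosen for \<delta>^2 \<mu> K <= m^2; the cut at 1 is what lets \<open>K\<close>
    bound the energy.\<close>
  define \<mu> where "\<mu> = min 1 (m\<^sup>2 / (\<delta>\<^sup>2 * K))"
  have \<mu>: "\<mu> > 0" "\<mu> \<le> 1" "\<mu> \<le> m\<^sup>2 / (\<delta>\<^sup>2 * K)" using m K assms by (auto simp: \<mu>_def)
  have "\<mu> * (L2_norm (U \<mu>))\<^sup>2 \<le> (L2_norm (W 1))\<^sup>2 + \<mu> * (L2_norm (U 1))\<^sup>2"
    using energy_le[OF \<mu>(1), of 1] zero_le_power2[of "L2_norm (W \<mu>)"] by linarith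
  also have "\<dots> \<le> K" using mult_right_mono[OF \<mu>(2), of "(L2_norm (U 1))\<^sup>2"] by (simp add: K_def)
  finally have le: "\<mu> * (L2_norm (U \<mu>))\<^sup>2 \<le> K" .
  have "(\<delta> * \<mu> * L2_norm (U \<mu>))\<^sup>2 = \<delta>\<^sup>2 * \<mu> * (\<mu> * (L2_norm (U \<mu>))\<^sup>2)"
    by (simp add: power2_eq_square mult_ac)
  also have "\<dots> \<le> \<delta>\<^sup>2 * \<mu> * K" using le \<mu> by (intro mult_left_mono) auto
  also have "\<dots> \<le> m\<^sup>2" using \<mu>(3) pos_le_divide_eq[of "\<delta>\<^sup>2 * K" \<mu> "m\<^sup>2"] K assms by (simp add: mult_ac)
  finally have "\<delta> * \<mu> * L2_norm (U \<mu>) \<le> m" by (rule power2_le_imp_le) (use m(1) in simp)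
  then show thesis using that[of \<mu>] \<mu> m(2)[OF \<mu>(1)] by linarith
qed

text \<open>If the inequality failed for all \<mu> >= 1, the representation for the parameter 1
  would bound ||W \<mu>|| by \<open>B\<close>, and ||U \<mu>|| <= B/(\<delta> \<mu>) would tend to
  0. In the limit \<open>D_bound\<close> would bound the functional by B times the L2 norm, against
  a test function of norm below 1/(2B).\<close>

lemma exists_large_parameter:
  assumes "\<delta> > 0"
  obtains \<mu> where "1 \<le> \<mu>" "L2_norm (W \<mu>) \<le> \<delta> * \<mu> * L2_norm (U \<mu>)"
proof (rule ccontr)
  assume "\<not> thesis"
  then have lt: "\<delta> * \<mu> * L2_norm (U \<mu>) < L2_norm (W \<mu>)" if "1 \<le> \<mu>" for \<mu>
    using that \<open>\<And>\<mu>. 1 \<le> \<mu> \<Longrightarrow> L2_norm (W \<mu>) \<le> \<delta> * \<mu> * L2_norm (U \<mu>) \<Longrightarrow> thesis\<close> by force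
  define B where "B = L2_norm (W 1) + L2_norm (U 1) / \<delta>"
  have B: "B > 0" using norm_W_pos[of 1] assms by (simp add: B_def add_pos_nonneg)
  have one: "(1::real) > 0" by simp
  have WB: "L2_norm (W \<mu>) \<le> B" if "1 \<le> \<mu>" for \<mu>
  proof -
    have \<mu>: "\<mu> > 0" using that by simp
    have "(L2_norm (W \<mu>))\<^sup>2 \<le> D (W \<mu>)" using D_W_self[OF \<mu>] \<mu> by simp
    also have "\<dots> \<le> L2_norm (W \<mu>) * L2_norm (W 1) + \<mu> * (L2_norm (U \<mu>) * L2_norm (U 1))"
      unfolding D_W[OF \<mu> one]
      using \<mu> L2_Cauchy_Schwarz[OF W_L2[OF \<mu>] W_L2[of 1]] L2_Cauchy_Schwarz[OF U_L2[OF \<mu>] U_L2[of 1]]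
      by (intro add_mono mult_left_mono) auto
    also have "\<mu> * (L2_norm (U \<mu>) * L2_norm (U 1)) \<le> L2_norm (W \<mu>) * (L2_norm (U 1) / \<delta>)"
      using mult_right_mono[OF less_imp_le[OF lt[OF that]], of "L2_norm (U 1)"] assms by (simp add: field_simps)
    finally have "L2_norm (W \<mu>) * L2_norm (W \<mu>) \<le> L2_norm (W \<mu>) * B"
      by (simp add: B_def power2_eq_square algebra_simps)
    then show ?thesis using norm_W_pos[OF \<mu>] by (simp add: mult_le_cancel_left)
  qed
  obtain f where f: "f \<in> L2_deriv {-1..1} r" "D f = 1" "L2_norm f < 1 / (2 * B)"
    using exists_small_test_function[OF k t, of "1 / (2 * B)"] B by auto
  define C where "C = L2_norm (deriv_on {-1..1} r f)"
  have C: "C \<ge> 0" by (simp add: C_def)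
  \<comment> \<open>Makes C B/(\<delta> \<mu>) < 1/2, so that neither term of \<open>D_bound\<close>
    exceeds half of \<open>D f = 1\<close>.\<close>
  define \<mu> where "\<mu> = 1 + 2 * C * B / \<delta>"
  have \<mu>: "1 \<le> \<mu>" using C B assms by (simp add: \<mu>_def)
  then have \<mu>0: "\<mu> > 0" by simp
  have "\<delta> * \<mu> * L2_norm (U \<mu>) \<le> B" using lt[OF \<mu>] WB[OF \<mu>] by linarith
  then have "C * (\<delta> * \<mu> * L2_norm (U \<mu>)) \<le> C * B" using C by (rule mult_left_mono)
  moreover have "2 * C * B < \<delta> * \<mu>" using assms by (simp add: \<mu>_def field_simps)
  ultimately have "\<delta> * \<mu> * (2 * (C * L2_norm (U \<mu>))) < \<delta> * \<mu> * 1" by (simp add: mult_ac)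
  then have 1: "C * L2_norm (U \<mu>) < 1 / 2" using assms \<mu>0 by (simp add: mult_less_cancel_left)
  have "L2_norm f * L2_norm (W \<mu>) \<le> 1 / (2 * B) * B"
    using f(3) WB[OF \<mu>] B by (intro mult_mono) auto
  then have "L2_norm f * L2_norm (W \<mu>) \<le> 1 / 2" using B by simp
  then have "\<bar>D f\<bar> < 1" using D_bound[OF \<mu>0 f(1)] 1 unfolding C_def by linarith
  then show False using f(2) by simp
qed

section \<open>Existence and uniqueness of the parameter\<close>

lemma parameter_exists:
  assumes "\<delta> > 0"
  obtains \<mu> where "\<mu> > 0" "\<delta> * \<mu> * L2_norm (U \<mu>) = L2_norm (W \<mu>)"
proof -
  define h where "h \<mu> = L2_norm (W \<mu>) - \<delta> * \<mu> * L2_norm (U \<mu>)" for \<mu>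
  obtain a where a: "0 < a" "a \<le> 1" "h a \<ge> 0" using exists_small_parameter[OF assms] unfolding h_def by (metis diff_ge_0_iff_ge)
  obtain b where b: "1 \<le> b" "h b \<le> 0" using exists_large_parameter[OF assms] unfolding h_def by (metis diff_le_0_iff_le)
  have "continuous_on {a..b} h" unfolding h_def
    using a by (intro continuous_intros continuous_on_subset[OF continuous_on_norms(1)] continuous_on_subset[OF continuous_on_norms(2)]) auto
  then obtain x where "a \<le> x" "x \<le> b" "h x = 0" using IVT2'[of h b 0 a] a b by auto
  then show thesis using that[of x] a by (simp add: h_def)
qed

text \<open>Under the two equations, \<open>D_W\<close> in either order with Cauchy-Schwarz compares
  p (1 + \<delta>^2 \<mu>) with q (1 + \<delta>^2 \<nu>), in opposite directions. So the
  Cauchy-Schwarz inequalities used are equalities.\<close>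

lemma parameter_unique:
  assumes "\<delta> > 0" "\<mu> > 0" "\<nu> > 0"
    and eq: "\<delta> * \<mu> * L2_norm (U \<mu>) = L2_norm (W \<mu>)" "\<delta> * \<nu> * L2_norm (U \<nu>) = L2_norm (W \<nu>)"
  shows "\<mu> = \<nu>"
proof -
  define p q where "p = L2_norm (U \<mu>)" and "q = L2_norm (U \<nu>)"
  have pq: "p > 0" "q > 0" using norm_U_pos assms by (auto simp: p_def q_def)
  have W: "L2_norm (W \<mu>) = \<delta> * \<mu> * p" "L2_norm (W \<nu>) = \<delta> * \<nu> * q" using eq by (auto simp: p_def q_def)
  define x y where "x = L2_inner (W \<mu>) (W \<nu>)" and "y = L2_inner (U \<mu>) (U \<nu>)"
  have cs: "x \<le> L2_norm (W \<mu>) * L2_norm (W \<nu>)" "y \<le> p * q"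
    using L2_Cauchy_Schwarz[OF W_L2 W_L2, OF assms(2,3)] L2_Cauchy_Schwarz[OF U_L2 U_L2, OF assms(2,3)]
    by (auto simp: x_def y_def p_def q_def)
  have D\<mu>: "x + \<mu> * y = \<mu> * p\<^sup>2 * (1 + \<delta>\<^sup>2 * \<mu>)"
    using D_W[OF assms(2,3)] D_W_self[OF assms(2)] W(1) by (simp add: x_def y_def p_def power2_eq_square algebra_simps)
  have D\<nu>: "x + \<nu> * y = \<nu> * q\<^sup>2 * (1 + \<delta>\<^sup>2 * \<nu>)"
    using D_W[OF assms(3,2)] D_W_self[OF assms(3)] W(2)
    by (simp add: x_def y_def q_def power2_eq_square algebra_simps L2_inner_commute)
  have "\<mu> * p\<^sup>2 * (1 + \<delta>\<^sup>2 * \<mu>) \<le> \<delta> * \<mu> * p * (\<delta> * \<nu> * q) + \<mu> * (p * q)"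
    unfolding D\<mu>[symmetric] using cs assms by (intro add_mono mult_left_mono) (auto simp: W)
  then have "(\<mu> * p) * (p * (1 + \<delta>\<^sup>2 * \<mu>)) \<le> (\<mu> * p) * (q * (1 + \<delta>\<^sup>2 * \<nu>))"
    by (simp add: power2_eq_square algebra_simps)
  then have 1: "p * (1 + \<delta>\<^sup>2 * \<mu>) \<le> q * (1 + \<delta>\<^sup>2 * \<nu>)" using assms pq by (simp add: mult_le_cancel_left)
  have "\<nu> * q\<^sup>2 * (1 + \<delta>\<^sup>2 * \<nu>) \<le> \<delta> * \<mu> * p * (\<delta> * \<nu> * q) + \<nu> * (p * q)"
    unfolding D\<nu>[symmetric] using cs assms by (intro add_mono mult_left_mono) (auto simp: W)
  then have "(\<nu> * q) * (q * (1 + \<delta>\<^sup>2 * \<nu>)) \<le> (\<nu> * q) * (p * (1 + \<delta>\<^sup>2 * \<mu>))"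
    by (simp add: power2_eq_square algebra_simps)
  then have 2: "q * (1 + \<delta>\<^sup>2 * \<nu>) \<le> p * (1 + \<delta>\<^sup>2 * \<mu>)" using assms pq by (simp add: mult_le_cancel_left)
  have pq_eq: "p * (1 + \<delta>\<^sup>2 * \<mu>) = q * (1 + \<delta>\<^sup>2 * \<nu>)" using 1 2 by simp
  have sum_eq: "x + \<mu> * y = L2_norm (W \<mu>) * L2_norm (W \<nu>) + \<mu> * (p * q)"
  proof -
    have "x + \<mu> * y = \<mu> * p * (p * (1 + \<delta>\<^sup>2 * \<mu>))" unfolding D\<mu> by (simp add: power2_eq_square)
    then show ?thesis unfolding pq_eq W by (simp add: power2_eq_square algebra_simps)
  qed
  \<comment> \<open>Two upper bounds whose sum is attained are both attained.\<close>
  have "\<mu> * y \<le> \<mu> * (p * q)" using cs assms by (intro mult_left_mono) auto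
  then have x_eq: "x = L2_norm (W \<mu>) * L2_norm (W \<nu>)" and "\<mu> * y = \<mu> * (p * q)" using sum_eq cs by linarith+
  then have y_eq: "y = p * q" using assms by simp
  have WAE: "AE z in lebesgue_on {-1..1}. L2_norm (W \<nu>) * W \<mu> z = L2_norm (W \<mu>) * W \<nu> z"
    using L2_Cauchy_Schwarz_eq[OF W_L2 W_L2, OF assms(2,3)] x_eq by (simp add: x_def)
  have UAE: "AE z in lebesgue_on {-1..1}. q * U \<mu> z = p * U \<nu> z"
    using L2_Cauchy_Schwarz_eq[OF U_L2 U_L2, OF assms(2,3)] y_eq by (simp add: y_def p_def q_def)
  have Wint: "L2_norm (W \<nu>) * L2_inner f (W \<mu>) = L2_norm (W \<mu>) * L2_inner f (W \<nu>)" if "f \<in> L2 {-1..1}" for f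
  proof -
    have "L2_inner (\<lambda>z. L2_norm (W \<nu>) * W \<mu> z) f = L2_inner (\<lambda>z. L2_norm (W \<mu>) * W \<nu> z) f"
      by (rule L2_inner_cong_AE) (use W_L2 assms that WAE in \<open>auto intro!: L2_scale\<close>)
    then show ?thesis unfolding L2_inner_scale by (simp add: L2_inner_commute)
  qed
  have Uint: "q * L2_inner f (U \<mu>) = p * L2_inner f (U \<nu>)" if "f \<in> L2 {-1..1}" for f
  proof -
    have "L2_inner (\<lambda>z. q * U \<mu> z) f = L2_inner (\<lambda>z. p * U \<nu> z) f"
      by (rule L2_inner_cong_AE) (use U_L2 assms that UAE in \<open>auto intro!: L2_scale\<close>)
    then show ?thesis unfolding L2_inner_scale by (simp add: L2_inner_commute)
  qed
  \<comment> \<open>Both \<open>W \<mu>\<close> and \<open>W \<nu>\<close> have inner product 1 with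
    a flat test function, so the factor of proportionality between them is 1.\<close>
  obtain f where f: "f \<in> L2_deriv {-1..1} r" "D f = 1" "\<And>x. x \<in> {-1..1} \<Longrightarrow> deriv_on {-1..1} r f x = 0"
    using exists_flat_test_function[OF k t] by metis
  have "L2_inner (deriv_on {-1..1} r f) g = 0" for g
    unfolding L2_inner_def
    by (rule integral_eq_zero_AE) (use f(3) in \<open>auto intro!: AE_I2 simp: space_restrict_space\<close>)
  then have "L2_inner f (W \<mu>) = 1" "L2_inner f (W \<nu>) = 1"
    using representation[OF _ f(1)] f(2) assms by auto
  then have W_eq: "L2_norm (W \<mu>) = L2_norm (W \<nu>)" using Wint[OF L2_deriv_L2(1)[OF f(1)]] by simp
  \<comment> \<open>\<open>W \<mu>\<close> may now replace \<open>W \<nu>\<close> in the inner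
    product, and comparing \<open>D_W\<close> with \<open>D_W_self\<close> leaves p^2 = p q.\<close>
  have "L2_inner (W \<mu>) (W \<mu>) = L2_inner (W \<mu>) (W \<nu>)"
    using Wint[OF W_L2[OF assms(2)]] W_eq norm_W_pos[OF assms(3)] by simp
  then have "(L2_norm (W \<mu>))\<^sup>2 + \<mu> * p\<^sup>2 = (L2_norm (W \<mu>))\<^sup>2 + \<mu> * y"
    using D_W[OF assms(2,3)] D_W_self[OF assms(2)] by (simp add: p_def y_def L2_norm_power2)
  then have "p = q" using y_eq pq assms by (simp add: power2_eq_square)
  then show ?thesis using W_eq W pq assms by simp
qed

lemma extremal_function:
  assumes "\<delta> > 0" "\<mu> > 0" and eq: "\<delta> * \<mu> * L2_norm (U \<mu>) = L2_norm (W \<mu>)"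
  obtains f where "f \<in> W2 r" "L2_norm f \<le> \<delta>" "D f = L2_norm (W \<mu>) * \<delta> + L2_norm (U \<mu>)"
proof -
  define p where "p = L2_norm (U \<mu>)"
  have p: "p > 0" using norm_U_pos assms by (simp add: p_def)
  \<comment> \<open>Normalizes the r-th derivative of the scaled \<open>W \<mu>\<close> to norm 1;
    the equation for \<mu> then makes its own norm exactly \<delta>, so both constraints are
    active.\<close>
  define c where "c = 1 / (\<mu> * p)"
  have c: "c > 0" "c * (\<mu> * p) = 1" using p assms by (auto simp: c_def)
  have r: "r \<ge> 1" using k by simp
  have f: "(\<lambda>x. c * W \<mu> x) \<in> L2_deriv {-1..1} r" using L2_deriv_scale(1)[OF W_L2_deriv[OF assms(2)] r] .
  have ae: "AE x in lebesgue_on {-1..1}. deriv_on {-1..1} r (\<lambda>x. c * W \<mu> x) x = c * ((-1)^(r + 1) * \<mu>) * U \<mu> x"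
    using L2_deriv_scale(3)[OF W_L2_deriv[OF assms(2)] r, of c] W_deriv[OF assms(2)]
    by eventually_elim simp
  have "L2_norm (deriv_on {-1..1} r (\<lambda>x. c * W \<mu> x)) = L2_norm (\<lambda>x. c * ((-1)^(r + 1) * \<mu>) * U \<mu> x)"
    by (rule L2_norm_cong_AE[OF L2_deriv_L2(2)[OF f] L2_scale[OF U_L2[OF assms(2)]] ae])
  also have "\<dots> = c * (\<mu> * p)"
    unfolding L2_norm_scale using c assms by (simp add: abs_mult power_abs p_def)
  finally have 1: "L2_norm (deriv_on {-1..1} r (\<lambda>x. c * W \<mu> x)) = 1" using c by simp
  have 2: "L2_norm (\<lambda>x. c * W \<mu> x) = \<delta>"
  proof -
    have "L2_norm (\<lambda>x. c * W \<mu> x) = c * (\<delta> * \<mu> * p)" unfolding L2_norm_scale using c eq by (simp add: p_def)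
    also have "\<dots> = \<delta> * (c * (\<mu> * p))" by (simp add: mult_ac)
    finally show ?thesis using c by simp
  qed
  have "D (\<lambda>x. c * W \<mu> x) = c * D (W \<mu>)"
    by (rule L2_deriv_scale(2)[OF W_L2_deriv[OF assms(2)] r k]) (use t in auto)
  also have "\<dots> = c * (L2_norm (W \<mu>) * (\<delta> * \<mu> * p) + \<mu> * p * p)"
    using D_W_self[OF assms(2)] eq by (simp add: power2_eq_square p_def)
  also have "\<dots> = (c * (\<mu> * p)) * (L2_norm (W \<mu>) * \<delta> + p)" by (simp add: algebra_simps)
  finally have 3: "D (\<lambda>x. c * W \<mu> x) = L2_norm (W \<mu>) * \<delta> + p" using c by simp
  show thesis
    by (rule that[of "\<lambda>x. c * W \<mu> x"]) (use f 1 2 3 in \<open>auto simp: W2_def p_def\<close>)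
qed

section \<open>The modulus and the recovery error\<close>

lemma modulus_eq:
  assumes "\<delta> > 0" "\<mu> > 0" and eq: "\<delta> * \<mu> * L2_norm (U \<mu>) = L2_norm (W \<mu>)"
  shows "modulus r k t \<delta> = ereal (L2_norm (W \<mu>) * \<delta> + L2_norm (U \<mu>))"
proof (rule antisym)
  show "modulus r k t \<delta> \<le> ereal (L2_norm (W \<mu>) * \<delta> + L2_norm (U \<mu>))"
    unfolding modulus_def
  proof (rule Sup_least, clarify)
    fix f assume f: "f \<in> W2 r" "L2_norm f \<le> \<delta>"
    then have f': "f \<in> L2_deriv {-1..1} r" "L2_norm (deriv_on {-1..1} r f) \<le> 1" by (auto simp: W2_def)
    have "\<bar>D f\<bar> \<le> L2_norm f * L2_norm (W \<mu>) + L2_norm (deriv_on {-1..1} r f) * L2_norm (U \<mu>)"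
      by (rule D_bound[OF assms(2) f'(1)])
    also have "\<dots> \<le> \<delta> * L2_norm (W \<mu>) + 1 * L2_norm (U \<mu>)"
      using f f' by (intro add_mono mult_right_mono) auto
    finally show "ereal \<bar>D f\<bar> \<le> ereal (L2_norm (W \<mu>) * \<delta> + L2_norm (U \<mu>))" by (simp add: mult.commute)
  qed
  obtain f where f: "f \<in> W2 r" "L2_norm f \<le> \<delta>" "D f = L2_norm (W \<mu>) * \<delta> + L2_norm (U \<mu>)"
    using extremal_function[OF assms] by metis
  have "ereal (L2_norm (W \<mu>) * \<delta> + L2_norm (U \<mu>)) \<le> ereal \<bar>D f\<bar>" using f(3) by simp
  also have "\<dots> \<le> modulus r k t \<delta>" unfolding modulus_def by (rule Sup_upper) (use f(1,2) in blast)
  finally show "ereal (L2_norm (W \<mu>) * \<delta> + L2_norm (U \<mu>)) \<le> modulus r k t \<delta>" .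
qed

text \<open>The data \<open>g = 0\<close> are admissible for f and for -f, and whatever number S
  assigns to them misses one of \<open>D f\<close> and \<open>- D f\<close> by at least |D f|. The
  argument is the same for linear and for arbitrary S.\<close>

lemma modulus_le_recovery_error:
  shows "modulus r k t \<delta> \<le> recovery_error \<delta> R r k t"
  unfolding recovery_error_def
proof (rule INF_greatest)
  fix S
  let ?E = "{ereal \<bar>D f - S g\<bar> |f g. f \<in> W2 r \<and> g \<in> L2 {-1..1} \<and> L2_norm (\<lambda>x. f x - g x) \<le> \<delta>}"
  show "modulus r k t \<delta> \<le> Sup ?E"
    unfolding modulus_def
  proof (rule Sup_least, clarify)
    fix f assume f: "f \<in> W2 r" "L2_norm f \<le> \<delta>"
    then have f': "f \<in> L2_deriv {-1..1} r" "L2_norm (deriv_on {-1..1} r f) \<le> 1" by (auto simp: W2_def)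
    have r: "r \<ge> 1" using k by simp
    note sc = L2_deriv_scale[OF f'(1) r, where c = "-1"]
    have m: "(\<lambda>x. - f x) \<in> L2_deriv {-1..1} r" "D (\<lambda>x. - f x) = - D f"
      using sc(1) sc(2)[OF k, of t] t by auto
    have "L2_norm (deriv_on {-1..1} r (\<lambda>x. -1 * f x)) = L2_norm (\<lambda>x. -1 * deriv_on {-1..1} r f x)"
      using L2_norm_cong_AE[OF L2_scale[OF L2_deriv_L2(2)[OF f'(1)]] L2_deriv_L2(2)[OF sc(1)] sc(3)] by simp
    then have mW: "(\<lambda>x. - f x) \<in> W2 r" using m(1) f'(2) L2_norm_scale[of "-1" "deriv_on {-1..1} r f"] by (simp add: W2_def)
    have mn: "L2_norm (\<lambda>x. - f x) \<le> \<delta>" using f(2) L2_norm_scale[of "-1" f] by simp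
    have "ereal \<bar>D f - S (\<lambda>x. 0)\<bar> \<le> Sup ?E"
      by (rule Sup_upper, rule CollectI, rule exI[of _ f], rule exI[of _ "\<lambda>x. 0"]) (use f L2_zero in simp)
    moreover have "ereal \<bar>D (\<lambda>x. - f x) - S (\<lambda>x. 0)\<bar> \<le> Sup ?E"
      by (rule Sup_upper, rule CollectI, rule exI[of _ "\<lambda>x. - f x"], rule exI[of _ "\<lambda>x. 0"]) (use mW mn L2_zero in simp)
    moreover have "\<bar>D f\<bar> \<le> \<bar>D f - S (\<lambda>x. 0)\<bar> \<or> \<bar>D f\<bar> \<le> \<bar>D (\<lambda>x. - f x) - S (\<lambda>x. 0)\<bar>"
      unfolding m(2) by linarith
    ultimately show "ereal \<bar>D f\<bar> \<le> Sup ?E"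
      by (meson ereal_less_eq(3) order_trans)
  qed
qed

lemma L2_inner_W_linear_map:
  assumes "\<mu> > 0"
  shows "(\<lambda>g. L2_inner g (W \<mu>)) \<in> linear_maps"
  unfolding linear_maps_def all_maps_def
proof (intro CollectI conjI ballI allI impI)
  fix f g assume "f \<in> L2 {-1..1}" "g \<in> L2 {-1..1}" "AE x in lebesgue_on {-1..1}. f x = g x"
  then show "L2_inner f (W \<mu>) = L2_inner g (W \<mu>)"
    using W_L2[OF assms] by (intro L2_inner_cong_AE) auto
next
  fix f g a b assume "f \<in> L2 {-1..1}" "g \<in> L2 {-1..1}"
  then show "L2_inner (\<lambda>x. a * f x + b * g x) (W \<mu>) = a * L2_inner f (W \<mu>) + b * L2_inner g (W \<mu>)"
    using W_L2[OF assms] by (intro L2_inner_linear)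
qed

lemma recovery_error_le:
  assumes "\<mu> > 0" "linear_maps \<subseteq> R"
  shows "recovery_error \<delta> R r k t \<le> ereal (L2_norm (W \<mu>) * \<delta> + L2_norm (U \<mu>))"
proof -
  have "(\<lambda>g. L2_inner g (W \<mu>)) \<in> R" using L2_inner_W_linear_map assms by blast
  then have "recovery_error \<delta> R r k t \<le> Sup {ereal \<bar>D f - L2_inner g (W \<mu>)\<bar> | f g.
        f \<in> W2 r \<and> g \<in> L2 {-1..1} \<and> L2_norm (\<lambda>x. f x - g x) \<le> \<delta>}"
    unfolding recovery_error_def by (rule INF_lower)
  also have "\<dots> \<le> ereal (L2_norm (W \<mu>) * \<delta> + L2_norm (U \<mu>))"
  proof (rule Sup_least, clarify)
    fix f g assume f: "f \<in> W2 r" and g: "g \<in> L2 {-1..1}" "L2_norm (\<lambda>x. f x - g x) \<le> \<delta>"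
    then have f': "f \<in> L2_deriv {-1..1} r" "L2_norm (deriv_on {-1..1} r f) \<le> 1" by (auto simp: W2_def)
    have "\<bar>D f - L2_inner g (W \<mu>)\<bar> \<le> L2_norm (\<lambda>x. f x - g x) * L2_norm (W \<mu>) + L2_norm (deriv_on {-1..1} r f) * L2_norm (U \<mu>)"
      by (rule recovery_bound[OF assms(1) f'(1) g(1)])
    also have "\<dots> \<le> \<delta> * L2_norm (W \<mu>) + 1 * L2_norm (U \<mu>)"
      using g f' by (intro add_mono mult_right_mono) auto
    finally show "ereal \<bar>D f - L2_inner g (W \<mu>)\<bar> \<le> ereal (L2_norm (W \<mu>) * \<delta> + L2_norm (U \<mu>))"
      by (simp add: mult.commute)
  qed
  finally show ?thesis .
qed

end

lemma recovery_exists: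
  assumes k: "k < r" and t: "-1 < t" "t < 1"
  obtains U W where "recovery r k t U W"
    "\<And>\<mu>. \<mu> > 0 \<Longrightarrow> L2_norm (u_sol r k \<mu> t) = L2_norm (U \<mu>)"
    "\<And>\<mu>. \<mu> > 0 \<Longrightarrow> L2_norm (u_deriv r k \<mu> t r) = L2_norm (W \<mu>)"
proof -
  have "\<forall>\<mu>. \<exists>L R. \<mu> > 0 \<longrightarrow> green r k \<mu> t 1 L R"
    using green_exists[OF k t] by metis
  then obtain L R where gr: "\<And>\<mu>. \<mu> > 0 \<Longrightarrow> green r k \<mu> t 1 (L \<mu>) (R \<mu>)" by metis
  show thesis
  proof (rule that[of "\<lambda>\<mu>. glue t (L \<mu> 0) (R \<mu> 0)" "\<lambda>\<mu>. glue t (L \<mu> r) (R \<mu> r)"])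
    show "recovery r k t (\<lambda>\<mu>. glue t (L \<mu> 0) (R \<mu> 0)) (\<lambda>\<mu>. glue t (L \<mu> r) (R \<mu> r))"
    proof
      fix \<mu> :: real assume \<mu>: "\<mu> > 0"
      interpret green r k \<mu> t 1 "L \<mu>" "R \<mu>" by (rule gr[OF \<mu>])
      show "G 0 \<in> L2 {-1..1}" by (rule G_L2) simp
      show "G r \<in> L2_deriv {-1..1} r" by (rule G_L2_deriv)
      show "AE x in lebesgue_on {-1..1}. deriv_on {-1..1} r (G r) x = (-1)^(r + 1) * \<mu> * G 0 x"
        by (rule G_deriv_on_AE)
      show "deriv_on {-1..1} k f t = L2_inner f (G r) + (-1)^(r + 1) * L2_inner (deriv_on {-1..1} r f) (G 0)"
        if "f \<in> L2_deriv {-1..1} r" for f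
        using reproducing[OF that] by simp
    qed (use k t in auto)
  next
    fix \<mu> :: real assume \<mu>: "\<mu> > 0"
    interpret green r k \<mu> t 1 "L \<mu>" "R \<mu>" by (rule gr[OF \<mu>])
    show "L2_norm (u_sol r k \<mu> t) = L2_norm (G 0)" by (rule L2_norm_u(1)[OF refl \<mu>])
    show "L2_norm (u_deriv r k \<mu> t r) = L2_norm (G r)" by (rule L2_norm_u(2)[OF refl \<mu>]) simp
  qed
qed

theorem theorem4:
  fixes r k :: nat and t \<delta> :: real and R :: "((real \<Rightarrow> real) \<Rightarrow> real) set"
  assumes "r \<ge> 1" and "k \<le> r - 1"
    and "t \<in> {-1<..<1}"
    and "R = all_maps \<or> R = linear_maps"
    and "\<delta> > 0"
  shows "(\<exists>!\<mu>::real. \<mu> > 0 \<and>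
            \<delta> * \<mu> * L2_norm (u_sol r k \<mu> t) = L2_norm (u_deriv r k \<mu> t r)) \<and>
         (\<forall>\<mu>>0. \<delta> * \<mu> * L2_norm (u_sol r k \<mu> t) = L2_norm (u_deriv r k \<mu> t r) \<longrightarrow>
            modulus r k t \<delta> = recovery_error \<delta> R r k t \<and>
            recovery_error \<delta> R r k t =
              ereal (L2_norm (u_deriv r k \<mu> t r) * \<delta> + L2_norm (u_sol r k \<mu> t)))"
proof -
  have k: "k < r" and t: "-1 < t" "t < 1" using assms by auto
  obtain U W where rec: "recovery r k t U W"
    and norms: "\<And>\<mu>. \<mu> > 0 \<Longrightarrow> L2_norm (u_sol r k \<mu> t) = L2_norm (U \<mu>)"
      "\<And>\<mu>. \<mu> > 0 \<Longrightarrow> L2_norm (u_deriv r k \<mu> t r) = L2_norm (W \<mu>)"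
    using recovery_exists[OF k t] by metis
  interpret recovery r k t U W by (rule rec)
  \<comment> \<open>One upper bound covers both classes, because the optimal method is
    linear.\<close>
  have sub: "linear_maps \<subseteq> R" using assms(4) by (auto simp: linear_maps_def)
  show ?thesis
  proof (intro conjI allI impI)
    obtain \<mu> where \<mu>: "\<mu> > 0" "\<delta> * \<mu> * L2_norm (U \<mu>) = L2_norm (W \<mu>)"
      using parameter_exists[OF \<open>\<delta> > 0\<close>] by metis
    show "\<exists>!\<mu>. \<mu> > 0 \<and> \<delta> * \<mu> * L2_norm (u_sol r k \<mu> t) = L2_norm (u_deriv r k \<mu> t r)"
    proof (rule ex1I[of _ \<mu>])
      show "\<mu> > 0 \<and> \<delta> * \<mu> * L2_norm (u_sol r k \<mu> t) = L2_norm (u_deriv r k \<mu> t r)"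
        using \<mu> norms by simp
      fix \<nu> assume \<nu>: "\<nu> > 0 \<and> \<delta> * \<nu> * L2_norm (u_sol r k \<nu> t) = L2_norm (u_deriv r k \<nu> t r)"
      then have "\<delta> * \<nu> * L2_norm (U \<nu>) = L2_norm (W \<nu>)" using norms[of \<nu>] by simp
      then show "\<nu> = \<mu>" using parameter_unique[OF \<open>\<delta> > 0\<close> _ \<mu>(1) _ \<mu>(2), of \<nu>] \<nu> by simp
    qed
  next
    fix \<mu> assume \<mu>: "\<mu> > 0" "\<delta> * \<mu> * L2_norm (u_sol r k \<mu> t) = L2_norm (u_deriv r k \<mu> t r)"
    then have eq: "\<delta> * \<mu> * L2_norm (U \<mu>) = L2_norm (W \<mu>)" using norms by simp
    \<comment> \<open>The modulus bounds the error from below, the linear method bounds it from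
      above, and the two values agree.\<close>
    note modulus_eq[OF \<open>\<delta> > 0\<close> \<mu>(1) eq] modulus_le_recovery_error[of \<delta> R] recovery_error_le[OF \<mu>(1) sub, of \<delta>]
    then show "modulus r k t \<delta> = recovery_error \<delta> R r k t"
      and "recovery_error \<delta> R r k t = ereal (L2_norm (u_deriv r k \<mu> t r) * \<delta> + L2_norm (u_sol r k \<mu> t))"
      using norms[OF \<mu>(1)] by auto
  qed
qed

end
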